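(* Let $\Omega\subset\mathbb{R}^2$ be a bounded domain with $C^3$ smooth boundary $\Gamma$ and outward unit normal $\nu$. Let $\kappa>0$, $c>0$, $\beta_n=\frac{\kappa^2}{c^2}(n+1)$ for $n=0,1,\ldots$, and $\gamma=\kappa/c$, and let $\Phi_n$ be the functions defined in the context. Let $0<\alpha<1$ and $q_m\in C^{1,\alpha}(\Gamma)$, $m=0,1,\ldots$. Then for all $x\in\Gamma$ and $n=0,1,\ldots$, $$\frac{\partial}{\partial\nu(x)}\sum_{m=0}^n(\mathcal{D}_{n-m}q_m)(x)=\sum_{m=0}^n\left[(\mathcal{H}_{n-m}q_m)(x)-(\mathcal{L}_{n-m}q_m)(x)\right],$$ where $$(\mathcal{D}_ng)(x)=\frac1\pi\int_\Gamma g(y)\frac{\partial}{\partial\nu(y)}\Phi_n(x,y)\,ds(y),$$ $$(\mathcal{H}_ng)(x)=\frac1\pi\frac{d}{ds(x)}\int_\Gamma\frac{dg}{ds}(y)\,\Phi_n(x,y)\,ds(y),$$ $$(\mathcal{L}_ng)(x)=\frac1\pi\,\nu(x)\cdot\int_\Gamma g(y)\,\nu(y)\sum_{k=0}^n\beta_{n-k}\Phi_k(x,y)\,ds(y).$$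
   Context: The functions $\Phi_n$: let $K_0,K_1$ be the modified Bessel functions of the second kind (modified Hankel/Macdonald functions) of orders $0$ and $1$. Define real numbers $a_{n,k}$, $0\le k\le n$, by $a_{n,0}=1$ for $n\ge0$; $a_{n,n}=-\frac{1}{2\gamma n}\beta_1a_{n-1,n-1}$ for $n\ge1$; and $$a_{n,k}=\frac{1}{2\gamma k}\left\{4\left[\tfrac{k+1}{2}\right]^2a_{n,k+1}-\sum_{m=k-1}^{n-1}\beta_{n-m}a_{m,k-1}\right\},\qquad k=n-1,\ldots,1,$$ where $[\cdot]$ denotes the integer part. Set $$v_n(r)=\sum_{k=0}^{[n/2]}a_{n,2k}r^{2k},\qquad w_n(r)=\sum_{k=0}^{[(n-1)/2]}a_{n,2k+1}r^{2k+1},\qquad w_0(r)=0,$$ and, for $x\ne y$ in $\mathbb{R}^2$, $$\Phi_n(x,y)=\Phi_n(|x-y|)=K_0(\gamma|x-y|)v_n(|x-y|)+K_1(\gamma|x-y|)w_n(|x-y|).$$ $d/ds$ denotes the derivative with respect to arc length along $\Gamma$. The normal derivative on the left-hand side is that of the double-layer potential $\mathcal{D}_{n-m}q_m$ considered as a function in $\Omega$, understood as the limit $\frac{\partial u}{\partial\nu}(x)=\lim_{h\to0^+}\nu(x)\cdot\nabla u(x-h\nu(x))$, $x\in\Gamma$. *)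

theory Defs
  imports "HOL-Analysis.Analysis"
begin

section \<open>Modified Bessel functions of integer order\<close>

definition bessel_I :: "nat \<Rightarrow> real \<Rightarrow> real" where
  "bessel_I n x = (\<Sum>k. (x / 2) ^ (2 * k + n) / (fact k * fact (n + k)))"

text \<open>The second kind (Macdonald function) on the positive axis, by its standard series; the
  library's \<open>Digamma\<close> satisfies \<open>Digamma (k + 1) = harm k - euler_mascheroni\<close> for natural \<open>k\<close>.\<close>

definition bessel_K :: "nat \<Rightarrow> real \<Rightarrow> real" where
  "bessel_K n x =
     1 / 2 * (\<Sum>k<n. fact (n - k - 1) / fact k * (- (x\<^sup>2 / 4)) ^ k) / (x / 2) ^ n
     + (- 1) ^ (n + 1) * ln (x / 2) * bessel_I n x
     + (- 1) ^ n * (1 / 2) * (x / 2) ^ n *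
         (\<Sum>k. (Digamma (real (k + 1)) + Digamma (real (n + k + 1))) * (x\<^sup>2 / 4) ^ k
               / (fact k * fact (n + k)))"


section \<open>The functions \<open>\<Phi>\<^sub>n\<close>\<close>

text \<open>Only the entries with \<open>k \<le> n\<close> are meaningful; the others are set to \<open>0\<close> and never used.
  Natural-number division renders the integer part.\<close>

function a_coeff :: "real \<Rightarrow> (nat \<Rightarrow> real) \<Rightarrow> nat \<Rightarrow> nat \<Rightarrow> real" where
  "a_coeff \<gamma> \<beta> n k =
     (if k = 0 then 1
      else if n < k then 0
      else if k = n then - (1 / (2 * \<gamma> * real n)) * \<beta> 1 * a_coeff \<gamma> \<beta> (n - 1) (n - 1)
      else 1 / (2 * \<gamma> * real k) *
             (4 * (real ((k + 1) div 2))\<^sup>2 * a_coeff \<gamma> \<beta> n (k + 1)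
              - (\<Sum>m\<in>{k - 1..n - 1}. \<beta> (n - m) * a_coeff \<gamma> \<beta> m (k - 1))))"
  by pat_completeness auto
termination
  by (relation "measures [\<lambda>(\<gamma>, \<beta>, n, k). n, \<lambda>(\<gamma>, \<beta>, n, k). n - k]") auto

declare a_coeff.simps [simp del]

definition v_fun :: "real \<Rightarrow> (nat \<Rightarrow> real) \<Rightarrow> nat \<Rightarrow> real \<Rightarrow> real" where
  "v_fun \<gamma> \<beta> n r = (\<Sum>k=0..n div 2. a_coeff \<gamma> \<beta> n (2 * k) * r ^ (2 * k))"

definition w_fun :: "real \<Rightarrow> (nat \<Rightarrow> real) \<Rightarrow> nat \<Rightarrow> real \<Rightarrow> real" where
  "w_fun \<gamma> \<beta> n r =
     (if n = 0 then 0
      else \<Sum>k=0..(n - 1) div 2. a_coeff \<gamma> \<beta> n (2 * k + 1) * r ^ (2 * k + 1))"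

definition Phi :: "real \<Rightarrow> (nat \<Rightarrow> real) \<Rightarrow> nat \<Rightarrow> real^2 \<Rightarrow> real^2 \<Rightarrow> real" where
  "Phi \<gamma> \<beta> n x y =
     bessel_K 0 (\<gamma> * dist x y) * v_fun \<gamma> \<beta> n (dist x y)
     + bessel_K 1 (\<gamma> * dist x y) * w_fun \<gamma> \<beta> n (dist x y)"


section \<open>Planar domains with smooth boundary\<close>

definition C_k :: "nat \<Rightarrow> (real \<Rightarrow> 'a::real_normed_vector) \<Rightarrow> bool" where
  "C_k k f \<longleftrightarrow>
     (\<exists>D. D 0 = f \<and> (\<forall>j<k. \<forall>t. (D j has_vector_derivative D (Suc j) t) (at t))
        \<and> continuous_on UNIV (D k :: real \<Rightarrow> 'a))"

definition rot90 :: "real^2 \<Rightarrow> real^2" where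
  "rot90 v = vector [- (v $ 2), v $ 1]"

text \<open>A simple closed curve of length \<open>L\<close> and class \<open>C\<^sup>3\<close>, parametrized by arc length and extended
  periodically to the real line.\<close>

definition C3_closed_curve :: "real \<Rightarrow> (real \<Rightarrow> real^2) \<Rightarrow> bool" where
  "C3_closed_curve L z \<longleftrightarrow>
     L > 0 \<and> C_k 3 z \<and> (\<forall>s. z (s + L) = z s) \<and> inj_on z {0..<L}
     \<and> (\<forall>s. norm (vector_derivative z (at s)) = 1)"

text \<open>Orthogonality to the boundary is expressed without reference to a parametrization.\<close>

definition outward_unit_normal :: "(real^2) set \<Rightarrow> (real^2 \<Rightarrow> real^2) \<Rightarrow> bool" where
  "outward_unit_normal \<Omega> \<nu> \<longleftrightarrow>
     (\<forall>x\<in>frontier \<Omega>.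
        norm (\<nu> x) = 1
        \<and> ((\<lambda>y. (\<nu> x \<bullet> (y - x)) / norm (y - x)) \<longlongrightarrow> 0) (at x within frontier \<Omega>)
        \<and> (\<forall>\<^sub>F h in at_right 0. x - h *\<^sub>R \<nu> x \<in> \<Omega> \<and> x + h *\<^sub>R \<nu> x \<notin> closure \<Omega>))"

text \<open>A bounded domain has \<open>C\<^sup>3\<close> boundary when its boundary is a disjoint union of finitely many
  simple closed \<open>C\<^sup>3\<close> curves, with the domain on one side of each. The finite set \<open>\<C>\<close> holds the
  boundary curves \<open>z\<close> with their lengths \<open>L\<close>; all of them are run through with the domain on the
  left, i.e. the unit tangent is the outward normal turned counterclockwise by a right angle.
  The domain need not be simply connected.\<close>

definition bounded_C3_domain ::
    "(real^2) set \<Rightarrow> (real^2 \<Rightarrow> real^2) \<Rightarrow> (real \<times> (real \<Rightarrow> real^2)) set \<Rightarrow> bool" where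
  "bounded_C3_domain \<Omega> \<nu> \<C> \<longleftrightarrow>
     open \<Omega> \<and> connected \<Omega> \<and> \<Omega> \<noteq> {} \<and> bounded \<Omega>
     \<and> outward_unit_normal \<Omega> \<nu>
     \<and> finite \<C>
     \<and> (\<forall>(L, z)\<in>\<C>. C3_closed_curve L z)
     \<and> disjoint_family_on (\<lambda>(L, z). range z) \<C>
     \<and> frontier \<Omega> = (\<Union>(L, z)\<in>\<C>. range z)
     \<and> (\<forall>(L, z)\<in>\<C>. \<forall>s. vector_derivative z (at s) = rot90 (\<nu> (z s)))"


section \<open>Calculus on the boundary\<close>

definition arc_integral ::
    "(real \<times> (real \<Rightarrow> real^2)) set \<Rightarrow> (real^2 \<Rightarrow> 'a::real_normed_vector) \<Rightarrow> 'a" where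
  "arc_integral \<C> f = (\<Sum>(L, z)\<in>\<C>. integral {0..L} (\<lambda>s. f (z s)))"

definition has_arc_derivative ::
    "(real \<times> (real \<Rightarrow> real^2)) set \<Rightarrow> (real^2 \<Rightarrow> real) \<Rightarrow> real \<Rightarrow> real^2 \<Rightarrow> bool" where
  "has_arc_derivative \<C> g d x \<longleftrightarrow>
     (\<exists>(L, z)\<in>\<C>. \<exists>s. z s = x \<and> ((\<lambda>t. g (z t)) has_real_derivative d) (at s))"

definition arc_deriv ::
    "(real \<times> (real \<Rightarrow> real^2)) set \<Rightarrow> (real^2 \<Rightarrow> real) \<Rightarrow> real^2 \<Rightarrow> real" where
  "arc_deriv \<C> g x = (THE d. has_arc_derivative \<C> g d x)"

text \<open>\<open>C\<^sup>1\<^sup>,\<^sup>\<alpha>(\<Gamma>)\<close>, where \<open>\<Gamma>\<close> is the union of the curves in \<open>\<C>\<close>; values off \<open>\<Gamma>\<close> are irrelevant.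
  The Hoelder condition implies continuity of the derivative.\<close>

definition C1_Hoelder ::
    "(real \<times> (real \<Rightarrow> real^2)) set \<Rightarrow> real \<Rightarrow> (real^2 \<Rightarrow> real) \<Rightarrow> bool" where
  "C1_Hoelder \<C> \<alpha> g \<longleftrightarrow>
     (\<forall>x\<in>(\<Union>(L, z)\<in>\<C>. range z). \<exists>d. has_arc_derivative \<C> g d x)
     \<and> (\<exists>M. \<forall>x\<in>(\<Union>(L, z)\<in>\<C>. range z). \<forall>y\<in>(\<Union>(L, z)\<in>\<C>. range z).
           \<bar>arc_deriv \<C> g x - arc_deriv \<C> g y\<bar> \<le> M * dist x y powr \<alpha>)"

definition grad :: "('a::real_inner \<Rightarrow> real) \<Rightarrow> 'a \<Rightarrow> 'a" where
  "grad f x = (THE D. GDERIV f x :> D)"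

text \<open>The one-sided normal derivative of a function given in \<open>\<Omega>\<close>, as a limit from inside;
  existence of the gradients near \<open>x\<close> and of the limit are part of the assertion.\<close>

definition has_interior_normal_derivative ::
    "(real^2 \<Rightarrow> real^2) \<Rightarrow> (real^2 \<Rightarrow> real) \<Rightarrow> real \<Rightarrow> real^2 \<Rightarrow> bool" where
  "has_interior_normal_derivative \<nu> u d x \<longleftrightarrow>
     (\<forall>\<^sub>F h in at_right 0. u differentiable at (x - h *\<^sub>R \<nu> x))
     \<and> ((\<lambda>h. \<nu> x \<bullet> grad u (x - h *\<^sub>R \<nu> x)) \<longlongrightarrow> d) (at_right 0)"


section \<open>The boundary operators\<close>

definition D_op ::
    "(real \<times> (real \<Rightarrow> real^2)) set \<Rightarrow> (real^2 \<Rightarrow> real^2) \<Rightarrow> real \<Rightarrow> (nat \<Rightarrow> real)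
     \<Rightarrow> nat \<Rightarrow> (real^2 \<Rightarrow> real) \<Rightarrow> real^2 \<Rightarrow> real" where
  "D_op \<C> \<nu> \<gamma> \<beta> n g x =
     1 / pi * arc_integral \<C> (\<lambda>y. g y * (\<nu> y \<bullet> grad (\<lambda>y'. Phi \<gamma> \<beta> n x y') y))"

definition S_deriv ::
    "(real \<times> (real \<Rightarrow> real^2)) set \<Rightarrow> real \<Rightarrow> (nat \<Rightarrow> real)
     \<Rightarrow> nat \<Rightarrow> (real^2 \<Rightarrow> real) \<Rightarrow> real^2 \<Rightarrow> real" where
  "S_deriv \<C> \<gamma> \<beta> n g x = arc_integral \<C> (\<lambda>y. arc_deriv \<C> g y * Phi \<gamma> \<beta> n x y)"

definition H_op ::
    "(real \<times> (real \<Rightarrow> real^2)) set \<Rightarrow> real \<Rightarrow> (nat \<Rightarrow> real)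
     \<Rightarrow> nat \<Rightarrow> (real^2 \<Rightarrow> real) \<Rightarrow> real^2 \<Rightarrow> real" where
  "H_op \<C> \<gamma> \<beta> n g x = 1 / pi * arc_deriv \<C> (S_deriv \<C> \<gamma> \<beta> n g) x"

definition L_op ::
    "(real \<times> (real \<Rightarrow> real^2)) set \<Rightarrow> (real^2 \<Rightarrow> real^2) \<Rightarrow> real \<Rightarrow> (nat \<Rightarrow> real)
     \<Rightarrow> nat \<Rightarrow> (real^2 \<Rightarrow> real) \<Rightarrow> real^2 \<Rightarrow> real" where
  "L_op \<C> \<nu> \<gamma> \<beta> n g x =
     1 / pi * (\<nu> x \<bullet> arc_integral \<C>
       (\<lambda>y. (g y * (\<Sum>k=0..n. \<beta> (n - k) * Phi \<gamma> \<beta> k x y)) *\<^sub>R \<nu> y))"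

end

theory Submission
  imports Defs
begin

text \<open>
  Write \<open>\<Phi>\<^sub>n (x, y) = \<phi>\<^sub>n (|x - y|\<^sup>2)\<close>. The formula holds for each kernel \<open>\<Phi>\<^sub>n\<close> and each density \<open>g\<close>
  separately and rests on two facts about the kernel: \<open>\<Delta> \<Phi>\<^sub>n = \<Sum> \<beta>\<^sub>n\<^sub>-\<^sub>k \<Phi>\<^sub>k\<close> off the diagonal, which
  is the recursion of the coefficients \<open>a\<^sub>n\<^sub>,\<^sub>k\<close> in disguise (\<open>poly_identity_V\<close>, \<open>poly_identity_W\<close>), and
  the fact that \<open>\<phi>\<^sub>n\<close> has only a logarithmic singularity at \<open>0\<close>, with derivatives of the size of those
  of \<open>ln\<close> (locale \<open>log_kernel\<close>). Both come from the power series of \<open>K\<^sub>0\<close> and \<open>K\<^sub>1\<close>.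

  Off the boundary one differentiates under the integral. For the symmetric Hessian \<open>H\<close> of the kernel
  and the rotation \<open>J\<close> by a right angle, \<open>m \<bullet> H n + J m \<bullet> H (J n) = (tr H) (m \<bullet> n)\<close>. With \<open>n\<close> the normal
  at the integration point and \<open>m\<close> the normal at \<open>x\<close>, this replaces the two normal derivatives of the
  double layer by the Laplacian and by two tangential derivatives. The one at the integration point
  is moved to \<open>g\<close> by integration by parts over the closed curves. Hence \<open>\<nu> (x) \<bullet> \<nabla> u\<close> at \<open>x - h \<nu> (x)\<close>
  is the tangential derivative of the single layer with density \<open>dg/ds\<close> minus \<open>\<nu> (x)\<close> times a
  potential with kernel \<open>\<Sum> \<beta>\<^sub>n\<^sub>-\<^sub>k \<Phi>\<^sub>k\<close> (\<open>double_layer_normal_component\<close>).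

  The second term converges to its boundary value by dominated convergence
  (\<open>potential_normal_limit\<close>). For the first one the tangential derivative of the single layer on the
  boundary must exist and equal the limit from inside. Both are compared with the potential in which
  \<open>r\<^sup>2 = |x - y|\<^sup>2\<close> is replaced by \<open>r\<^sup>2 + h\<^sup>2\<close>. This potential is differentiable along the boundary curves, and its
  tangential derivative converges uniformly as \<open>h\<close> tends to \<open>0\<close>: the integral
  of the exact derivative \<open>d/dt \<phi>\<^sub>n (r\<^sup>2 + h\<^sup>2)\<close> over a closed curve vanishes, and subtracting it leaves
  a kernel in which Hoelder continuity of \<open>dg/ds\<close> and Lipschitz continuity of the tangent gain a factor
  \<open>r\<^sup>\<alpha>\<close> (\<open>subtracted_kernel\<close>, \<open>singular_kernel_regularization\<close>). Uniform convergence of the derivatives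
  gives differentiability in the limit (\<open>single_layer_tangential_derivative\<close>). On the other hand,
  the squared distance from \<open>x - h \<nu> (x)\<close> to a boundary point is \<open>r\<^sup>2 + h\<^sup>2\<close> up to \<open>O (h r\<^sup>2)\<close>, because
  \<open>\<nu> (x) \<bullet> (x - y) = O (r\<^sup>2)\<close>, so the limit from inside is the same (\<open>normal_approach\<close>).
\<close>


section \<open>The Macdonald functions of orders zero and one\<close>

definition entire_seq :: "(nat \<Rightarrow> real) \<Rightarrow> bool" where
  "entire_seq c \<longleftrightarrow> (\<forall>y. summable (\<lambda>k. c k * y ^ k))"

definition pow_ser :: "(nat \<Rightarrow> real) \<Rightarrow> real \<Rightarrow> real" where
  "pow_ser c y = (\<Sum>k. c k * y ^ k)"

lemma entire_seq_fact_bound: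
  assumes "\<And>k. \<bar>c k\<bar> \<le> M / fact k"
  shows "entire_seq c"
  unfolding entire_seq_def
proof
  fix y :: real
  have "summable (\<lambda>k. M * (\<bar>y\<bar> ^ k / fact k))"
    using summable_exp[of "\<bar>y\<bar>"] by (intro summable_mult) (simp add: field_simps)
  moreover have "norm (c k * y ^ k) \<le> M * (\<bar>y\<bar> ^ k / fact k)" for k
    using mult_right_mono[OF assms[of k], of "\<bar>y\<bar> ^ k"] by (simp add: abs_mult power_abs)
  ultimately show "summable (\<lambda>k. c k * y ^ k)"
    by (meson summable_comparison_test')
qed

lemma pow_ser_deriv:
  assumes "entire_seq c"
  shows "(pow_ser c has_real_derivative pow_ser (diffs c) y) (at y)"
  using termdiffs_strong_converges_everywhere[of c y] assms
  unfolding entire_seq_def pow_ser_def[abs_def] by blast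

lemma entire_seq_shift:
  assumes "entire_seq c"
  shows "entire_seq (\<lambda>k. c (Suc k))" and "pow_ser c y = c 0 + y * pow_ser (\<lambda>k. c (Suc k)) y"
proof -
  show "entire_seq (\<lambda>k. c (Suc k))"
    unfolding entire_seq_def using assms powser_split_head(3)[of c] unfolding entire_seq_def by blast
  show "pow_ser c y = c 0 + y * pow_ser (\<lambda>k. c (Suc k)) y"
    unfolding pow_ser_def using powser_split_head(1)[of c y] assms
    unfolding entire_seq_def by (simp add: mult.commute)
qed

lemma mult_pow_ser_deriv:
  assumes "entire_seq c"
  shows "((\<lambda>y. y * pow_ser c y) has_real_derivative pow_ser (\<lambda>k. (real k + 1) * c k) y) (at y)"
proof -
  define c' where "c' k = (case k of 0 \<Rightarrow> 0 | Suc j \<Rightarrow> c j)" for k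
  have "summable (\<lambda>k. c' k * z ^ k)" for z
    using assms summable_powser_split_head[of c' z] by (simp add: c'_def entire_seq_def)
  then have c': "entire_seq c'" by (simp add: entire_seq_def)
  have "pow_ser c' y = y * pow_ser c y" for y
    using entire_seq_shift(2)[OF c', of y] by (simp add: c'_def)
  then have "pow_ser c' = (\<lambda>y. y * pow_ser c y)" by blast
  moreover have "diffs c' = (\<lambda>k. (real k + 1) * c k)"
    by (auto simp: diffs_def c'_def fun_eq_iff)
  ultimately show ?thesis
    using pow_ser_deriv[OF c', of y] by presburger
qed

lemma pow_ser_add:
  assumes "entire_seq a" "entire_seq b"
  shows "pow_ser (\<lambda>k. a k + b k) y = pow_ser a y + pow_ser b y"
  using assms suminf_add[of "\<lambda>k. a k * y ^ k" "\<lambda>k. b k * y ^ k"]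
  unfolding entire_seq_def pow_ser_def by (simp add: algebra_simps)

lemma continuous_on_pow_ser: "entire_seq c \<Longrightarrow> continuous_on S (pow_ser c)"
  by (meson pow_ser_deriv DERIV_isCont continuous_at_imp_continuous_on)

definition coeff_I :: "nat \<Rightarrow> nat \<Rightarrow> real" where
  "coeff_I m k = 1 / (fact k * fact (m + k))"

definition coeff_K :: "nat \<Rightarrow> nat \<Rightarrow> real" where
  "coeff_K m k = (Digamma (real (k + 1)) + Digamma (real (m + k + 1))) / (fact k * fact (m + k))"

lemma entire_coeff_I: "entire_seq (coeff_I m)"
proof (rule entire_seq_fact_bound[of _ 1])
  fix k
  have "(1::real) \<le> fact (m + k)" by (rule fact_ge_1)
  then have "1 / (fact k * fact (m + k)) \<le> 1 / (fact k :: real)"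
    by (intro divide_left_mono) auto
  then show "\<bar>coeff_I m k\<bar> \<le> 1 / fact k" by (simp add: coeff_I_def)
qed

lemma Digamma_Suc_bound: "\<bar>Digamma (real (Suc k))\<bar> \<le> (1 + \<bar>euler_mascheroni\<bar>) * real (Suc k)"
proof -
  have h: "0 \<le> (harm k :: real)" "(harm k :: real) \<le> real k"
    unfolding harm_def
    by (auto intro!: sum_nonneg sum_bounded_above[where K = "1::real", of "{1..k}", simplified]
        simp: divide_simps)
  have "\<bar>Digamma (real (Suc k))\<bar> \<le> real k + \<bar>euler_mascheroni\<bar>"
    using h Digamma_of_nat[where 'a = real, of k] by (simp add: abs_if split: if_splits)
  also have "\<dots> \<le> (1 + \<bar>euler_mascheroni\<bar>) * real (Suc k)"
    by (simp add: algebra_simps)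
  finally show ?thesis .
qed

lemma Suc_le_two_fact: "real (Suc k) \<le> 2 * fact k"
proof (induction k)
  case (Suc k)
  have "real (Suc (Suc k)) \<le> 2 * real (Suc k)" by simp
  also have "\<dots> \<le> 2 * fact (Suc k)"
    by (metis fact_ge_self of_nat_fact of_nat_le_iff mult_left_mono zero_le_numeral)
  finally show ?case .
qed simp

lemma entire_coeff_K: "entire_seq (coeff_K m)"
proof (rule entire_seq_fact_bound)
  fix k
  define c where "c = 1 + \<bar>euler_mascheroni :: real\<bar>"
  have c: "c \<ge> 0" by (simp add: c_def)
  have "\<bar>Digamma (real (k + 1)) + Digamma (real (m + k + 1))\<bar>
      \<le> c * real (Suc k) + c * real (Suc (m + k))"
    using Digamma_Suc_bound[of k] Digamma_Suc_bound[of "m + k"] by (simp add: c_def)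
  also have "\<dots> \<le> 2 * c * real (Suc (m + k))"
    using c by (simp add: algebra_simps mult_left_mono)
  also have "\<dots> \<le> 2 * c * (2 * fact (m + k))"
    using c by (intro mult_left_mono Suc_le_two_fact) auto
  finally have "\<bar>Digamma (real (k + 1)) + Digamma (real (m + k + 1))\<bar> \<le> 4 * c * fact (m + k)"
    by simp
  then have "\<bar>Digamma (real (k + 1)) + Digamma (real (m + k + 1))\<bar> / (fact k * fact (m + k))
      \<le> 4 * c * fact (m + k) / (fact k * fact (m + k))"
    by (intro divide_right_mono) auto
  then have "\<bar>coeff_K m k\<bar> \<le> 4 * c * fact (m + k) / (fact k * fact (m + k))"
    unfolding coeff_K_def abs_divide abs_mult by simp
  also have "\<dots> = 4 * c / fact k" by simp
  finally show "\<bar>coeff_K m k\<bar> \<le> 4 * (1 + \<bar>euler_mascheroni :: real\<bar>) / fact k"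
    by (simp add: c_def)
qed

lemma Digamma_real_Suc: "Digamma (real k + 2) = Digamma (real k + 1) + 1 / (real k + 1)"
  using Digamma_plus1[of "real k + 1"] by (simp add: add.assoc)

text \<open>These four identities between coefficients, of which the last two express
  \<open>Digamma (k + 2) = Digamma (k + 1) + 1 / (k + 1)\<close>, encode \<open>K\<^sub>0' = - K\<^sub>1\<close> and
  \<open>(x K\<^sub>1)' = - x K\<^sub>0\<close>.\<close>

lemma diffs_coeff_I: "diffs (coeff_I 0) = coeff_I 1"
  by (auto simp: diffs_def coeff_I_def fun_eq_iff divide_simps)

lemma shift_coeff_I: "(\<lambda>k. (real k + 1) * coeff_I 1 k) = coeff_I 0"
  by (auto simp: coeff_I_def fun_eq_iff divide_simps)

lemma diffs_coeff_K: "diffs (coeff_K 0) = (\<lambda>k. coeff_K 1 k + coeff_I 0 (Suc k))"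
proof
  fix k
  have "(1 + real k) \<noteq> 0" by linarith
  then show "diffs (coeff_K 0) k = coeff_K 1 k + coeff_I 0 (Suc k)"
    using Digamma_real_Suc[of k]
    by (simp add: diffs_def coeff_K_def coeff_I_def add.commute divide_simps)
       (simp add: algebra_simps)
qed

lemma shift_coeff_K: "(\<lambda>k. (real k + 1) * coeff_K 1 k) = (\<lambda>k. coeff_I 1 k + coeff_K 0 k)"
proof
  fix k
  have "(1 + real k) \<noteq> 0" by linarith
  then show "(real k + 1) * coeff_K 1 k = coeff_I 1 k + coeff_K 0 k"
    using Digamma_real_Suc[of k]
    by (simp add: coeff_K_def coeff_I_def add.commute divide_simps)
       (simp add: algebra_simps)
qed

text \<open>In the variable \<open>y = x\<^sup>2 / 4\<close> these two functions are \<open>K\<^sub>0 x\<close> and \<open>x K\<^sub>1 x\<close>: up to the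
  factor \<open>ln y\<close> they are power series, so the square roots hidden in \<open>x\<close> disappear.\<close>

definition kappa0 :: "real \<Rightarrow> real" where
  "kappa0 y = - (1 / 2) * ln y * pow_ser (coeff_I 0) y + 1 / 2 * pow_ser (coeff_K 0) y"

definition kappa1 :: "real \<Rightarrow> real" where
  "kappa1 y = 1 + ln y * (y * pow_ser (coeff_I 1) y) - y * pow_ser (coeff_K 1) y"

lemma bessel_I_eq: "bessel_I n x = (x / 2) ^ n * pow_ser (coeff_I n) (x\<^sup>2 / 4)"
proof -
  have "(x / 2) ^ n * pow_ser (coeff_I n) (x\<^sup>2 / 4)
      = (\<Sum>k. (x / 2) ^ n * (coeff_I n k * (x\<^sup>2 / 4) ^ k))"
    unfolding pow_ser_def using entire_coeff_I[of n] unfolding entire_seq_def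
    by (intro suminf_mult[symmetric]) auto
  also have "\<dots> = bessel_I n x"
  proof -
    have "(x\<^sup>2 / 4) ^ k = (x / 2) ^ (2 * k)" for k
      by (simp add: power_mult power_divide)
    then show ?thesis
      by (simp add: bessel_I_def coeff_I_def power_add mult.commute)
  qed
  finally show ?thesis by simp
qed

lemma ln_half:
  assumes "(x::real) > 0" shows "ln (x / 2) = ln (x\<^sup>2 / 4) / 2"
proof -
  have "x\<^sup>2 / 4 = (x / 2) ^ 2" by (simp add: power_divide)
  then show ?thesis using assms by (simp add: ln_realpow)
qed

lemma bessel_K0_eq:
  assumes "x > 0" shows "bessel_K 0 x = kappa0 (x\<^sup>2 / 4)"
  using assms by (simp add: bessel_K_def kappa0_def bessel_I_eq ln_half pow_ser_def coeff_K_def)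

lemma bessel_K1_eq:
  assumes "x > 0" shows "x * bessel_K 1 x = kappa1 (x\<^sup>2 / 4)"
proof -
  have "bessel_K 1 x = 1 / x + ln (x\<^sup>2 / 4) / 2 * (x / 2 * pow_ser (coeff_I 1) (x\<^sup>2 / 4))
      - 1 / 2 * (x / 2) * pow_ser (coeff_K 1) (x\<^sup>2 / 4)"
    using assms by (simp add: bessel_K_def bessel_I_eq ln_half pow_ser_def coeff_K_def)
  then show ?thesis
    using assms by (simp add: kappa1_def field_simps power2_eq_square)
qed

lemma kappa0_deriv:
  assumes "y > 0"
  shows "(kappa0 has_real_derivative - kappa1 y / (2 * y)) (at y)"
proof -
  have E: "(pow_ser (coeff_I 0) has_real_derivative pow_ser (coeff_I 1) y) (at y)"
    using pow_ser_deriv[OF entire_coeff_I[of 0], of y] by (simp add: diffs_coeff_I)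
  have G: "(pow_ser (coeff_K 0) has_real_derivative
      pow_ser (coeff_K 1) y + pow_ser (\<lambda>k. coeff_I 0 (Suc k)) y) (at y)"
    using pow_ser_deriv[OF entire_coeff_K[of 0], of y]
    by (simp only: diffs_coeff_K
        pow_ser_add[OF entire_coeff_K[of 1] entire_seq_shift(1)[OF entire_coeff_I[of 0]]])
  have E0: "pow_ser (coeff_I 0) y = 1 + y * pow_ser (\<lambda>k. coeff_I 0 (Suc k)) y"
    using entire_seq_shift(2)[OF entire_coeff_I[of 0], of y] by (simp add: coeff_I_def)
  have "(kappa0 has_real_derivative
      - (1 / 2) * (1 / y) * pow_ser (coeff_I 0) y + (- (1 / 2)) * ln y * pow_ser (coeff_I 1) y
      + 1 / 2 * (pow_ser (coeff_K 1) y + pow_ser (\<lambda>k. coeff_I 0 (Suc k)) y)) (at y)"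
    unfolding kappa0_def[abs_def] using assms
    by (auto intro!: derivative_eq_intros E G simp: divide_simps) 
  also have "- (1 / 2) * (1 / y) * pow_ser (coeff_I 0) y
      + (- (1 / 2)) * ln y * pow_ser (coeff_I 1) y
      + 1 / 2 * (pow_ser (coeff_K 1) y + pow_ser (\<lambda>k. coeff_I 0 (Suc k)) y)
      = - kappa1 y / (2 * y)"
    using assms unfolding kappa1_def E0 by (simp add: field_simps)
  finally show ?thesis .
qed

lemma kappa1_deriv:
  assumes "y > 0"
  shows "(kappa1 has_real_derivative - 2 * kappa0 y) (at y)"
proof -
  have E: "((\<lambda>y. y * pow_ser (coeff_I 1) y) has_real_derivative pow_ser (coeff_I 0) y) (at y)"
    using mult_pow_ser_deriv[OF entire_coeff_I[of 1], of y] by (simp only: shift_coeff_I)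
  have G: "((\<lambda>y. y * pow_ser (coeff_K 1) y) has_real_derivative
      pow_ser (coeff_I 1) y + pow_ser (coeff_K 0) y) (at y)"
    using mult_pow_ser_deriv[OF entire_coeff_K[of 1], of y]
    by (simp only: shift_coeff_K pow_ser_add[OF entire_coeff_I entire_coeff_K])
  have "(kappa1 has_real_derivative 0 + (1 / y * (y * pow_ser (coeff_I 1) y)
      + pow_ser (coeff_I 0) y * ln y) - (pow_ser (coeff_I 1) y + pow_ser (coeff_K 0) y)) (at y)"
    unfolding kappa1_def[abs_def] using assms
    by (intro DERIV_diff DERIV_add DERIV_const DERIV_mult E G) (auto intro!: derivative_eq_intros)
  then show ?thesis
    using assms by (simp add: kappa0_def algebra_simps)
qed

lemma abs_ln_bound:
  fixes y :: real
  assumes "0 < y" "y \<le> Y"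
  shows "\<bar>ln y\<bar> \<le> 4 * (1 + Y) * y powr (-1/4)"
proof (cases "y \<ge> 1")
  case True
  have "ln y \<le> y powr (1/4) / (1/4)" by (rule ln_powr_bound) (use True in auto)
  also have "y powr (1/4) = y powr (1/2) * y powr (-1/4)" using powr_add[of y "1/2" "-1/4"] by simp
  also have "y powr (1/2) \<le> y powr 1" by (rule powr_mono) (use True in auto)
  also have "y powr 1 \<le> 1 + Y" using assms by simp
  finally have "ln y \<le> (1 + Y) * y powr (-1/4) / (1/4)" by (simp add: mult_right_mono)
  also have "\<dots> = 4 * (1 + Y) * y powr (-1/4)" by simp
  finally show ?thesis using True by simp
next
  case False
  have "ln (1 / y) \<le> (1 / y) powr (1/4) / (1/4)"
    by (rule ln_powr_bound) (use False assms in auto)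
  also have "(1 / y) powr (1/4) = y powr (-1/4)"
    using assms by (simp add: powr_divide powr_minus_divide)
  finally have "- ln y \<le> 4 * y powr (-1/4)" using assms by (simp add: ln_div)
  also have "\<dots> \<le> 4 * (1 + Y) * y powr (-1/4)" using assms by simp
  finally show ?thesis using False assms by simp
qed

lemma one_le_powr_bound:
  fixes y :: real
  assumes "0 < y" "y \<le> Y"
  shows "1 \<le> (1 + Y) * y powr (-1/4)"
proof (cases "y \<le> 1")
  case True
  have "1 \<le> y powr (-1/4)" using powr_mono'[of "-1/4" 0 y] True assms by simp
  also have "\<dots> \<le> (1 + Y) * y powr (-1/4)" using assms by simp
  finally show ?thesis .
next
  case False
  have "1 = y powr (1/4) * y powr (-1/4)" using assms powr_add[of y "1/4" "-1/4"] by simp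
  also have "y powr (1/4) \<le> y powr 1" by (rule powr_mono) (use False in auto)
  also have "y powr 1 \<le> 1 + Y" using assms by simp
  finally show ?thesis by (simp add: mult_right_mono)
qed

lemma powr_three_quarters_bound:
  fixes y :: real
  assumes "0 < y" "y \<le> Y"
  shows "y * y powr (-1/4) \<le> 1 + Y"
proof (cases "y \<le> 1")
  case True
  have "y * y powr (-1/4) = y powr (3/4)" using assms powr_mult_base[of y "-1/4"] by simp
  also have "\<dots> \<le> 1" using True assms by (simp add: powr_le1)
  finally show ?thesis using assms by simp
next
  case False
  have "y powr (-1/4) \<le> 1" using powr_mono[of "-1/4" 0 y] False by simp
  then have "y * y powr (-1/4) \<le> y * 1" using assms by (intro mult_left_mono) auto
  then show ?thesis using assms by linarith
qed

lemma continuous_bound_interval: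
  fixes f :: "real \<Rightarrow> real"
  assumes "continuous_on {0..Y} f"
  shows "\<exists>B>0. \<forall>y\<in>{0..Y}. \<bar>f y\<bar> \<le> B"
proof -
  have "bounded (f ` {0..Y})"
    using assms compact_continuous_image compact_imp_bounded by blast
  then show ?thesis unfolding bounded_pos by auto
qed

lemma kappa_bounds:
  "\<exists>C>0. \<forall>y. 0 < y \<longrightarrow> y \<le> Y \<longrightarrow> \<bar>kappa0 y\<bar> \<le> C * y powr (-1/4) \<and> \<bar>kappa1 y\<bar> \<le> C"
proof -
  obtain A where A: "A > 0" "\<And>y. y \<in> {0..Y} \<Longrightarrow> \<bar>pow_ser (coeff_I 0) y\<bar> \<le> A"
    using continuous_bound_interval[OF continuous_on_pow_ser[OF entire_coeff_I]] by metis
  obtain B where B: "B > 0" "\<And>y. y \<in> {0..Y} \<Longrightarrow> \<bar>pow_ser (coeff_K 0) y\<bar> \<le> B"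
    using continuous_bound_interval[OF continuous_on_pow_ser[OF entire_coeff_K]] by metis
  obtain D where D: "D > 0" "\<And>y. y \<in> {0..Y} \<Longrightarrow> \<bar>pow_ser (coeff_I 1) y\<bar> \<le> D"
    using continuous_bound_interval[OF continuous_on_pow_ser[OF entire_coeff_I]] by metis
  obtain F where F: "F > 0" "\<And>y. y \<in> {0..Y} \<Longrightarrow> \<bar>pow_ser (coeff_K 1) y\<bar> \<le> F"
    using continuous_bound_interval[OF continuous_on_pow_ser[OF entire_coeff_K]] by metis
  define Z where "Z = 1 + \<bar>Y\<bar>"
  define C where "C = 4 * Z * A + Z * B + (1 + 4 * Z * Z * D + Z * F)"
  have Z: "Z \<ge> 1" by (simp add: Z_def)
  have "C > 0" using A B D F Z unfolding C_def by (intro add_pos_pos mult_pos_pos) auto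
  moreover have "\<bar>kappa0 y\<bar> \<le> C * y powr (-1/4) \<and> \<bar>kappa1 y\<bar> \<le> C" if y: "0 < y" "y \<le> Y" for y
  proof
    have yY: "y \<in> {0..Y}" using y by auto
    define p where "p = y powr (-1/4)"
    have p: "p \<ge> 0" by (simp add: p_def)
    have Ze: "Z = 1 + Y" using y by (simp add: Z_def)
    have ln: "\<bar>ln y\<bar> \<le> 4 * Z * p" using abs_ln_bound[OF y] by (simp add: p_def Ze)
    have one: "1 \<le> Z * p" using one_le_powr_bound[OF y] by (simp add: p_def Ze)
    have yp: "y * p \<le> Z" using powr_three_quarters_bound[OF y] by (simp add: p_def Ze)
    have "\<bar>kappa0 y\<bar> \<le> \<bar>ln y * pow_ser (coeff_I 0) y\<bar> + \<bar>pow_ser (coeff_K 0) y\<bar>"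
      unfolding kappa0_def by (simp add: abs_if split: if_splits)
    also have "\<dots> \<le> (4 * Z * p) * A + B * 1"
      unfolding abs_mult using ln A(2)[OF yY] B(2)[OF yY] by (intro add_mono mult_mono) auto
    also have "B * 1 \<le> B * (Z * p)" using one B by (intro mult_left_mono) auto
    finally have "\<bar>kappa0 y\<bar> \<le> (4 * Z * A + Z * B) * p" by (simp add: algebra_simps)
    also have "\<dots> \<le> C * p" unfolding C_def
      using A B D F Z p by (intro mult_right_mono) (auto intro!: add_nonneg_nonneg mult_nonneg_nonneg)
    finally show "\<bar>kappa0 y\<bar> \<le> C * y powr (-1/4)" by (simp add: p_def)
    have "\<bar>ln y * y\<bar> \<le> (4 * Z * p) * y" unfolding abs_mult using ln y by (intro mult_mono) auto
    also have "\<dots> = 4 * Z * (y * p)" by simp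
    also have "\<dots> \<le> 4 * Z * Z" using yp Z by (intro mult_left_mono) auto
    finally have lny: "\<bar>ln y * y\<bar> \<le> 4 * Z * Z" .
    have "\<bar>kappa1 y\<bar> \<le> 1 + \<bar>ln y * y\<bar> * \<bar>pow_ser (coeff_I 1) y\<bar> + \<bar>y\<bar> * \<bar>pow_ser (coeff_K 1) y\<bar>"
      unfolding kappa1_def abs_mult[symmetric] mult.assoc[symmetric] by linarith
    also have "\<dots> \<le> 1 + (4 * Z * Z) * D + Z * F"
      using lny D(2)[OF yY] F(2)[OF yY] y Z Ze by (intro add_mono mult_mono) auto
    also have "\<dots> \<le> C" unfolding C_def
      using A B D F Z by (auto intro!: add_nonneg_nonneg mult_nonneg_nonneg)
    finally show "\<bar>kappa1 y\<bar> \<le> C" .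
  qed
  ultimately show ?thesis by blast
qed


section \<open>Kernels with a logarithmic singularity\<close>

text \<open>A radial kernel is written as a function of the squared distance \<open>u = |x - y|\<^sup>2\<close>, which makes
  it smooth in \<open>x\<close> and \<open>y\<close> off the diagonal without square roots. The bounds on
  the derivatives are those of \<open>ln u\<close>; the bound on \<open>\<phi>\<close>, a power instead of a logarithm, makes the
  kernel integrable over a curve because \<open>u powr (-1/4) = |x - y| powr (-1/2)\<close>.\<close>

locale log_kernel =
  fixes \<phi> \<phi>1 \<phi>2 :: "real \<Rightarrow> real"
  assumes deriv1: "u > 0 \<Longrightarrow> (\<phi> has_real_derivative \<phi>1 u) (at u)"
    and deriv2: "u > 0 \<Longrightarrow> (\<phi>1 has_real_derivative \<phi>2 u) (at u)"
    and cont2: "continuous_on {0<..} \<phi>2"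
    and bounds: "\<exists>C>0. \<forall>u. 0 < u \<longrightarrow> u \<le> U \<longrightarrow>
      \<bar>\<phi> u\<bar> \<le> C * u powr (-1/4) \<and> \<bar>\<phi>1 u\<bar> \<le> C / u \<and> \<bar>\<phi>2 u\<bar> \<le> C / u\<^sup>2"

section \<open>The functions \<open>\<Phi>\<^sub>n\<close>: radial equation and singularity\<close>

definition phi :: "real \<Rightarrow> (nat \<Rightarrow> real) \<Rightarrow> nat \<Rightarrow> real \<Rightarrow> real" where
  "phi \<gamma> \<beta> n u = bessel_K 0 (\<gamma> * sqrt u) * v_fun \<gamma> \<beta> n (sqrt u)
     + bessel_K 1 (\<gamma> * sqrt u) * w_fun \<gamma> \<beta> n (sqrt u)"

lemma Phi_eq_phi: "Phi \<gamma> \<beta> n x y = phi \<gamma> \<beta> n ((dist x y)\<^sup>2)"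
  by (simp add: Phi_def phi_def)

lemma a_coeff_above: "k \<noteq> 0 \<Longrightarrow> n < k \<Longrightarrow> a_coeff \<gamma> \<beta> n k = 0"
  by (subst a_coeff.simps) simp

text \<open>With the entries above the diagonal equal to zero, the two cases of the recursion merge
  into one identity for all \<open>n\<close> and all \<open>k \<ge> 1\<close>.\<close>

lemma a_coeff_recursion:
  assumes "\<gamma> \<noteq> 0" "k \<noteq> 0"
  shows "2 * \<gamma> * real k * a_coeff \<gamma> \<beta> n k =
    4 * (real ((k + 1) div 2))\<^sup>2 * a_coeff \<gamma> \<beta> n (k + 1)
    - (\<Sum>m<n. \<beta> (n - m) * a_coeff \<gamma> \<beta> m (k - 1))"
proof -
  consider "n < k" | "k = n" | "k < n" by linarith
  then show ?thesis
  proof cases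
    case 1
    have "(\<Sum>m<n. \<beta> (n - m) * a_coeff \<gamma> \<beta> m (k - 1)) = 0"
    proof (rule sum.neutral, safe)
      fix m assume "m < n"
      then show "\<beta> (n - m) * a_coeff \<gamma> \<beta> m (k - 1) = 0"
        using 1 a_coeff_above[of "k - 1" m] by simp
    qed
    then show ?thesis using 1 assms by (simp add: a_coeff_above)
  next
    case 2
    have "(\<Sum>m<n. \<beta> (n - m) * a_coeff \<gamma> \<beta> m (k - 1))
        = (\<Sum>m\<in>{n - 1}. \<beta> (n - m) * a_coeff \<gamma> \<beta> m (k - 1))"
      using 2 assms by (intro sum.mono_neutral_right) (auto simp: a_coeff_above)
    also have "\<dots> = \<beta> 1 * a_coeff \<gamma> \<beta> (n - 1) (n - 1)"
      using 2 assms by simp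
    finally show ?thesis
      using 2 assms a_coeff.simps[of \<gamma> \<beta> n k] by (simp add: a_coeff_above)
  next
    case 3
    have "(\<Sum>m<n. \<beta> (n - m) * a_coeff \<gamma> \<beta> m (k - 1))
        = (\<Sum>m\<in>{k - 1..n - 1}. \<beta> (n - m) * a_coeff \<gamma> \<beta> m (k - 1))"
      using 3 assms by (intro sum.mono_neutral_right) (auto simp: a_coeff_above)
    then show ?thesis
      using 3 assms a_coeff.simps[of \<gamma> \<beta> n k] by (simp add: field_simps)
  qed
qed

locale Phi_params =
  fixes \<gamma> :: real and \<beta> :: "nat \<Rightarrow> real"
  assumes gamma_pos: "\<gamma> > 0" and beta_0: "\<beta> 0 = \<gamma>\<^sup>2"
begin

definition V :: "nat \<Rightarrow> real poly" where
  "V n = (\<Sum>j\<le>n. monom (a_coeff \<gamma> \<beta> n (2 * j)) j)"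

definition W :: "nat \<Rightarrow> real poly" where
  "W n = (\<Sum>j\<le>n. monom (a_coeff \<gamma> \<beta> n (2 * j + 1)) j)"

lemma coeff_V: "coeff (V n) j = a_coeff \<gamma> \<beta> n (2 * j)"
  by (simp add: V_def coeff_sum a_coeff_above)

lemma coeff_W: "coeff (W n) j = a_coeff \<gamma> \<beta> n (2 * j + 1)"
  by (simp add: W_def coeff_sum a_coeff_above)

lemma v_fun_eq: "v_fun \<gamma> \<beta> n r = poly (V n) (r\<^sup>2)"
proof -
  have "v_fun \<gamma> \<beta> n r = (\<Sum>j\<le>n. a_coeff \<gamma> \<beta> n (2 * j) * r ^ (2 * j))"
    unfolding v_fun_def by (intro sum.mono_neutral_left) (auto simp: a_coeff_above)
  then show ?thesis by (simp add: V_def poly_sum poly_monom power_mult)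
qed

lemma w_fun_eq: "w_fun \<gamma> \<beta> n r = r * poly (W n) (r\<^sup>2)"
proof -
  have "w_fun \<gamma> \<beta> n r = (\<Sum>j\<le>n. a_coeff \<gamma> \<beta> n (2 * j + 1) * r ^ (2 * j + 1))"
  proof (cases "n = 0")
    case True
    then show ?thesis by (simp add: w_fun_def a_coeff_above)
  next
    case False
    then show ?thesis
      unfolding w_fun_def by (auto simp: a_coeff_above intro!: sum.mono_neutral_left)
  qed
  also have "\<dots> = r * (\<Sum>j\<le>n. a_coeff \<gamma> \<beta> n (2 * j + 1) * r ^ (2 * j))"
    by (simp add: sum_distrib_left algebra_simps)
  finally show ?thesis by (simp add: W_def poly_sum poly_monom power_mult)
qed

text \<open>\<open>K\<^sub>0 (\<gamma> \<surd>u)\<close> and \<open>\<surd>u K\<^sub>1 (\<gamma> \<surd>u)\<close>. They satisfy \<open>k\<^sub>0' = - \<gamma> k\<^sub>1 / (2 u)\<close> and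
  \<open>k\<^sub>1' = - \<gamma> k\<^sub>0 / 2\<close>, and the kernels are combinations of them with polynomial coefficients.\<close>

definition k0 :: "real \<Rightarrow> real" where "k0 u = kappa0 (\<gamma>\<^sup>2 * u / 4)"
definition k1 :: "real \<Rightarrow> real" where "k1 u = kappa1 (\<gamma>\<^sup>2 * u / 4) / \<gamma>"

lemma k0_deriv:
  assumes "u > 0" shows "(k0 has_real_derivative - \<gamma> * k1 u / (2 * u)) (at u)"
proof -
  have "((\<lambda>u. \<gamma>\<^sup>2 * u / 4) has_real_derivative \<gamma>\<^sup>2 / 4) (at u)"
    by (auto intro!: derivative_eq_intros)
  from DERIV_chain2[OF kappa0_deriv this] show ?thesis
    using assms gamma_pos by (simp add: k0_def[abs_def] k1_def divide_simps power2_eq_square)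
qed

lemma k1_deriv:
  assumes "u > 0" shows "(k1 has_real_derivative - \<gamma> * k0 u / 2) (at u)"
proof -
  have "((\<lambda>u. \<gamma>\<^sup>2 * u / 4) has_real_derivative \<gamma>\<^sup>2 / 4) (at u)"
    by (auto intro!: derivative_eq_intros)
  from DERIV_cdivide[OF DERIV_chain2[OF kappa1_deriv this], of \<gamma>] show ?thesis
    using assms gamma_pos by (simp add: k1_def[abs_def] k0_def divide_simps power2_eq_square)
qed

lemma phi_eq: "u > 0 \<Longrightarrow> phi \<gamma> \<beta> n u = k0 u * poly (V n) u + k1 u * poly (W n) u"
  using gamma_pos bessel_K0_eq[of "\<gamma> * sqrt u"] bessel_K1_eq[of "\<gamma> * sqrt u"]
  by (simp add: phi_def v_fun_eq w_fun_eq k0_def k1_def power_mult_distrib field_simps)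

text \<open>The coefficients in \<open>u \<phi>\<^sub>n' = k\<^sub>0 (u R\<^sub>n) + k\<^sub>1 Q\<^sub>n\<close>.\<close>

definition R :: "nat \<Rightarrow> real poly" where "R n = pderiv (V n) - smult (\<gamma> / 2) (W n)"
definition Q :: "nat \<Rightarrow> real poly" where "Q n = pCons 0 (pderiv (W n)) - smult (\<gamma> / 2) (V n)"

definition phi1 :: "nat \<Rightarrow> real \<Rightarrow> real" where
  "phi1 n u = (k0 u * (u * poly (R n) u) + k1 u * poly (Q n) u) / u"

text \<open>The second derivative is read off from the radial equation
  \<open>4 (u \<phi>\<^sub>n')' = \<Sum> \<beta>\<^sub>n\<^sub>-\<^sub>k \<phi>\<^sub>k\<close>. This reduces its bound to those of \<open>\<phi>\<^sub>k\<close> and \<open>\<phi>\<^sub>n'\<close>, and moves the content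
  of the equation into the proof that it is indeed the derivative of \<open>\<phi>\<^sub>n'\<close>.\<close>

definition phi2 :: "nat \<Rightarrow> real \<Rightarrow> real" where
  "phi2 n u = ((\<Sum>k=0..n. \<beta> (n - k) * phi \<gamma> \<beta> k u) / 4 - phi1 n u) / u"

lemma sum_beta_split:
  "(\<Sum>m=0..n. \<beta> (n - m) * f m) = (\<Sum>m<n. \<beta> (n - m) * f m) + \<gamma>\<^sup>2 * f n" for f :: "nat \<Rightarrow> real"
  by (simp add: atLeast0AtMost lessThan_Suc_atMost[symmetric] beta_0)

text \<open>Inserting \<open>u \<phi>\<^sub>n' = k\<^sub>0 (u R\<^sub>n) + k\<^sub>1 Q\<^sub>n\<close> into the radial equation and comparing the factors of
  \<open>k\<^sub>0\<close> and of \<open>k\<^sub>1\<close> leaves two polynomial identities. Their coefficients are the recursion of the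
  \<open>a\<^sub>n\<^sub>,\<^sub>k\<close> for odd and for even second index.\<close>

lemma poly_identity_V:
  "smult 4 (pderiv (pCons 0 (R n)) - smult (\<gamma> / 2) (Q n)) = (\<Sum>m=0..n. smult (\<beta> (n - m)) (V m))"
proof (rule poly_eqI)
  fix j
  have "2 * \<gamma> * real (2 * j + 1) * a_coeff \<gamma> \<beta> n (2 * j + 1)
      = 4 * (real (j + 1))\<^sup>2 * a_coeff \<gamma> \<beta> n (2 * j + 2)
      - (\<Sum>m<n. \<beta> (n - m) * a_coeff \<gamma> \<beta> m (2 * j))"
    using a_coeff_recursion[of \<gamma> "2 * j + 1" \<beta> n] gamma_pos by simp
  moreover have "coeff (Q n) j
      = real j * a_coeff \<gamma> \<beta> n (2 * j + 1) - \<gamma> / 2 * a_coeff \<gamma> \<beta> n (2 * j)"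
    by (cases j) (auto simp: Q_def coeff_V coeff_W coeff_pderiv)
  ultimately show "coeff (smult 4 (pderiv (pCons 0 (R n)) - smult (\<gamma> / 2) (Q n))) j
      = coeff (\<Sum>m=0..n. smult (\<beta> (n - m)) (V m)) j"
    by (simp add: coeff_sum coeff_V coeff_W coeff_pderiv R_def sum_beta_split)
       (simp add: field_simps power2_eq_square)
qed

lemma poly_identity_W:
  "smult 4 (pderiv (Q n) - smult (\<gamma> / 2) (R n)) = (\<Sum>m=0..n. smult (\<beta> (n - m)) (W m))"
proof (rule poly_eqI)
  fix j
  have "2 * \<gamma> * real (2 * j + 2) * a_coeff \<gamma> \<beta> n (2 * j + 2)
      = 4 * (real (j + 1))\<^sup>2 * a_coeff \<gamma> \<beta> n (2 * j + 3)
      - (\<Sum>m<n. \<beta> (n - m) * a_coeff \<gamma> \<beta> m (2 * j + 1))"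
    using a_coeff_recursion[of \<gamma> "2 * j + 2" \<beta> n] gamma_pos by (simp add: numeral_3_eq_3)
  then show "coeff (smult 4 (pderiv (Q n) - smult (\<gamma> / 2) (R n))) j
      = coeff (\<Sum>m=0..n. smult (\<beta> (n - m)) (W m)) j"
    by (simp add: coeff_sum coeff_V coeff_W coeff_pderiv R_def Q_def sum_beta_split numeral_3_eq_3)
       (simp add: field_simps power2_eq_square)
qed

lemma phi_deriv:
  assumes "u > 0" shows "(phi \<gamma> \<beta> n has_real_derivative phi1 n u) (at u)"
proof -
  have "((\<lambda>u. k0 u * poly (V n) u + k1 u * poly (W n) u) has_real_derivative phi1 n u) (at u)"
    using assms
    by (auto intro!: derivative_eq_intros k0_deriv k1_deriv simp: phi1_def R_def Q_def field_simps)
  moreover have "\<forall>\<^sub>F w in nhds u. k0 w * poly (V n) w + k1 w * poly (W n) w = phi \<gamma> \<beta> n w"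
    using assms by (intro eventually_nhds_in_open[of "{0<..}", THEN eventually_mono])
      (auto simp: phi_eq)
  ultimately show ?thesis by (simp cong: DERIV_cong_ev)
qed

lemma phi1_deriv:
  assumes "u > 0" shows "(phi1 n has_real_derivative phi2 n u) (at u)"
proof -
  have V: "4 * (poly (pderiv (pCons 0 (R n))) u - \<gamma> / 2 * poly (Q n) u)
      = (\<Sum>m=0..n. \<beta> (n - m) * poly (V m) u)"
    using arg_cong[OF poly_identity_V[of n], of "\<lambda>p. poly p u"] by (simp add: poly_sum)
  have W: "4 * (poly (pderiv (Q n)) u - \<gamma> / 2 * poly (R n) u)
      = (\<Sum>m=0..n. \<beta> (n - m) * poly (W m) u)"
    using arg_cong[OF poly_identity_W[of n], of "\<lambda>p. poly p u"] by (simp add: poly_sum)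
  have "(\<Sum>k=0..n. \<beta> (n - k) * phi \<gamma> \<beta> k u)
      = k0 u * (\<Sum>m=0..n. \<beta> (n - m) * poly (V m) u) + k1 u * (\<Sum>m=0..n. \<beta> (n - m) * poly (W m) u)"
    using assms by (simp add: phi_eq sum_distrib_left sum.distrib algebra_simps)
  also have "\<dots> = 4 * (k0 u * (poly (pderiv (pCons 0 (R n))) u - \<gamma> / 2 * poly (Q n) u)
      + k1 u * (poly (pderiv (Q n)) u - \<gamma> / 2 * poly (R n) u))"
    unfolding V[symmetric] W[symmetric] by (simp add: algebra_simps)
  finally have S: "(\<Sum>k=0..n. \<beta> (n - k) * phi \<gamma> \<beta> k u) / 4
      = k0 u * (poly (pderiv (pCons 0 (R n))) u - \<gamma> / 2 * poly (Q n) u)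
      + k1 u * (poly (pderiv (Q n)) u - \<gamma> / 2 * poly (R n) u)" by simp
  have "((\<lambda>u. k0 u * poly (pCons 0 (R n)) u + k1 u * poly (Q n) u) has_real_derivative
      (\<Sum>k=0..n. \<beta> (n - k) * phi \<gamma> \<beta> k u) / 4) (at u)"
  proof (rule DERIV_cong)
    show "((\<lambda>u. k0 u * poly (pCons 0 (R n)) u + k1 u * poly (Q n) u) has_real_derivative
        - \<gamma> * k1 u / (2 * u) * poly (pCons 0 (R n)) u + poly (pderiv (pCons 0 (R n))) u * k0 u
        + (- \<gamma> * k0 u / 2 * poly (Q n) u + poly (pderiv (Q n)) u * k1 u)) (at u)"
      using assms by (intro DERIV_add DERIV_mult k0_deriv k1_deriv poly_DERIV)
  qed (use assms S in \<open>simp add: field_simps\<close>)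
  from DERIV_divide[OF this DERIV_ident] assms
  show ?thesis
    unfolding phi1_def[abs_def] phi2_def by (simp add: field_simps power2_eq_square)
qed

lemma k_bounds:
  "\<exists>C>0. \<forall>u. 0 < u \<longrightarrow> u \<le> U \<longrightarrow> \<bar>k0 u\<bar> \<le> C * u powr (-1/4) \<and> \<bar>k1 u\<bar> \<le> C"
proof -
  obtain C where C: "C > 0" "\<And>y. 0 < y \<Longrightarrow> y \<le> \<gamma>\<^sup>2 * U / 4 \<Longrightarrow>
      \<bar>kappa0 y\<bar> \<le> C * y powr (-1/4) \<and> \<bar>kappa1 y\<bar> \<le> C"
    using kappa_bounds by metis
  define c where "c = (\<gamma>\<^sup>2 / 4) powr (-1/4)"
  have c: "c > 0" using gamma_pos by (simp add: c_def)
  define D where "D = C * c + C / \<gamma>"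
  have "\<bar>k0 u\<bar> \<le> D * u powr (-1/4) \<and> \<bar>k1 u\<bar> \<le> D" if u: "0 < u" "u \<le> U" for u
  proof
    have y: "0 < \<gamma>\<^sup>2 * u / 4" "\<gamma>\<^sup>2 * u / 4 \<le> \<gamma>\<^sup>2 * U / 4" using u gamma_pos by auto
    have "(\<gamma>\<^sup>2 * u / 4) powr (-1/4) = c * u powr (-1/4)"
      using powr_mult[of "\<gamma>\<^sup>2 / 4" u "-1/4"] u gamma_pos by (simp add: c_def)
    then have "\<bar>k0 u\<bar> \<le> C * c * u powr (-1/4)"
      using C(2)[OF y] by (simp add: k0_def)
    also have "\<dots> \<le> D * u powr (-1/4)"
      using C(1) c gamma_pos by (intro mult_right_mono) (auto simp: D_def)
    finally show "\<bar>k0 u\<bar> \<le> D * u powr (-1/4)" .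
    have "\<bar>k1 u\<bar> \<le> C / \<gamma>"
      using C(2)[OF y] gamma_pos by (simp add: k1_def divide_right_mono)
    also have "\<dots> \<le> D" using C(1) c by (simp add: D_def)
    finally show "\<bar>k1 u\<bar> \<le> D" .
  qed
  moreover have "D > 0" using C(1) c gamma_pos by (simp add: D_def add_pos_pos)
  ultimately show ?thesis by blast
qed

lemma phi_bounds_01:
  "\<exists>C>0. \<forall>u. 0 < u \<longrightarrow> u \<le> U \<longrightarrow> \<bar>phi \<gamma> \<beta> n u\<bar> \<le> C * u powr (-1/4) \<and> \<bar>phi1 n u\<bar> \<le> C / u"
proof -
  obtain C where C: "C > 0" "\<And>u. 0 < u \<Longrightarrow> u \<le> U \<Longrightarrow> \<bar>k0 u\<bar> \<le> C * u powr (-1/4)"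
      "\<And>u. 0 < u \<Longrightarrow> u \<le> U \<Longrightarrow> \<bar>k1 u\<bar> \<le> C"
    using k_bounds by metis
  have poly_bound: "\<exists>B>0. \<forall>y\<in>{0..U}. \<bar>poly p y\<bar> \<le> B" for p :: "real poly"
    by (intro continuous_bound_interval continuous_intros)
  obtain a where a: "a > 0" "\<And>u. u \<in> {0..U} \<Longrightarrow> \<bar>poly (V n) u\<bar> \<le> a" using poly_bound by metis
  obtain b where b: "b > 0" "\<And>u. u \<in> {0..U} \<Longrightarrow> \<bar>poly (W n) u\<bar> \<le> b" using poly_bound by metis
  obtain c where c: "c > 0" "\<And>u. u \<in> {0..U} \<Longrightarrow> \<bar>poly (R n) u\<bar> \<le> c" using poly_bound by metis
  obtain d where d: "d > 0" "\<And>u. u \<in> {0..U} \<Longrightarrow> \<bar>poly (Q n) u\<bar> \<le> d" using poly_bound by metis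
  define D where "D = (C * a + C * (1 + \<bar>U\<bar>) * b) + (C * (1 + \<bar>U\<bar>) * c + C * d)"
  have D: "D > 0" unfolding D_def using C(1) a(1) b(1) c(1) d(1) by (intro add_pos_pos) auto
  have "\<bar>phi \<gamma> \<beta> n u\<bar> \<le> D * u powr (-1/4) \<and> \<bar>phi1 n u\<bar> \<le> D / u" if u: "0 < u" "u \<le> U" for u
  proof
    have uU: "u \<in> {0..U}" "1 + \<bar>U\<bar> = 1 + U" using u by auto
    define p where "p = u powr (-1/4)"
    have p: "p \<ge> 0" "1 \<le> (1 + \<bar>U\<bar>) * p" "u * p \<le> 1 + \<bar>U\<bar>"
      using one_le_powr_bound[OF u] powr_three_quarters_bound[OF u] uU by (auto simp: p_def)
    have "\<bar>phi \<gamma> \<beta> n u\<bar> \<le> \<bar>k0 u\<bar> * \<bar>poly (V n) u\<bar> + \<bar>k1 u\<bar> * \<bar>poly (W n) u\<bar>"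
      unfolding phi_eq[OF u(1)] abs_mult[symmetric] by (rule abs_triangle_ineq)
    also have "\<dots> \<le> C * p * a + C * b"
      using C(2,3)[OF u] a(2)[OF uU(1)] b(2)[OF uU(1)] C(1) p(1)
      by (intro add_mono mult_mono) (auto simp: p_def)
    also have "C * b \<le> C * b * ((1 + \<bar>U\<bar>) * p)"
      using p(2) C(1) b(1) mult_left_mono[of 1 "(1 + \<bar>U\<bar>) * p" "C * b"] by simp
    finally have "\<bar>phi \<gamma> \<beta> n u\<bar> \<le> (C * a + C * (1 + \<bar>U\<bar>) * b) * p" by (simp add: algebra_simps)
    also have "\<dots> \<le> D * p" unfolding D_def using p(1) C(1) c(1) d(1)
      by (intro mult_right_mono) auto
    finally show "\<bar>phi \<gamma> \<beta> n u\<bar> \<le> D * u powr (-1/4)" by (simp add: p_def)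
    have "\<bar>k0 u * (u * poly (R n) u) + k1 u * poly (Q n) u\<bar>
        \<le> (\<bar>k0 u\<bar> * u) * \<bar>poly (R n) u\<bar> + \<bar>k1 u\<bar> * \<bar>poly (Q n) u\<bar>"
      using u abs_triangle_ineq[of "k0 u * (u * poly (R n) u)" "k1 u * poly (Q n) u"]
      by (simp add: abs_mult mult.assoc)
    also have "\<dots> \<le> (C * p * u) * c + C * d"
      using C(2,3)[OF u] c(2)[OF uU(1)] d(2)[OF uU(1)] C(1) p(1) u
      by (intro add_mono mult_mono) (auto simp: p_def)
    also have "C * p * u = C * (u * p)" by simp
    also have "\<dots> * c + C * d \<le> C * (1 + \<bar>U\<bar>) * c + C * d"
      using p(3) C(1) c(1) by (intro add_mono mult_right_mono mult_left_mono) auto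
    also have "\<dots> \<le> D" unfolding D_def using C(1) a(1) b(1) by simp
    finally show "\<bar>phi1 n u\<bar> \<le> D / u"
      unfolding phi1_def abs_divide using u by (simp add: divide_right_mono)
  qed
  then show ?thesis using D by blast
qed

lemma phi2_bound: "\<exists>C>0. \<forall>u. 0 < u \<longrightarrow> u \<le> U \<longrightarrow> \<bar>phi2 n u\<bar> \<le> C / u\<^sup>2"
proof -
  obtain B where B: "\<And>k. B k > 0" "\<And>k u. 0 < u \<Longrightarrow> u \<le> U \<Longrightarrow> \<bar>phi \<gamma> \<beta> k u\<bar> \<le> B k * u powr (-1/4)"
      "\<And>k u. 0 < u \<Longrightarrow> u \<le> U \<Longrightarrow> \<bar>phi1 k u\<bar> \<le> B k / u"
    using phi_bounds_01 by metis
  define S where "S = (\<Sum>k=0..n. \<bar>\<beta> (n - k)\<bar> * B k)"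
  have S: "S \<ge> 0" unfolding S_def using B(1) by (intro sum_nonneg) (simp add: less_imp_le)
  define D where "D = S * (1 + \<bar>U\<bar>) + B n"
  have D: "D > 0" unfolding D_def using S B(1)[of n] by (intro add_nonneg_pos) auto
  have "\<bar>phi2 n u\<bar> \<le> D / u\<^sup>2" if u: "0 < u" "u \<le> U" for u
  proof -
    have "\<bar>\<Sum>k=0..n. \<beta> (n - k) * phi \<gamma> \<beta> k u\<bar> \<le> (\<Sum>k=0..n. \<bar>\<beta> (n - k)\<bar> * (B k * u powr (-1/4)))"
      using B(2)[OF u] by (intro order_trans[OF sum_abs] sum_mono) (simp add: abs_mult mult_left_mono)
    also have "\<dots> = S * u powr (-1/4)" by (simp add: S_def sum_distrib_right mult.assoc)
    finally have "\<bar>(\<Sum>k=0..n. \<beta> (n - k) * phi \<gamma> \<beta> k u) / 4 - phi1 n u\<bar>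
        \<le> S * u powr (-1/4) + B n / u"
      using B(3)[OF u, of n] S by (simp add: abs_if split: if_splits)
    also have "S * u powr (-1/4) = S * (u * u powr (-1/4)) / u" using u by simp
    also have "\<dots> \<le> S * (1 + \<bar>U\<bar>) / u"
      using powr_three_quarters_bound[OF u] S u by (intro divide_right_mono mult_left_mono) auto
    also have "S * (1 + \<bar>U\<bar>) / u + B n / u = D / u" by (simp add: D_def add_divide_distrib)
    finally show ?thesis
      unfolding phi2_def abs_divide using u
      by (simp add: divide_right_mono power2_eq_square flip: divide_divide_eq_left)
  qed
  then show ?thesis using D by blast
qed

sublocale log_kernel "phi \<gamma> \<beta> n" "phi1 n" "phi2 n" for n
proof
  show "continuous_on {0<..} (phi2 n)"
    unfolding phi2_def[abs_def]
    by (intro continuous_intros continuous_at_imp_continuous_on ballI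
        DERIV_isCont[OF phi_deriv] DERIV_isCont[OF phi1_deriv]) auto
  fix U
  obtain C where C: "C > 0" "\<And>u. 0 < u \<Longrightarrow> u \<le> U \<Longrightarrow>
      \<bar>phi \<gamma> \<beta> n u\<bar> \<le> C * u powr (-1/4) \<and> \<bar>phi1 n u\<bar> \<le> C / u"
    using phi_bounds_01 by metis
  obtain D where D: "D > 0" "\<And>u. 0 < u \<Longrightarrow> u \<le> U \<Longrightarrow> \<bar>phi2 n u\<bar> \<le> D / u\<^sup>2"
    using phi2_bound by metis
  have m: "C \<le> max C D" "D \<le> max C D" by auto
  show "\<exists>C>0. \<forall>u. 0 < u \<longrightarrow> u \<le> U \<longrightarrow> \<bar>phi \<gamma> \<beta> n u\<bar> \<le> C * u powr (-1/4) \<and>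
      \<bar>phi1 n u\<bar> \<le> C / u \<and> \<bar>phi2 n u\<bar> \<le> C / u\<^sup>2"
  proof (intro exI[of _ "max C D"] conjI allI impI)
    fix u assume u: "0 < u" "u \<le> U"
    show "\<bar>phi \<gamma> \<beta> n u\<bar> \<le> max C D * u powr (-1/4)"
      using C(2)[OF u] mult_right_mono[OF m(1), of "u powr (-1/4)"] by simp
    show "\<bar>phi1 n u\<bar> \<le> max C D / u"
      using C(2)[OF u] divide_right_mono[OF m(1), of u] u by linarith
    show "\<bar>phi2 n u\<bar> \<le> max C D / u\<^sup>2"
      using D(2)[OF u] divide_right_mono[OF m(2), of "u\<^sup>2"] u by force
  qed (use C in auto)
qed (use phi_deriv phi1_deriv in auto)

text \<open>In two dimensions a function \<open>\<phi> (|x - y|\<^sup>2)\<close> has Laplacian \<open>4 \<phi>' + 4 u \<phi>''\<close>, so this is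
  \<open>\<Delta> \<Phi>\<^sub>n = \<Sum> \<beta>\<^sub>n\<^sub>-\<^sub>k \<Phi>\<^sub>k\<close>.\<close>

lemma phi_laplace:
  assumes "u > 0"
  shows "4 * phi1 n u + 4 * u * phi2 n u = (\<Sum>k=0..n. \<beta> (n - k) * phi \<gamma> \<beta> k u)"
  using assms by (simp add: phi2_def field_simps)

end

section \<open>Geometry of the boundary curves\<close>

lemma rot90_nth [simp]: "rot90 v $ 1 = - (v $ 2)" "rot90 v $ 2 = v $ 1"
  by (simp_all add: rot90_def)

lemma inner_real2: "(v :: real^2) \<bullet> w = v $ 1 * w $ 1 + v $ 2 * w $ 2"
  by (simp add: inner_vec_def sum_2)

lemma norm_rot90 [simp]: "norm (rot90 v) = norm v"
  by (simp add: norm_eq_sqrt_inner inner_real2)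

lemma bounded_linear_rot90: "bounded_linear rot90"
proof (rule bounded_linear_intro[of _ 1])
  show "rot90 (x + y) = rot90 x + rot90 y" for x y by (simp add: vec_eq_iff forall_2)
  show "rot90 (r *\<^sub>R x) = r *\<^sub>R rot90 x" for r x by (simp add: vec_eq_iff forall_2)
qed simp

lemma rot90_rot90: "rot90 (rot90 v) = - v"
  by (simp add: vec_eq_iff forall_2)

lemma periodic_shift_int:
  fixes f :: "real \<Rightarrow> 'a"
  assumes "\<And>s. f (s + L) = f s"
  shows "f (s + of_int k * L) = f s"
proof -
  have nat: "f (s + real n * L) = f s" for n s
  proof (induction n)
    case (Suc n)
    have "f (s + real (Suc n) * L) = f ((s + real n * L) + L)" by (simp add: algebra_simps)
    then show ?case using assms Suc by simp
  qed simp
  show ?thesis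
  proof (cases "k \<ge> 0")
    case True
    then show ?thesis using nat[of s "nat k"] by simp
  next
    case False
    then show ?thesis using nat[of "s + of_int k * L" "nat (- k)"] by simp
  qed
qed

lemma reduce_mod_period:
  assumes "(L::real) > 0"
  shows "\<exists>k::int. 0 \<le> s + of_int k * L \<and> s + of_int k * L < L"
proof
  have "of_int \<lfloor>s / L\<rfloor> * L \<le> s"
    using mult_right_mono[OF of_int_floor_le[of "s / L"], of L] assms by simp
  moreover have "s < (of_int \<lfloor>s / L\<rfloor> + 1) * L"
    using assms floor_correct[of "s / L"] by (simp add: pos_divide_less_eq[symmetric])
  ultimately show "0 \<le> s + of_int (- \<lfloor>s / L\<rfloor>) * L \<and> s + of_int (- \<lfloor>s / L\<rfloor>) * L < L"
    by (simp add: algebra_simps)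
qed

lemma nearest_mod_period:
  assumes "(L::real) > 0"
  shows "\<exists>k::int. \<bar>s - (t + of_int k * L)\<bar> \<le> L / 2"
proof
  define x where "x = (s - t) / L"
  have "\<bar>x - of_int (round x)\<bar> \<le> 1 / 2" using of_int_round_abs_le[of x] by linarith
  then have "\<bar>x - of_int (round x)\<bar> * L \<le> 1 / 2 * L" using assms by (intro mult_right_mono) auto
  moreover have "\<bar>x - of_int (round x)\<bar> * L = \<bar>s - (t + of_int (round x) * L)\<bar>"
  proof -
    have "s - (t + of_int (round x) * L) = (x - of_int (round x)) * L"
      using assms by (simp add: x_def field_simps)
    then show ?thesis using assms by (simp add: abs_mult)
  qed
  ultimately show "\<bar>s - (t + of_int (round x) * L)\<bar> \<le> L / 2" by simp
qed

text \<open>The primitive of \<open>|x|\<^sup>-\<^sup>p\<close> is the odd function \<open>sgn x |x|\<^sup>1\<^sup>-\<^sup>p / (1 - p)\<close>; writing it with two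
  maxima makes its continuity at the singular point visible.\<close>

lemma abs_powr_has_integral:
  fixes a p :: real
  assumes "0 < p" "p < 1" "b \<le> c"
  defines "G \<equiv> \<lambda>x. (max x 0 powr (1 - p) - max (- x) 0 powr (1 - p)) / (1 - p)"
  shows "((\<lambda>t. \<bar>t - a\<bar> powr (- p)) has_integral (G (c - a) - G (b - a))) {b..c}"
proof (rule fundamental_theorem_of_calculus_strong[of "{a}"])
  show "continuous_on {b..c} (\<lambda>t. G (t - a))"
    unfolding G_def using assms(1,2) by (intro continuous_intros continuous_on_powr') auto
  fix t assume "t \<in> {b..c} - {a}"
  then consider "t > a" | "t < a" by force
  then have "((\<lambda>t. G (t - a)) has_real_derivative \<bar>t - a\<bar> powr (- p)) (at t)"
  proof cases
    case 1
    have "((\<lambda>t. (t - a) powr (1 - p) / (1 - p)) has_real_derivative (t - a) powr (- p)) (at t)"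
      using 1 assms(1,2) by (auto intro!: derivative_eq_intros)
    moreover have "\<forall>\<^sub>F x in nhds t. G (x - a) = (x - a) powr (1 - p) / (1 - p)"
      using 1 assms(1,2) by (intro eventually_nhds_in_open[of "{a<..}", THEN eventually_mono])
        (auto simp: G_def max_def)
    ultimately show ?thesis using 1 by (simp cong: DERIV_cong_ev)
  next
    case 2
    have "((\<lambda>t. - ((a - t) powr (1 - p) / (1 - p))) has_real_derivative (a - t) powr (- p)) (at t)"
      using 2 assms(1,2) by (auto intro!: derivative_eq_intros)
    moreover have "\<forall>\<^sub>F x in nhds t. G (x - a) = - ((a - x) powr (1 - p) / (1 - p))"
      using 2 assms(1,2) by (intro eventually_nhds_in_open[of "{..<a}", THEN eventually_mono])
        (auto simp: G_def max_def)
    ultimately show ?thesis using 2 by (simp cong: DERIV_cong_ev)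
  qed
  then show "((\<lambda>t. G (t - a)) has_vector_derivative \<bar>t - a\<bar> powr (- p)) (at t)"
    by (simp add: has_real_derivative_iff_has_vector_derivative)
qed (use assms in auto)

lemma abs_powr_integral_bound:
  fixes a p L :: real
  assumes "0 < p" "p < 1" "0 < L" "- L \<le> a" "a \<le> 2 * L"
  shows "(\<lambda>t. \<bar>t - a\<bar> powr (- p)) integrable_on {0..L}"
    and "integral {0..L} (\<lambda>t. \<bar>t - a\<bar> powr (- p)) \<le> 2 * (2 * L) powr (1 - p) / (1 - p)"
proof -
  note I = abs_powr_has_integral[OF assms(1,2), of 0 L a]
  show "(\<lambda>t. \<bar>t - a\<bar> powr (- p)) integrable_on {0..L}"
    using I assms(3) by (auto simp: integrable_on_def)
  have b: "max x 0 powr (1 - p) \<le> (2 * L) powr (1 - p)" if "x \<le> 2 * L" for x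
    using that assms by (intro powr_mono2) auto
  have "integral {0..L} (\<lambda>t. \<bar>t - a\<bar> powr (- p)) =
      ((max (L - a) 0 powr (1 - p) - max (a - L) 0 powr (1 - p))
      - (max (- a) 0 powr (1 - p) - max a 0 powr (1 - p))) / (1 - p)"
    using I assms by (simp add: integral_unique diff_divide_distrib)
  also have "\<dots> \<le> ((2 * L) powr (1 - p) + (2 * L) powr (1 - p)) / (1 - p)"
  proof (rule divide_right_mono)
    have "max (a - L) 0 powr (1 - p) \<ge> 0" "max (- a) 0 powr (1 - p) \<ge> 0" by simp_all
    then show "(max (L - a) 0 powr (1 - p) - max (a - L) 0 powr (1 - p))
        - (max (- a) 0 powr (1 - p) - max a 0 powr (1 - p))
        \<le> (2 * L) powr (1 - p) + (2 * L) powr (1 - p)"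
      using b[of "L - a"] b[of a] assms by linarith
  qed (use assms in auto)
  finally show "integral {0..L} (\<lambda>t. \<bar>t - a\<bar> powr (- p)) \<le> 2 * (2 * L) powr (1 - p) / (1 - p)"
    by simp
qed

locale C3_boundary =
  fixes \<C> :: "(real \<times> (real \<Rightarrow> real^2)) set" and \<nu> :: "real^2 \<Rightarrow> real^2"
  assumes finite_curves: "finite \<C>"
    and closed_curve: "(L, z) \<in> \<C> \<Longrightarrow> C3_closed_curve L z"
    and disjoint_curves: "disjoint_family_on (\<lambda>(L, z). range z) \<C>"
    and tangent: "(L, z) \<in> \<C> \<Longrightarrow> vector_derivative z (at s) = rot90 (\<nu> (z s))"
begin

definition \<tau> :: "real^2 \<Rightarrow> real^2" where "\<tau> x = rot90 (\<nu> x)"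

lemma normal_tangent [simp]: "\<nu> x \<bullet> \<tau> x = 0"
  by (simp add: \<tau>_def inner_real2)

context
  fixes L :: real and z :: "real \<Rightarrow> real^2"
  assumes Lz: "(L, z) \<in> \<C>"
begin

lemma L_pos: "L > 0" and z_period: "z (s + L) = z s" and z_inj: "inj_on z {0..<L}"
  using closed_curve[OF Lz] by (auto simp: C3_closed_curve_def)

lemma z_deriv: "(z has_vector_derivative \<tau> (z s)) (at s)"
proof -
  obtain D where D: "D 0 = z" "\<And>j t. j < 3 \<Longrightarrow> (D j has_vector_derivative D (Suc j) t) (at t)"
    using closed_curve[OF Lz] by (auto simp: C3_closed_curve_def C_k_def)
  have "(z has_vector_derivative D 1 s) (at s)" using D(2)[of 0 s] D(1) by simp
  then show ?thesis
    using tangent[OF Lz, of s] by (simp add: vector_derivative_at \<tau>_def)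
qed

lemma norm_tangent [simp]: "norm (\<tau> (z s)) = 1"
  using closed_curve[OF Lz] tangent[OF Lz] by (simp add: C3_closed_curve_def \<tau>_def)

lemma norm_normal [simp]: "norm (\<nu> (z s)) = 1"
  using norm_tangent[of s] by (simp add: \<tau>_def)

lemma z_cont: "continuous_on S z"
  using z_deriv has_vector_derivative_continuous continuous_at_imp_continuous_on by blast

lemma z_shift: "z (s + of_int k * L) = z s"
  by (rule periodic_shift_int[of z L]) (rule z_period)

text \<open>The curvature vector is continuous and periodic, hence bounded.\<close>

lemma tangent_Lipschitz: "\<exists>B>0. \<forall>s t. norm (\<tau> (z s) - \<tau> (z t)) \<le> B * \<bar>s - t\<bar>"
proof -
  obtain D where D: "D 0 = z" "\<And>j t. j < 3 \<Longrightarrow> (D j has_vector_derivative D (Suc j) t) (at t)"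
    using closed_curve[OF Lz] by (auto simp: C3_closed_curve_def C_k_def)
  have "(z has_vector_derivative D 1 s) (at s)" for s using D(2)[of 0 s] D(1) by simp
  then have D1: "D 1 = (\<lambda>s. \<tau> (z s))"
    using z_deriv vector_derivative_unique_at by fast
  have d2: "((\<lambda>s. \<tau> (z s)) has_vector_derivative D 2 s) (at s)" for s
    using D(2)[of 1 s] D1 by (simp add: numeral_2_eq_2)
  have "D 2 (s + L) = D 2 s" for s
  proof -
    have "((\<lambda>s. \<tau> (z (s + L))) has_vector_derivative D 2 (s + L)) (at s)"
    proof -
      have "((\<lambda>s. s + L) has_vector_derivative 1) (at s)" 
        by (auto intro!: derivative_eq_intros)
      from vector_diff_chain_at[OF this d2] show ?thesis by (simp add: o_def)
    qed
    then show ?thesis using d2[of s] vector_derivative_unique_at by (simp add: z_period) fast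
  qed
  note per = periodic_shift_int[of "D 2", OF this]
  have "continuous_on {0..L} (D 2)"
    using D(2)[of 2] has_vector_derivative_continuous continuous_at_imp_continuous_on
    by (metis lessI numeral_2_eq_2 numeral_3_eq_3)
  then have "bounded (D 2 ` {0..L})"
    using compact_continuous_image compact_imp_bounded by blast
  then obtain B where B: "B > 0" "\<And>s. s \<in> {0..L} \<Longrightarrow> norm (D 2 s) \<le> B"
    unfolding bounded_pos by auto
  have bound: "norm (D 2 s) \<le> B" for s
  proof -
    obtain k :: int where "0 \<le> s + of_int k * L" "s + of_int k * L < L"
      using reduce_mod_period[OF L_pos] by blast
    then show ?thesis using B(2)[of "s + of_int k * L"] per[of s k] by simp
  qed
  have "norm (\<tau> (z s) - \<tau> (z t)) \<le> B * \<bar>s - t\<bar>" for s t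
  proof -
    have "norm (\<tau> (z s) - \<tau> (z t)) \<le> B * norm (s - t)"
    proof (rule differentiable_bound[of UNIV _ "\<lambda>x h. h *\<^sub>R D 2 x"])
      show "((\<lambda>s. \<tau> (z s)) has_derivative (\<lambda>h. h *\<^sub>R D 2 x)) (at x within UNIV)" for x
        using d2[of x] by (simp add: has_vector_derivative_def)
      show "onorm (\<lambda>h. h *\<^sub>R D 2 x) \<le> B" for x
        by (rule onorm_bound) (use B(1) bound[of x] in \<open>simp_all add: mult.commute[of B] mult_left_mono\<close>)
    qed auto
    then show ?thesis by simp
  qed
  then show ?thesis using B(1) by blast
qed

lemma tangent_cont: "continuous_on S (\<lambda>t. \<tau> (z t))"
proof -
  obtain B where B: "B > 0" "\<And>s t. norm (\<tau> (z s) - \<tau> (z t)) \<le> B * \<bar>s - t\<bar>"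
    using tangent_Lipschitz by blast
  have "B-lipschitz_on S (\<lambda>t. \<tau> (z t))"
    by (rule lipschitz_onI) (use B in \<open>auto simp: dist_norm\<close>)
  then show ?thesis by (rule lipschitz_on_continuous_on)
qed

lemma normal_cont: "continuous_on S (\<lambda>t. \<nu> (z t))"
proof -
  have "\<nu> x = - rot90 (\<tau> x)" for x by (simp add: \<tau>_def rot90_rot90)
  moreover have "continuous_on S (\<lambda>t. - rot90 (\<tau> (z t)))"
    by (intro continuous_intros bounded_linear.continuous_on[OF bounded_linear_rot90] tangent_cont)
  ultimately show ?thesis by simp
qed

lemma taylor_bound:
  "\<exists>B>0. \<forall>s t. norm (z t - z s - (t - s) *\<^sub>R \<tau> (z s)) \<le> B * \<bar>s - t\<bar>\<^sup>2"
proof -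
  obtain B where B: "B > 0" "\<And>s t. norm (\<tau> (z s) - \<tau> (z t)) \<le> B * \<bar>s - t\<bar>"
    using tangent_Lipschitz by blast
  have seg: "norm (z t - z s - (t - s) *\<^sub>R \<tau> (z s)) \<le> norm (t - s) * (B * \<bar>s - t\<bar>)" for s t
  proof (rule vector_differentiable_bound_linearization[of "closed_segment s t"])
    show "(z has_vector_derivative \<tau> (z x)) (at x within closed_segment s t)" for x
      using z_deriv has_vector_derivative_at_within by blast
    show "\<And>x. x \<in> closed_segment s t \<Longrightarrow> norm (\<tau> (z x) - \<tau> (z s)) \<le> B * \<bar>s - t\<bar>"
    proof -
      fix x assume "x \<in> closed_segment s t"
      then have "\<bar>x - s\<bar> \<le> \<bar>s - t\<bar>" by (auto simp: closed_segment_eq_real_ivl split: if_splits)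
      then have "B * \<bar>x - s\<bar> \<le> B * \<bar>s - t\<bar>" using B(1) by simp
      then show "norm (\<tau> (z x) - \<tau> (z s)) \<le> B * \<bar>s - t\<bar>" using B(2)[of x s] by linarith
    qed
  qed auto
  then have "norm (z t - z s - (t - s) *\<^sub>R \<tau> (z s)) \<le> B * \<bar>s - t\<bar>\<^sup>2" for s t
  proof -
    have "norm (t - s) * (B * \<bar>s - t\<bar>) = B * \<bar>s - t\<bar>\<^sup>2"
      unfolding power2_eq_square by (simp add: abs_minus_commute[of t s] del: abs_mult_self_eq)
    then show ?thesis using seg[where s = s and t = t] by metis
  qed
  then show ?thesis using B(1) by blast
qed

lemma z_eq_imp:
  assumes "z s = z t" "\<bar>s - t\<bar> < L" shows "s = t"
proof -
  obtain k :: int where k: "0 \<le> s + of_int k * L" "s + of_int k * L < L"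
    using reduce_mod_period[OF L_pos] by blast
  obtain m :: int where m: "0 \<le> t + of_int m * L" "t + of_int m * L < L"
    using reduce_mod_period[OF L_pos] by blast
  have "z (s + of_int k * L) = z (t + of_int m * L)" using assms(1) by (simp add: z_shift)
  then have e: "s + of_int k * L = t + of_int m * L"
    using z_inj k m by (auto dest: inj_onD)
  then have "s - t = of_int (m - k) * L" by (simp add: algebra_simps)
  then have "\<bar>of_int (m - k)\<bar> * L < 1 * L" using assms(2) L_pos by (simp add: abs_mult)
  then have "\<bar>of_int (m - k) :: real\<bar> < 1" using L_pos by (simp only: mult_less_cancel_right_pos)
  then have "m = k" by linarith
  then show ?thesis using e by simp
qed

text \<open>Near the diagonal the chord is comparable to the arc because the tangent is Lipschitz; away
  from it the chord is bounded below because the curve is simple and compact.\<close>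

lemma chord_arc: "\<exists>c>0. \<forall>s t. \<bar>s - t\<bar> \<le> L / 2 \<longrightarrow> c * \<bar>s - t\<bar> \<le> dist (z s) (z t)"
proof -
  obtain B where B: "B > 0" "\<And>s t. norm (z t - z s - (t - s) *\<^sub>R \<tau> (z s)) \<le> B * \<bar>s - t\<bar>\<^sup>2"
    using taylor_bound by blast
  have near: "\<bar>s - t\<bar> / 2 \<le> dist (z s) (z t)" if "\<bar>s - t\<bar> \<le> 1 / (2 * B)" for s t
  proof -
    have "norm ((t - s) *\<^sub>R \<tau> (z s)) \<le> norm (z t - z s) + B * \<bar>s - t\<bar>\<^sup>2"
      using B(2)[of t s] norm_triangle_sub[of "(t - s) *\<^sub>R \<tau> (z s)" "z t - z s"]
      by (simp add: norm_minus_commute)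
    moreover have "B * \<bar>s - t\<bar>\<^sup>2 \<le> \<bar>s - t\<bar> / 2"
    proof -
      have "B * \<bar>s - t\<bar> \<le> 1 / 2" using that B(1) by (simp add: field_simps)
      then have "B * \<bar>s - t\<bar> * \<bar>s - t\<bar> \<le> 1 / 2 * \<bar>s - t\<bar>" by (rule mult_right_mono) simp
      then show ?thesis by (simp add: power2_eq_square)
    qed
    ultimately show ?thesis by (simp add: dist_norm norm_minus_commute abs_minus_commute)
  qed
  \<comment> \<open>Pairs that are neither close together nor more than half a period apart, reduced modulo the
     period to a compact set on which the chord does not vanish.\<close>
  define K where "K = {p \<in> {0..L} \<times> {- L..2 * L}. 1 / (2 * B) \<le> \<bar>fst p - snd p\<bar> \<and> \<bar>fst p - snd p\<bar> \<le> L / 2}"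
  have "compact K"
  proof -
    have "K = ({0..L} \<times> {- L..2 * L}) \<inter> {p. 1 / (2 * B) \<le> \<bar>fst p - snd p\<bar>} \<inter> {p. \<bar>fst p - snd p\<bar> \<le> L / 2}"
      by (auto simp: K_def)
    moreover have "closed {p :: real \<times> real. 1 / (2 * B) \<le> \<bar>fst p - snd p\<bar>}"
      "closed {p :: real \<times> real. \<bar>fst p - snd p\<bar> \<le> L / 2}"
      by (intro closed_Collect_le continuous_intros)+
    ultimately show ?thesis by (auto intro!: compact_Int_closed compact_Times)
  qed
  have "\<exists>m>0. \<forall>p\<in>K. m \<le> dist (z (fst p)) (z (snd p))"
  proof (cases "K = {}")
    case False
    have "continuous_on K (\<lambda>p. dist (z (fst p)) (z (snd p)))"
      by (intro continuous_intros continuous_on_compose2[OF z_cont[of UNIV]]) auto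
    then obtain q where q: "q \<in> K" "\<And>p. p \<in> K \<Longrightarrow> dist (z (fst q)) (z (snd q)) \<le> dist (z (fst p)) (z (snd p))"
      using continuous_attains_inf[OF \<open>compact K\<close> False] by blast
    have "fst q \<noteq> snd q" "\<bar>fst q - snd q\<bar> < L"
      using q(1) B(1) L_pos by (auto simp: K_def)
    then have "dist (z (fst q)) (z (snd q)) > 0" using z_eq_imp by auto
    then show ?thesis using q(2) by blast
  qed (auto intro: exI[of _ 1])
  then obtain m where m: "m > 0" "\<And>s t. (s, t) \<in> K \<Longrightarrow> m \<le> dist (z s) (z t)" by force
  define c where "c = min (1 / 2) (m / L)"
  have "c * \<bar>s - t\<bar> \<le> dist (z s) (z t)" if st: "\<bar>s - t\<bar> \<le> L / 2" for s t
  proof (cases "\<bar>s - t\<bar> \<le> 1 / (2 * B)")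
    case True
    have "c \<le> 1 / 2" unfolding c_def by (rule min.cobounded1)
    then have "c * \<bar>s - t\<bar> \<le> 1 / 2 * \<bar>s - t\<bar>" by (rule mult_right_mono) simp
    then show ?thesis using near[OF True] by simp
  next
    case False
    obtain k :: int where k: "0 \<le> s + of_int k * L" "s + of_int k * L < L"
      using reduce_mod_period[OF L_pos] by blast
    define s' where "s' = s + of_int k * L"
    define t' where "t' = t + of_int k * L"
    have s't': "s' - t' = s - t" by (simp add: s'_def t'_def)
    have "s' \<in> {0..L}" using k by (simp add: s'_def)
    moreover have "t' \<in> {- L..2 * L}" using calculation s't' st L_pos unfolding atLeastAtMost_iff by linarith
    ultimately have "(s', t') \<in> K" using False st s't' by (simp add: K_def)
    then have "m \<le> dist (z s) (z t)" using m(2)[of s' t'] by (simp add: s'_def t'_def z_shift)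
    moreover have "c * \<bar>s - t\<bar> \<le> m / L * L"
      using st L_pos m(1) by (intro mult_mono) (auto simp: c_def)
    ultimately show ?thesis using L_pos by simp
  qed
  moreover have "c > 0" using m(1) L_pos by (simp add: c_def)
  ultimately show ?thesis by blast
qed

text \<open>For any two parameters, one of the representatives of the second modulo the period is within
  half a period of the first. This turns estimates in terms of the parameter distance into
  estimates in terms of the chord.\<close>

lemma chord_representative:
  "\<exists>c>0. \<forall>s t. \<exists>k::int. c * \<bar>s - (t + of_int k * L)\<bar> \<le> dist (z s) (z t)"
proof -
  obtain c where c: "c > 0" "\<And>s t. \<bar>s - t\<bar> \<le> L / 2 \<Longrightarrow> c * \<bar>s - t\<bar> \<le> dist (z s) (z t)"
    using chord_arc by blast
  have "\<exists>k::int. c * \<bar>s - (t + of_int k * L)\<bar> \<le> dist (z s) (z t)" for s t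
  proof -
    obtain k :: int where "\<bar>s - (t + of_int k * L)\<bar> \<le> L / 2"
      using nearest_mod_period[OF L_pos] by blast
    then show ?thesis using c(2)[of s "t + of_int k * L"] by (auto simp: z_shift)
  qed
  then show ?thesis using c(1) by blast
qed

lemma tangent_chord: "\<exists>C>0. \<forall>s t. norm (\<tau> (z s) - \<tau> (z t)) \<le> C * dist (z s) (z t)"
proof -
  obtain B where B: "B > 0" "\<And>s t. norm (\<tau> (z s) - \<tau> (z t)) \<le> B * \<bar>s - t\<bar>"
    using tangent_Lipschitz by blast
  obtain c where c: "c > 0" "\<And>s t. \<exists>k::int. c * \<bar>s - (t + of_int k * L)\<bar> \<le> dist (z s) (z t)"
    using chord_representative by blast
  have "norm (\<tau> (z s) - \<tau> (z t)) \<le> B / c * dist (z s) (z t)" for s t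
  proof -
    obtain k :: int where k: "c * \<bar>s - (t + of_int k * L)\<bar> \<le> dist (z s) (z t)" using c(2) by blast
    have "norm (\<tau> (z s) - \<tau> (z t)) \<le> B * \<bar>s - (t + of_int k * L)\<bar>"
      using B(2)[of s "t + of_int k * L"] by (simp add: z_shift)
    also have "\<dots> = B / c * (c * \<bar>s - (t + of_int k * L)\<bar>)" using c(1) by simp
    also have "\<dots> \<le> B / c * dist (z s) (z t)"
      using k B(1) c(1) by (intro mult_left_mono) auto
    finally show ?thesis .
  qed
  then show ?thesis using B(1) c(1) by (intro exI[of _ "B / c"]) auto
qed

text \<open>The chord agrees with the tangent vector to second order, and the tangent is orthogonal to the
  normal.\<close>

lemma normal_chord_same:
  "\<exists>C>0. \<forall>s t. \<bar>\<nu> (z s) \<bullet> (z s - z t)\<bar> \<le> C * (dist (z s) (z t))\<^sup>2"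
proof -
  obtain B where B: "B > 0" "\<And>s t. norm (z t - z s - (t - s) *\<^sub>R \<tau> (z s)) \<le> B * \<bar>s - t\<bar>\<^sup>2"
    using taylor_bound by blast
  obtain c where c: "c > 0" "\<And>s t. \<exists>k::int. c * \<bar>s - (t + of_int k * L)\<bar> \<le> dist (z s) (z t)"
    using chord_representative by blast
  have "\<bar>\<nu> (z s) \<bullet> (z s - z t)\<bar> \<le> B / c\<^sup>2 * (dist (z s) (z t))\<^sup>2" for s t
  proof -
    obtain k :: int where k: "c * \<bar>s - (t + of_int k * L)\<bar> \<le> dist (z s) (z t)" using c(2) by blast
    define t' where "t' = t + of_int k * L"
    have zt': "z t' = z t" by (simp add: t'_def z_shift)
    have "\<nu> (z s) \<bullet> (z s - z t) = - (\<nu> (z s) \<bullet> (z t' - z s - (t' - s) *\<^sub>R \<tau> (z s)))"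
      by (simp add: zt' inner_diff_right)
    then have "\<bar>\<nu> (z s) \<bullet> (z s - z t)\<bar> \<le> norm (z t' - z s - (t' - s) *\<^sub>R \<tau> (z s))"
      using Cauchy_Schwarz_ineq2[of "\<nu> (z s)" "z t' - z s - (t' - s) *\<^sub>R \<tau> (z s)"] by simp
    also have "\<dots> \<le> B * \<bar>s - t'\<bar>\<^sup>2" by (rule B(2))
    also have "\<dots> = B / c\<^sup>2 * (c * \<bar>s - t'\<bar>)\<^sup>2" using c(1) by (simp add: power_mult_distrib)
    also have "\<dots> \<le> B / c\<^sup>2 * (dist (z s) (z t))\<^sup>2"
      using k B(1) c(1) unfolding t'_def by (intro mult_left_mono power_mono) auto
    finally show ?thesis .
  qed
  then show ?thesis using B(1) c(1) by (intro exI[of _ "B / c\<^sup>2"]) auto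
qed

text \<open>A point with parameter \<open>a\<close> is reached again at \<open>a - L\<close> and \<open>a + L\<close>, and every parameter in
  \<open>{0..L}\<close> is within half a period of one of the three. The sum of three translates of
  \<open>|t|\<^sup>-\<^sup>p\<close> therefore dominates, and its integral is bounded independently of the base point.\<close>

lemma majorant_same:
  assumes "0 < p" "p < 1"
  shows "\<exists>K. \<forall>s. \<exists>w. w integrable_on {0..L} \<and> integral {0..L} w \<le> K \<and>
    (\<forall>t\<in>{0..L}. dist (z s) (z t) powr (- p) \<le> w t)"
proof -
  obtain c where c: "c > 0" "\<And>s t. \<bar>s - t\<bar> \<le> L / 2 \<Longrightarrow> c * \<bar>s - t\<bar> \<le> dist (z s) (z t)"
    using chord_arc by blast
  define I where "I = 2 * (2 * L) powr (1 - p) / (1 - p)"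
  have "\<exists>w. w integrable_on {0..L} \<and> integral {0..L} w \<le> c powr (- p) * (I + (I + I)) \<and>
    (\<forall>t\<in>{0..L}. dist (z s) (z t) powr (- p) \<le> w t)" for s
  proof -
    obtain k :: int where k: "0 \<le> s + of_int k * L" "s + of_int k * L < L"
      using reduce_mod_period[OF L_pos] by blast
    define a where "a = s + of_int k * L"
    have za: "z s = z a" "z s = z (a - L)" "z s = z (a + L)"
      using z_shift[of s k] z_period[of "a - L"] z_period[of a] by (simp_all add: a_def)
    define f where "f b t = \<bar>t - b\<bar> powr (- p)" for b t :: real
    have f: "f b integrable_on {0..L}" "integral {0..L} (f b) \<le> I" if "b \<in> {a, a - L, a + L}" for b
      using abs_powr_integral_bound[OF assms L_pos, of b] that k
      by (auto simp: f_def[abs_def] I_def a_def)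
    define w where "w t = c powr (- p) * (f a t + (f (a - L) t + f (a + L) t))" for t
    have "w integrable_on {0..L}"
      unfolding w_def[abs_def] by (intro integrable_on_mult_right integrable_add f(1)) auto
    moreover have "integral {0..L} w \<le> c powr (- p) * (I + (I + I))"
    proof -
      have "integral {0..L} w = c powr (- p) * (integral {0..L} (f a)
          + (integral {0..L} (f (a - L)) + integral {0..L} (f (a + L))))"
        unfolding w_def[abs_def] by (simp add: integral_add integrable_add f(1))
      also have "\<dots> \<le> c powr (- p) * (I + (I + I))"
        using f(2) by (intro mult_left_mono add_mono) auto
      finally show ?thesis .
    qed
    moreover have "dist (z s) (z t) powr (- p) \<le> w t" if t: "t \<in> {0..L}" for t
    proof -
      have key: "dist (z s) (z t) powr (- p) \<le> c powr (- p) * f b t"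
        if "z s = z b" "\<bar>b - t\<bar> \<le> L / 2" for b
      proof (cases "b = t")
        case True
        then show ?thesis using that by (simp add: f_def)
      next
        case False
        have "dist (z s) (z t) powr (- p) \<le> (c * \<bar>t - b\<bar>) powr (- p)"
          using c(2)[OF that(2)] that(1) c(1) False assms
          by (intro powr_mono2') (auto simp: abs_minus_commute)
        then show ?thesis using c(1) by (simp add: f_def powr_mult)
      qed
      have nn: "0 \<le> f b t" for b by (simp add: f_def)
      consider "\<bar>a - t\<bar> \<le> L / 2" | "\<bar>a - L - t\<bar> \<le> L / 2" | "\<bar>a + L - t\<bar> \<le> L / 2"
        using t k unfolding a_def[symmetric] atLeastAtMost_iff by linarith
      then have "dist (z s) (z t) powr (- p) \<le> c powr (- p) * f a t \<or>
          dist (z s) (z t) powr (- p) \<le> c powr (- p) * f (a - L) t \<or>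
          dist (z s) (z t) powr (- p) \<le> c powr (- p) * f (a + L) t"
        using key[OF za(1)] key[OF za(2)] key[OF za(3)] by cases auto
      moreover have "0 \<le> c powr (- p) * f b t" for b using nn by simp
      ultimately show ?thesis
        unfolding w_def distrib_left by (smt (verit))
    qed
    ultimately show ?thesis by blast
  qed
  then show ?thesis by blast
qed

lemma finite_hits: "finite {t \<in> {0..L}. z t = x}"
proof (cases "\<exists>t\<in>{0..<L}. z t = x")
  case True
  then obtain t0 where t0: "t0 \<in> {0..<L}" "z t0 = x" by blast
  have "{t \<in> {0..L}. z t = x} \<subseteq> {t0, L}"
  proof
    fix t assume t: "t \<in> {t \<in> {0..L}. z t = x}"
    then show "t \<in> {t0, L}" using t0 z_inj by (cases "t = L") (auto dest: inj_onD)
  qed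
  then show ?thesis by (rule finite_subset) simp
next
  case False
  have "{t \<in> {0..L}. z t = x} \<subseteq> {L}"
    using False by force
  then show ?thesis by (rule finite_subset) simp
qed

lemma range_z: "range z = z ` {0..L}"
proof -
  have "z s \<in> z ` {0..L}" for s
  proof -
    obtain k :: int where "0 \<le> s + of_int k * L" "s + of_int k * L < L"
      using reduce_mod_period[OF L_pos] by blast
    then show ?thesis using z_shift[of s k] by (intro image_eqI[of _ _ "s + of_int k * L"]) auto
  qed
  then show ?thesis by auto
qed

lemma compact_range_z: "compact (range z)"
  unfolding range_z by (intro compact_continuous_image z_cont) auto

end

text \<open>The following estimates for a base curve \<open>z0\<close> and an integration curve \<open>z\<close> also cover two
  different curves, which have a positive distance.\<close>

context
  fixes L0 L :: real and z0 z :: "real \<Rightarrow> real^2"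
  assumes Lz0: "(L0, z0) \<in> \<C>" and Lz: "(L, z) \<in> \<C>"
begin

lemma separated:
  assumes "(L0, z0) \<noteq> (L, z)"
  shows "\<exists>d>0. \<forall>s t. d \<le> dist (z0 s) (z t)"
proof -
  have "range z0 \<inter> range z = {}"
    using disjoint_curves Lz0 Lz assms unfolding disjoint_family_on_def by fastforce
  then show ?thesis
    using separate_compact_closed[OF compact_range_z[OF Lz0] compact_imp_closed[OF compact_range_z[OF Lz]]]
    by auto
qed

lemma dist_bounded: "\<exists>D>0. \<forall>s t. dist (z0 s) (z t) \<le> D"
proof -
  have "bounded (range z0 \<union> range z)"
    using compact_range_z[OF Lz0] compact_range_z[OF Lz] compact_imp_bounded by auto
  then obtain e where e: "e > 0" "\<And>x. x \<in> range z0 \<union> range z \<Longrightarrow> norm x \<le> e"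
    unfolding bounded_pos by auto
  have "dist (z0 s) (z t) \<le> e + e" for s t
    using e(2)[of "z0 s"] e(2)[of "z t"] norm_triangle_ineq4[of "z0 s" "z t"] 
    by (simp add: dist_norm)
  then show ?thesis using e(1) by (intro exI[of _ "e + e"]) auto
qed

lemma normal_chord:
  "\<exists>C>0. \<forall>s t. \<bar>\<nu> (z0 s) \<bullet> (z0 s - z t)\<bar> \<le> C * (dist (z0 s) (z t))\<^sup>2"
proof (cases "(L0, z0) = (L, z)")
  case True
  then show ?thesis using normal_chord_same[OF Lz] by simp
next
  case False
  then obtain d where d: "d > 0" "\<And>s t. d \<le> dist (z0 s) (z t)" using separated by blast
  have "\<bar>\<nu> (z0 s) \<bullet> (z0 s - z t)\<bar> \<le> 1 / d * (dist (z0 s) (z t))\<^sup>2" for s t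
  proof -
    have "\<bar>\<nu> (z0 s) \<bullet> (z0 s - z t)\<bar> \<le> dist (z0 s) (z t)"
      using Cauchy_Schwarz_ineq2[of "\<nu> (z0 s)" "z0 s - z t"]
      by (simp add: norm_normal[OF Lz0] dist_norm)
    moreover
    have "dist (z0 s) (z t) * d \<le> dist (z0 s) (z t) * dist (z0 s) (z t)"
      by (intro mult_left_mono d(2)) auto
    then have "dist (z0 s) (z t) \<le> 1 / d * (dist (z0 s) (z t))\<^sup>2"
      using d(1) by (simp add: field_simps power2_eq_square)
    ultimately show ?thesis by linarith
  qed
  then show ?thesis using d(1) by (intro exI[of _ "1 / d"]) auto
qed

lemma majorant:
  assumes "0 < p" "p < 1"
  shows "\<exists>K. \<forall>s. \<exists>w. w integrable_on {0..L} \<and> integral {0..L} w \<le> K \<and>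
    (\<forall>t\<in>{0..L}. dist (z0 s) (z t) powr (- p) \<le> w t)"
proof (cases "(L0, z0) = (L, z)")
  case True
  then show ?thesis using majorant_same[OF Lz assms] by simp
next
  case False
  then obtain d where d: "d > 0" "\<And>s t. d \<le> dist (z0 s) (z t)" using separated by blast
  have "dist (z0 s) (z t) powr (- p) \<le> d powr (- p)" for s t
    using d assms by (intro powr_mono2') auto
  then show ?thesis
    by (intro exI[of _ "integral {0..L} (\<lambda>_. d powr (- p))"] allI exI[of _ "\<lambda>_. d powr (- p)"])
      (auto intro!: integrable_const_ivl)
qed

end

end

section \<open>Weakly singular integrals\<close>

context log_kernel
begin

lemma continuous_on_phi [continuous_intros]:
  assumes "continuous_on S f" "\<And>x. x \<in> S \<Longrightarrow> f x > 0"
  shows "continuous_on S (\<lambda>x. \<phi> (f x))" and "continuous_on S (\<lambda>x. \<phi>1 (f x))"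
    and "continuous_on S (\<lambda>x. \<phi>2 (f x))"
proof -
  have "continuous_on {0<..} \<phi>" "continuous_on {0<..} \<phi>1"
    using deriv1 deriv2 DERIV_isCont continuous_at_imp_continuous_on by (metis greaterThan_iff)+
  then show "continuous_on S (\<lambda>x. \<phi> (f x))" "continuous_on S (\<lambda>x. \<phi>1 (f x))"
      "continuous_on S (\<lambda>x. \<phi>2 (f x))"
    using assms cont2 by (auto intro: continuous_on_compose2[where t = "{0<..}"])
qed

lemma tendsto_phi:
  assumes "(f \<longlongrightarrow> u) F" "u > 0"
  shows "((\<lambda>x. \<phi> (f x)) \<longlongrightarrow> \<phi> u) F" "((\<lambda>x. \<phi>1 (f x)) \<longlongrightarrow> \<phi>1 u) F"
  using assms deriv1 deriv2 DERIV_isCont isCont_tendsto_compose by blast+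

text \<open>Since \<open>- C / u\<close> has derivative \<open>C / u\<^sup>2\<close>, the bound on \<open>\<phi>2\<close> makes \<open>- C / u \<plusminus> \<phi>1 u\<close> increasing.\<close>

lemma difference_bounds:
  "\<exists>C>0. \<forall>u v. 0 < u \<longrightarrow> u \<le> v \<longrightarrow> v \<le> U \<longrightarrow>
    \<bar>\<phi> u\<bar> \<le> C * u powr (-1/4) \<and> \<bar>\<phi>1 u\<bar> \<le> C / u \<and> \<bar>\<phi>1 v - \<phi>1 u\<bar> \<le> C * (1 / u - 1 / v)"
proof -
  obtain C where C: "C > 0" "\<And>u. 0 < u \<Longrightarrow> u \<le> U \<Longrightarrow> \<bar>\<phi> u\<bar> \<le> C * u powr (-1/4)"
    "\<And>u. 0 < u \<Longrightarrow> u \<le> U \<Longrightarrow> \<bar>\<phi>1 u\<bar> \<le> C / u" "\<And>u. 0 < u \<Longrightarrow> u \<le> U \<Longrightarrow> \<bar>\<phi>2 u\<bar> \<le> C / u\<^sup>2"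
    using bounds by metis
  have "\<bar>\<phi>1 v - \<phi>1 u\<bar> \<le> C * (1 / u - 1 / v)" if uv: "0 < u" "u \<le> v" "v \<le> U" for u v
  proof -
    have d: "((\<lambda>x. - C / x + e * \<phi>1 x) has_real_derivative C / x\<^sup>2 + e * \<phi>2 x) (at x)"
      if "0 < x" for x e
      using that by (auto intro!: derivative_eq_intros deriv2 simp: power2_eq_square)
    have "- C / u + e * \<phi>1 u \<le> - C / v + e * \<phi>1 v" if e: "\<bar>e\<bar> = 1" for e
    proof (rule DERIV_nonneg_imp_nondecreasing[OF uv(2)])
      fix x assume x: "u \<le> x" "x \<le> v"
      have "\<bar>e * \<phi>2 x\<bar> \<le> C / x\<^sup>2" using C(4)[of x] x uv e by (simp add: abs_mult)
      then have "0 \<le> C / x\<^sup>2 + e * \<phi>2 x" by linarith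
      then show "\<exists>y. ((\<lambda>x. - C / x + e * \<phi>1 x) has_real_derivative y) (at x) \<and> 0 \<le> y"
        using d[of x e] x uv by auto
    qed
    from this[of 1] this[of "-1"] show ?thesis by (simp add: algebra_simps abs_le_iff)
  qed
  then show ?thesis using C(1,2,3) by (intro exI[of _ C]) auto
qed

lemma ratio_le_powr:
  fixes h r a :: real
  assumes "0 < h" "0 < r" "0 < a" "a < 1"
  shows "h\<^sup>2 / (r\<^sup>2 + h\<^sup>2) \<le> (h / r) powr a"
proof (cases "h \<le> r")
  case True
  have "h\<^sup>2 / (r\<^sup>2 + h\<^sup>2) \<le> h\<^sup>2 / r\<^sup>2" using assms by (intro divide_left_mono mult_pos_pos) (auto intro: add_pos_pos)
  also have "\<dots> = (h / r) powr 2" using assms by (simp add: power_divide)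
  also have "\<dots> \<le> (h / r) powr a" using True assms by (intro powr_mono') auto
  finally show ?thesis .
next
  case False
  have "h\<^sup>2 / (r\<^sup>2 + h\<^sup>2) \<le> 1" using assms by (simp add: divide_le_eq add_pos_pos)
  also have "1 = (h / r) powr 0" using assms by simp
  also have "\<dots> \<le> (h / r) powr a" using False assms by (intro powr_mono) auto
  finally show ?thesis .
qed

text \<open>Replacing \<open>r\<^sup>2\<close> by \<open>r\<^sup>2 + h\<^sup>2\<close> in a kernel of size \<open>r\<^sup>1\<^sup>+\<^sup>\<alpha> \<bar>\<phi>' (r\<^sup>2)\<bar>\<close> costs at most a multiple of
  \<open>r\<^sup>\<alpha>\<^sup>-\<^sup>1 h\<^sup>2 / (r\<^sup>2 + h\<^sup>2)\<close>, and trading half of the surplus exponent \<open>\<alpha>\<close> turns this into the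
  integrable function \<open>r\<^sup>\<alpha>\<^sup>/\<^sup>2\<^sup>-\<^sup>1\<close> times \<open>h\<^sup>\<alpha>\<^sup>/\<^sup>2\<close>. The constant is chosen before the kernel, so that
  the convergence will be uniform with respect to the base point.\<close>

lemma singular_kernel_regularization:
  assumes "0 < \<alpha>" "\<alpha> < 1" "0 \<le> C"
  shows "\<exists>A\<ge>0. \<forall>(N :: real \<Rightarrow> real) r w L.
    continuous_on {0..L} N \<longrightarrow> continuous_on {0..L} r \<longrightarrow> w integrable_on {0..L} \<longrightarrow>
    (\<forall>t\<in>{0..L}. 0 \<le> r t \<and> r t \<le> D \<and> \<bar>N t\<bar> \<le> C * r t powr (1 + \<alpha>) \<and>
      r t powr (- (1 - \<alpha> / 2)) \<le> w t) \<longrightarrow>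
    (\<lambda>t. N t * \<phi>1 ((r t)\<^sup>2)) integrable_on {0..L} \<and>
    (\<forall>h. 0 < h \<longrightarrow> h \<le> 1 \<longrightarrow>
      \<bar>integral {0..L} (\<lambda>t. N t * \<phi>1 ((r t)\<^sup>2 + h\<^sup>2)) - integral {0..L} (\<lambda>t. N t * \<phi>1 ((r t)\<^sup>2))\<bar>
        \<le> A * h powr (\<alpha> / 2) * integral {0..L} w)"
proof -
  obtain B where B: "B > 0" "\<And>u. 0 < u \<Longrightarrow> u \<le> D\<^sup>2 + 1 \<Longrightarrow> \<bar>\<phi>1 u\<bar> \<le> B / u"
      "\<And>u v. 0 < u \<Longrightarrow> u \<le> v \<Longrightarrow> v \<le> D\<^sup>2 + 1 \<Longrightarrow> \<bar>\<phi>1 v - \<phi>1 u\<bar> \<le> B * (1 / u - 1 / v)"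
    using difference_bounds[of "D\<^sup>2 + 1"] by (meson order_refl)
  have main: "(\<lambda>t. N t * \<phi>1 ((r t)\<^sup>2)) integrable_on {0..L} \<and>
    (\<forall>h. 0 < h \<longrightarrow> h \<le> 1 \<longrightarrow>
      \<bar>integral {0..L} (\<lambda>t. N t * \<phi>1 ((r t)\<^sup>2 + h\<^sup>2)) - integral {0..L} (\<lambda>t. N t * \<phi>1 ((r t)\<^sup>2))\<bar>
        \<le> C * B * h powr (\<alpha> / 2) * integral {0..L} w)"
    if N: "continuous_on {0..L} N" and r: "continuous_on {0..L} r" and w: "w integrable_on {0..L}"
      and bd: "\<forall>t\<in>{0..L}. 0 \<le> r t \<and> r t \<le> D \<and> \<bar>N t\<bar> \<le> C * r t powr (1 + \<alpha>) \<and>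
        r t powr (- (1 - \<alpha> / 2)) \<le> w t"
    for N r w :: "real \<Rightarrow> real" and L :: real
  proof (intro conjI allI impI)
    have cont: "continuous_on {0..L} (\<lambda>t. N t * \<phi>1 ((r t)\<^sup>2 + h\<^sup>2))" if "0 < h" for h
      using that by (intro continuous_intros N r) (auto intro: add_nonneg_pos)
    have N0: "N t = 0" if "t \<in> {0..L}" "r t = 0" for t
    proof -
      have "\<bar>N t\<bar> \<le> C * r t powr (1 + \<alpha>)" using bd that(1) by blast
      then show ?thesis using that(2) by simp
    qed
    have diff: "\<bar>N t * \<phi>1 ((r t)\<^sup>2 + h\<^sup>2) - N t * \<phi>1 ((r t)\<^sup>2)\<bar> \<le> C * B * h powr (\<alpha> / 2) * w t"
      if h: "0 < h" "h \<le> 1" and t: "t \<in> {0..L}" for h t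
    proof (cases "r t = 0")
      case True
      have "0 \<le> w t" using bd t powr_ge_zero order_trans by blast
      moreover have "N t = 0" using N0 t True by blast
      ultimately show ?thesis using assms B(1) by simp
    next
      case False
      define x where "x = r t"
      have "0 \<le> r t" "r t \<le> D" using bd t by blast+
      then have x: "0 < x" "x \<le> D" using False by (auto simp: x_def)
      have "x\<^sup>2 \<le> D\<^sup>2" "h\<^sup>2 \<le> 1" using x h by (auto intro: power_mono simp: power_le_one)
      then have "\<bar>\<phi>1 (x\<^sup>2 + h\<^sup>2) - \<phi>1 (x\<^sup>2)\<bar> \<le> B * (1 / x\<^sup>2 - 1 / (x\<^sup>2 + h\<^sup>2))"
        using x h by (intro B(3)) (auto simp del: power_mono_iff intro: add_mono)
      also have "1 / x\<^sup>2 - 1 / (x\<^sup>2 + h\<^sup>2) = h\<^sup>2 / (x\<^sup>2 + h\<^sup>2) / x\<^sup>2"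
      proof -
        have "x\<^sup>2 + h\<^sup>2 > 0" using x by (simp add: add_pos_nonneg)
        then show ?thesis using x by (simp add: divide_simps)
      qed
      also have "B * (h\<^sup>2 / (x\<^sup>2 + h\<^sup>2) / x\<^sup>2) \<le> B * ((h / x) powr (\<alpha> / 2) / x\<^sup>2)"
        using ratio_le_powr[of h x "\<alpha> / 2"] x h assms B(1)
        by (intro mult_left_mono divide_right_mono) auto
      finally have "\<bar>N t\<bar> * \<bar>\<phi>1 (x\<^sup>2 + h\<^sup>2) - \<phi>1 (x\<^sup>2)\<bar>
          \<le> (C * x powr (1 + \<alpha>)) * (B * ((h / x) powr (\<alpha> / 2) / x\<^sup>2))"
        using bd t assms by (intro mult_mono) (auto simp: x_def)
      also have "\<dots> = C * B * h powr (\<alpha> / 2) * x powr (- (1 - \<alpha> / 2))"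
      proof -
        have "x powr (1 + \<alpha>) * ((h / x) powr (\<alpha> / 2) / x\<^sup>2)
            = h powr (\<alpha> / 2) * (x powr (1 + \<alpha>) / x powr (\<alpha> / 2) / x powr 2)"
          using x h by (simp add: powr_divide)
        also have "x powr (1 + \<alpha>) / x powr (\<alpha> / 2) / x powr 2 = x powr (1 + \<alpha> - \<alpha> / 2 - 2)"
          by (simp only: powr_diff)
        also have "1 + \<alpha> - \<alpha> / 2 - 2 = - (1 - \<alpha> / 2)" by simp
        finally have e: "x powr (1 + \<alpha>) * ((h / x) powr (\<alpha> / 2) / x\<^sup>2)
            = h powr (\<alpha> / 2) * x powr (- (1 - \<alpha> / 2))" .
        have "(C * x powr (1 + \<alpha>)) * (B * ((h / x) powr (\<alpha> / 2) / x\<^sup>2))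
            = C * B * (x powr (1 + \<alpha>) * ((h / x) powr (\<alpha> / 2) / x\<^sup>2))"
          by (simp only: mult_ac)
        then show ?thesis unfolding e by (simp only: mult.assoc)
      qed
      also have "\<dots> \<le> C * B * h powr (\<alpha> / 2) * w t"
        using bd t assms B(1) by (intro mult_left_mono) (auto simp: x_def)
      finally show ?thesis by (simp add: x_def abs_mult flip: right_diff_distrib)
    qed
    define h where "h n = 1 / real (Suc n)" for n
    have h: "0 < h n" "h n \<le> 1" for n by (auto simp: h_def)
    have h0: "h \<longlonglongrightarrow> 0" unfolding h_def by (rule LIMSEQ_Suc[OF lim_1_over_n])
    have "(\<lambda>t. N t * \<phi>1 ((r t)\<^sup>2) - N t * \<phi>1 ((r t)\<^sup>2 + (h 0)\<^sup>2)) integrable_on {0..L}"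
    proof (rule dominated_convergence(1))
      show "(\<lambda>t. N t * \<phi>1 ((r t)\<^sup>2 + (h n)\<^sup>2) - N t * \<phi>1 ((r t)\<^sup>2 + (h 0)\<^sup>2)) integrable_on {0..L}" for n
        using cont[OF h(1)] by (intro integrable_diff integrable_continuous_interval)
      show "(\<lambda>t. 2 * (C * B) * w t) integrable_on {0..L}"
        by (intro integrable_on_mult_right w)
      show "norm (N t * \<phi>1 ((r t)\<^sup>2 + (h n)\<^sup>2) - N t * \<phi>1 ((r t)\<^sup>2 + (h 0)\<^sup>2)) \<le> 2 * (C * B) * w t"
        if t: "t \<in> {0..L}" for n t
      proof -
        have "0 \<le> w t" using bd t powr_ge_zero order_trans by blast
        then have "C * B * h m powr (\<alpha> / 2) * w t \<le> C * B * 1 * w t" for m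
          using assms B(1) h[of m] by (intro mult_right_mono mult_left_mono) (auto simp: powr_le1)
        from this[of n] this[of 0] show ?thesis
          using diff[OF h t, of n] diff[OF h t, of 0] by simp
      qed
      show "(\<lambda>n. N t * \<phi>1 ((r t)\<^sup>2 + (h n)\<^sup>2) - N t * \<phi>1 ((r t)\<^sup>2 + (h 0)\<^sup>2))
          \<longlonglongrightarrow> N t * \<phi>1 ((r t)\<^sup>2) - N t * \<phi>1 ((r t)\<^sup>2 + (h 0)\<^sup>2)" if t: "t \<in> {0..L}" for t
      proof (cases "r t = 0")
        case True
        then have "N t = 0" using N0 t by blast
        then show ?thesis by simp
      next
        case False
        have "(\<lambda>n. (r t)\<^sup>2 + (h n)\<^sup>2) \<longlonglongrightarrow> (r t)\<^sup>2 + 0\<^sup>2" by (intro tendsto_intros h0)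
        then show ?thesis using False by (intro tendsto_intros tendsto_phi) auto
      qed
    qed
    from integrable_add[OF this integrable_continuous_interval[OF cont[OF h(1)[of 0]]]]
    show int: "(\<lambda>t. N t * \<phi>1 ((r t)\<^sup>2)) integrable_on {0..L}" by simp
    fix h :: real assume h: "0 < h" "h \<le> 1"
    have int_h: "(\<lambda>t. N t * \<phi>1 ((r t)\<^sup>2 + h\<^sup>2)) integrable_on {0..L}"
      using cont[OF h(1)] by (rule integrable_continuous_interval)
    have "norm (integral {0..L} (\<lambda>t. N t * \<phi>1 ((r t)\<^sup>2 + h\<^sup>2) - N t * \<phi>1 ((r t)\<^sup>2)))
        \<le> integral {0..L} (\<lambda>t. C * B * h powr (\<alpha> / 2) * w t)"
      using diff[OF h] by (intro integral_norm_bound_integral integrable_diff int int_h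
          integrable_on_mult_right w) auto
    then show "\<bar>integral {0..L} (\<lambda>t. N t * \<phi>1 ((r t)\<^sup>2 + h\<^sup>2)) - integral {0..L} (\<lambda>t. N t * \<phi>1 ((r t)\<^sup>2))\<bar>
        \<le> C * B * h powr (\<alpha> / 2) * integral {0..L} w"
      by (simp add: integral_diff int int_h)
  qed
  show ?thesis
  proof (intro exI[of _ "C * B"] conjI)
    show "0 \<le> C * B" using assms(3) B(1) by simp
  qed (use main in blast)
qed

text \<open>The kernel \<open>\<phi>\<close> itself is only logarithmic, so dominated convergence suffices for any
  approximation \<open>\<rho> n t\<close> of the squared distance that stays above half of it.\<close>

lemma log_kernel_convergence:
  fixes \<psi> :: "real \<Rightarrow> 'b::euclidean_space"
  assumes \<psi>: "continuous_on {0..L} \<psi>" and w: "w integrable_on {0..L}"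
    and hits: "finite {t \<in> {0..L}. r t = 0}"
    and r: "\<And>t. t \<in> {0..L} \<Longrightarrow> 0 \<le> r t \<and> r t powr (- (1/2)) \<le> w t"
    and \<rho>: "\<And>n. continuous_on {0..L} (\<rho> n)"
      "\<And>n t. t \<in> {0..L} \<Longrightarrow> 0 < \<rho> n t \<and> (r t)\<^sup>2 / 2 \<le> \<rho> n t \<and> \<rho> n t \<le> U"
      "\<And>t. t \<in> {0..L} \<Longrightarrow> (\<lambda>n. \<rho> n t) \<longlonglongrightarrow> (r t)\<^sup>2"
  shows "(\<lambda>t. \<phi> ((r t)\<^sup>2) *\<^sub>R \<psi> t) integrable_on {0..L}"
    and "(\<lambda>n. integral {0..L} (\<lambda>t. \<phi> (\<rho> n t) *\<^sub>R \<psi> t))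
      \<longlonglongrightarrow> integral {0..L} (\<lambda>t. \<phi> ((r t)\<^sup>2) *\<^sub>R \<psi> t)"
proof -
  obtain B where B: "B > 0" "\<And>u. 0 < u \<Longrightarrow> u \<le> U \<Longrightarrow> \<bar>\<phi> u\<bar> \<le> B * u powr (-1/4)"
    using bounds by metis
  have "bounded (\<psi> ` {0..L})" using \<psi> compact_continuous_image compact_imp_bounded by blast
  then obtain P where P: "P > 0" "\<And>t. t \<in> {0..L} \<Longrightarrow> norm (\<psi> t) \<le> P"
    unfolding bounded_pos by auto
  \<comment> \<open>The values of the kernel at the finitely many zeros of \<open>r\<close> are meaningless and are cut out.\<close>
  define S where "S = {0..L} - {t \<in> {0..L}. r t = 0}"
  have neg: "negligible A" if "A \<subseteq> {t \<in> {0..L}. r t = 0}" for A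
    using hits that by (meson finite_subset negligible_finite)
  have spike: "negligible {t \<in> S - {0..L}. f t \<noteq> 0}" "negligible {t \<in> {0..L} - S. f t \<noteq> 0}"
    for f :: "real \<Rightarrow> 'b"
    by (auto simp: S_def intro!: neg)
  have conv_int: "f integrable_on S \<longleftrightarrow> f integrable_on {0..L}" "integral S f = integral {0..L} f"
    for f :: "real \<Rightarrow> 'b"
    using has_integral_spike_set_eq[OF spike, of f] by (simp_all only: integrable_on_def integral_def)
  have p1: "(\<lambda>t. \<phi> (\<rho> n t) *\<^sub>R \<psi> t) integrable_on S" for n
  proof -
    have "continuous_on {0..L} (\<lambda>t. \<phi> (\<rho> n t) *\<^sub>R \<psi> t)"
      using \<rho> by (intro continuous_intros \<psi>) auto
    then show "(\<lambda>t. \<phi> (\<rho> n t) *\<^sub>R \<psi> t) integrable_on S"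
      unfolding conv_int(1) by (rule integrable_continuous_interval)
  qed
  have p2: "(\<lambda>t. 2 * B * P * w t) integrable_on S"
      by (rule integrable_spike_set[OF integrable_on_mult_right[OF w]])
        (auto simp: S_def intro!: neg)
  have p3: "norm (\<phi> (\<rho> n t) *\<^sub>R \<psi> t) \<le> 2 * B * P * w t" if "t \<in> S" for n t
  proof -
    from that have t: "t \<in> {0..L}" "r t \<noteq> 0" by (auto simp: S_def)
    then have "0 < r t" using r[of t] by simp
    note t = t(1) this
    have "\<bar>\<phi> (\<rho> n t)\<bar> \<le> B * \<rho> n t powr (-1/4)" using B(2) \<rho>(2)[OF t(1)] by blast
    also have "\<dots> \<le> B * ((r t)\<^sup>2 / 2) powr (-1/4)"
      using \<rho>(2)[OF t(1)] t(2) B(1) by (intro mult_left_mono powr_mono2') auto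
    also have "((r t)\<^sup>2 / 2) powr (-1/4) = r t powr (- (1/2)) * 2 powr (1/4)"
    proof -
      have "(r t)\<^sup>2 = r t powr 2" using t(2) by simp
      then have "((r t)\<^sup>2 / 2) powr (-1/4) = (r t powr 2) powr (-1/4) / 2 powr (-1/4)"
        using t(2) by (simp add: powr_divide)
      also have "(r t powr 2) powr (-1/4) = r t powr (- (1/2))" by (simp add: powr_powr)
      also have "(2::real) powr (-1/4) = 1 / 2 powr (1/4)"
        using powr_minus_divide[of "2::real" "1/4"] by simp
      finally show ?thesis by (simp only: divide_divide_eq_right div_by_1 mult.commute)
    qed
    also have "\<dots> \<le> w t * 2"
    proof (rule mult_mono)
      show "(2::real) powr (1/4) \<le> 2" using powr_mono[of "1/4" 1 "2::real"] by simp
      show "0 \<le> w t" using r[OF t(1)] powr_ge_zero order_trans by blast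
    qed (use r[OF t(1)] in auto)
    finally have "\<bar>\<phi> (\<rho> n t)\<bar> \<le> B * (w t * 2)" using B(1) by simp
    then have "\<bar>\<phi> (\<rho> n t)\<bar> * norm (\<psi> t) \<le> B * (w t * 2) * P"
      using P(2)[OF t(1)] by (intro mult_mono) auto
    then show "norm (\<phi> (\<rho> n t) *\<^sub>R \<psi> t) \<le> 2 * B * P * w t" by (simp add: algebra_simps)
  qed
  have p4: "(\<lambda>n. \<phi> (\<rho> n t) *\<^sub>R \<psi> t) \<longlonglongrightarrow> \<phi> ((r t)\<^sup>2) *\<^sub>R \<psi> t" if "t \<in> S" for t
  proof -
    from that have t: "t \<in> {0..L}" "0 < (r t)\<^sup>2" using r by (auto simp: S_def)
    show ?thesis
      using t \<rho>(3) by (intro tendsto_intros tendsto_phi) auto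
  qed
  show "(\<lambda>t. \<phi> ((r t)\<^sup>2) *\<^sub>R \<psi> t) integrable_on {0..L}"
    "(\<lambda>n. integral {0..L} (\<lambda>t. \<phi> (\<rho> n t) *\<^sub>R \<psi> t))
      \<longlonglongrightarrow> integral {0..L} (\<lambda>t. \<phi> ((r t)\<^sup>2) *\<^sub>R \<psi> t)"
    using dominated_convergence[OF p1 p2 p3 p4] by (simp_all only: conv_int)
qed

end

section \<open>Layer potentials with a logarithmic kernel\<close>

locale boundary_kernel = C3_boundary \<C> \<nu> + log_kernel \<phi> \<phi>1 \<phi>2
  for \<C> \<nu> \<phi> \<phi>1 \<phi>2
begin

lemma continuous_on_Hoelder:
  fixes g :: "real^2 \<Rightarrow> real"
  assumes "(L, z) \<in> \<C>" "0 < \<alpha>"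
    and g: "\<forall>x\<in>range z. \<forall>y\<in>range z. \<bar>g x - g y\<bar> \<le> M * dist x y powr \<alpha>"
  shows "continuous_on S (\<lambda>t. g (z t))"
proof -
  have "isCont (\<lambda>t. g (z t)) t" for t
  proof -
    have "((\<lambda>s. M * dist (z s) (z t) powr \<alpha>) \<longlongrightarrow> M * 0 powr \<alpha>) (at t)"
    proof (intro tendsto_intros tendsto_powr2)
      have "isCont z t" using z_cont[OF assms(1), of UNIV] by (simp add: continuous_on_eq_continuous_at)
      then show "((\<lambda>s. dist (z s) (z t)) \<longlongrightarrow> 0) (at t)"
        unfolding isCont_def by (subst (asm) tendsto_dist_iff)
    qed (use assms in auto)
    then have "((\<lambda>s. M * dist (z s) (z t) powr \<alpha>) \<longlongrightarrow> 0) (at t)" by simp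
    then have "((\<lambda>s. g (z s) - g (z t)) \<longlongrightarrow> 0) (at t)"
    proof (rule Lim_null_comparison[rotated])
      have "norm (g (z s) - g (z t)) \<le> M * dist (z s) (z t) powr \<alpha>" for s
        using g by (simp only: real_norm_def) blast
      then show "\<forall>\<^sub>F s in at t. norm (g (z s) - g (z t)) \<le> M * dist (z s) (z t) powr \<alpha>"
        by (rule always_eventually[OF allI])
    qed
    then show ?thesis unfolding isCont_def by (rule LIM_zero_cancel)
  qed
  then show ?thesis by (intro continuous_at_imp_continuous_on) auto
qed

lemma has_derivative_dist_sq:
  assumes "(L, z) \<in> \<C>"
  shows "((\<lambda>s. (dist (z s) y)\<^sup>2 + e) has_real_derivative 2 * (\<tau> (z s) \<bullet> (z s - y))) (at s)"
proof -
  have "((\<lambda>s. (z s - y) \<bullet> (z s - y) + e) has_derivative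
      (\<lambda>h. (z s - y) \<bullet> (h *\<^sub>R \<tau> (z s)) + (h *\<^sub>R \<tau> (z s)) \<bullet> (z s - y))) (at s)"
    using z_deriv[OF assms, of s] unfolding has_vector_derivative_def
    by (auto intro!: derivative_eq_intros)
  then show ?thesis
    unfolding has_field_derivative_def dist_norm power2_norm_eq_inner
    by (rule has_derivative_eq_rhs) (auto simp: inner_commute)
qed

lemma add_sq_pos: "0 < h \<Longrightarrow> 0 < (x::real)\<^sup>2 + h\<^sup>2"
  by (simp add: add_nonneg_pos)

context
  fixes L0 L :: real and z0 z :: "real \<Rightarrow> real^2"
  assumes Lz0: "(L0, z0) \<in> \<C>" and Lz: "(L, z) \<in> \<C>"
begin

lemma regularized_potential_deriv:
  assumes g: "continuous_on {0..L} (\<lambda>t. g (z t))" and h: "0 < h"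
  shows "((\<lambda>s. integral {0..L} (\<lambda>t. g (z t) * \<phi> ((dist (z0 s) (z t))\<^sup>2 + h\<^sup>2))) has_real_derivative
    integral {0..L} (\<lambda>t. g (z t) * (2 * (\<tau> (z0 s) \<bullet> (z0 s - z t)) *
      \<phi>1 ((dist (z0 s) (z t))\<^sup>2 + h\<^sup>2)))) (at s)"
proof -
  note gc = continuous_on_compose2[OF g]
  have "((\<lambda>s. integral (cbox 0 L) (\<lambda>t. g (z t) * \<phi> ((dist (z0 s) (z t))\<^sup>2 + h\<^sup>2))) has_real_derivative
    integral (cbox 0 L) (\<lambda>t. g (z t) * (2 * (\<tau> (z0 s) \<bullet> (z0 s - z t)) *
      \<phi>1 ((dist (z0 s) (z t))\<^sup>2 + h\<^sup>2)))) (at s within UNIV)"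
  proof (rule leibniz_rule_field_derivative)
    fix s t
    have "((\<lambda>s. \<phi> ((dist (z0 s) (z t))\<^sup>2 + h\<^sup>2)) has_real_derivative
        \<phi>1 ((dist (z0 s) (z t))\<^sup>2 + h\<^sup>2) * (2 * (\<tau> (z0 s) \<bullet> (z0 s - z t)))) (at s)"
      by (rule DERIV_chain2[OF deriv1 has_derivative_dist_sq[OF Lz0]]) (use h add_sq_pos in auto)
    from DERIV_cmult[OF this, of "g (z t)"]
    show "((\<lambda>s. g (z t) * \<phi> ((dist (z0 s) (z t))\<^sup>2 + h\<^sup>2)) has_real_derivative
      g (z t) * (2 * (\<tau> (z0 s) \<bullet> (z0 s - z t)) * \<phi>1 ((dist (z0 s) (z t))\<^sup>2 + h\<^sup>2)))
      (at s within UNIV)" by (simp add: mult_ac)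
  next
    fix s
    show "(\<lambda>t. g (z t) * \<phi> ((dist (z0 s) (z t))\<^sup>2 + h\<^sup>2)) integrable_on cbox 0 L"
      unfolding box_real using h add_sq_pos
      by (intro integrable_continuous_interval continuous_intros g z_cont[OF Lz]) auto
  next
    show "continuous_on (UNIV \<times> cbox 0 L) (\<lambda>(s, t). g (z t) * (2 * (\<tau> (z0 s) \<bullet> (z0 s - z t)) *
      \<phi>1 ((dist (z0 s) (z t))\<^sup>2 + h\<^sup>2)))"
      unfolding split_beta using h add_sq_pos
      by (intro continuous_intros gc continuous_on_compose2[OF tangent_cont[OF Lz0, of UNIV]]
          continuous_on_compose2[OF z_cont[OF Lz0, of UNIV]]
          continuous_on_compose2[OF z_cont[OF Lz, of UNIV]]) auto
  qed auto
  then show ?thesis by simp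
qed

end

text \<open>The integrand is the derivative of \<open>- \<phi> (r\<^sup>2 + h\<^sup>2)\<close> along the closed curve.\<close>

lemma periodic_cancellation:
  assumes Lz: "(L, z) \<in> \<C>" and h: "0 < h"
  shows "((\<lambda>t. 2 * (\<tau> (z t) \<bullet> (z s - z t)) * \<phi>1 ((dist (z s) (z t))\<^sup>2 + h\<^sup>2)) has_integral 0) {0..L}"
proof -
  have "((\<lambda>t. - \<phi> ((dist (z t) (z s))\<^sup>2 + h\<^sup>2)) has_real_derivative
      2 * (\<tau> (z t) \<bullet> (z s - z t)) * \<phi>1 ((dist (z s) (z t))\<^sup>2 + h\<^sup>2)) (at t)" for t
  proof -
    have "((\<lambda>t. \<phi> ((dist (z t) (z s))\<^sup>2 + h\<^sup>2)) has_real_derivative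
        \<phi>1 ((dist (z t) (z s))\<^sup>2 + h\<^sup>2) * (2 * (\<tau> (z t) \<bullet> (z t - z s)))) (at t)"
      by (rule DERIV_chain2[OF deriv1 has_derivative_dist_sq[OF Lz]]) (use h add_sq_pos in auto)
    from DERIV_minus[OF this] show ?thesis by (simp add: dist_commute inner_diff_right algebra_simps)
  qed
  then have "((\<lambda>t. 2 * (\<tau> (z t) \<bullet> (z s - z t)) * \<phi>1 ((dist (z s) (z t))\<^sup>2 + h\<^sup>2)) has_integral
      (- \<phi> ((dist (z L) (z s))\<^sup>2 + h\<^sup>2) - - \<phi> ((dist (z 0) (z s))\<^sup>2 + h\<^sup>2))) {0..L}"
    using L_pos[OF Lz]
    by (intro fundamental_theorem_of_calculus)
      (auto simp: has_real_derivative_iff_has_vector_derivative intro: has_vector_derivative_at_within)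
  then show ?thesis using z_period[OF Lz, of 0] by simp
qed

text \<open>The tangential derivative of a single layer is a Cauchy-type singular integral. On the curve
  that carries the density, subtracting the exact derivative along the integration variable,
  whose integral over the closed curve vanishes, gains the factor \<open>r\<^sup>\<alpha>\<close>: the difference is a
  term with the density difference \<open>g y - g x\<close> plus a term with the tangent difference
  \<open>\<tau> x - \<tau> y\<close>. On any other curve \<open>r\<close> is bounded below and the factor costs nothing.\<close>

lemma subtracted_kernel:
  assumes Lz0: "(L0, z0) \<in> \<C>" and Lz: "(L, z) \<in> \<C>" and \<alpha>: "0 < \<alpha>" "\<alpha> < 1"
    and g: "\<forall>x\<in>range z. \<forall>y\<in>range z. \<bar>g x - g y\<bar> \<le> M * dist x y powr \<alpha>"
  shows "\<exists>N C. 0 \<le> C \<and> (\<forall>s. continuous_on {0..L} (N s)) \<and>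
    (\<forall>s. \<forall>t\<in>{0..L}. \<bar>N s t\<bar> \<le> C * dist (z0 s) (z t) powr (1 + \<alpha>)) \<and>
    (\<forall>s h. 0 < h \<longrightarrow>
      integral {0..L} (\<lambda>t. g (z t) * (2 * (\<tau> (z0 s) \<bullet> (z0 s - z t)) * \<phi>1 ((dist (z0 s) (z t))\<^sup>2 + h\<^sup>2)))
      = integral {0..L} (\<lambda>t. N s t * \<phi>1 ((dist (z0 s) (z t))\<^sup>2 + h\<^sup>2)))"
proof -
  have gc: "continuous_on S (\<lambda>t. g (z t))" for S
    by (rule continuous_on_Hoelder[OF Lz \<alpha>(1) g])
  have "bounded ((\<lambda>t. g (z t)) ` {0..L})"
    using gc compact_continuous_image compact_imp_bounded by blast
  then obtain P where P: "P > 0" "\<And>t. t \<in> {0..L} \<Longrightarrow> \<bar>g (z t)\<bar> \<le> P"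
    unfolding bounded_pos by auto
  have P': "\<bar>g (z s)\<bar> \<le> P" for s
    using P(2) range_z[OF Lz] by (metis imageE rangeI)
  show ?thesis
  proof (cases "(L0, z0) = (L, z)")
    case False
    then obtain d where d: "d > 0" "\<And>s t. d \<le> dist (z0 s) (z t)"
      using separated[OF Lz0 Lz] by blast
    define N where "N s t = g (z t) * (2 * (\<tau> (z0 s) \<bullet> (z0 s - z t)))" for s t
    have n1: "\<bar>N s t\<bar> \<le> 2 * P / d powr \<alpha> * dist (z0 s) (z t) powr (1 + \<alpha>)" for s t
    proof -
      define r where "r = dist (z0 s) (z t)"
      have r: "d \<le> r" "0 < r" using d(1) d(2)[of s t] by (auto simp: r_def)
      have "\<bar>\<tau> (z0 s) \<bullet> (z0 s - z t)\<bar> \<le> r"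
        using Cauchy_Schwarz_ineq2[of "\<tau> (z0 s)" "z0 s - z t"]
        by (simp add: norm_tangent[OF Lz0] dist_norm r_def)
      then have "\<bar>N s t\<bar> \<le> P * (2 * r)"
        unfolding N_def abs_mult using P'[of t] P(1) by (intro mult_mono) auto
      also have "\<dots> = 2 * P / d powr \<alpha> * (r * d powr \<alpha>)" using d(1) by simp
      also have "\<dots> \<le> 2 * P / d powr \<alpha> * (r * r powr \<alpha>)"
        using r d(1) \<alpha> P(1) by (intro mult_left_mono powr_mono2) auto
      also have "r * r powr \<alpha> = r powr (1 + \<alpha>)" using r by (simp add: powr_add)
      finally show ?thesis by (simp add: r_def)
    qed
    have n2: "continuous_on {0..L} (N s)" for s
      unfolding N_def[abs_def] by (intro continuous_intros gc z_cont[OF Lz])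
    have n3: "integral {0..L} (\<lambda>t. g (z t) * (2 * (\<tau> (z0 s) \<bullet> (z0 s - z t)) * \<phi>1 (f t)))
        = integral {0..L} (\<lambda>t. N s t * \<phi>1 (f t))" for s f
      by (simp add: N_def mult_ac)
    have n4: "0 \<le> 2 * P / d powr \<alpha>" using P(1) by simp
    show ?thesis
      by (intro exI[of _ N] exI[of _ "2 * P / d powr \<alpha>"] conjI allI ballI impI n1 n2 n3 n4)
  next
    case True
    then have eq: "L0 = L" "z0 = z" by auto
    obtain K where K: "K > 0" "\<And>s t. norm (\<tau> (z s) - \<tau> (z t)) \<le> K * dist (z s) (z t)"
      using tangent_chord[OF Lz] by blast
    obtain D where D: "D > 0" "\<And>s t. dist (z s) (z t) \<le> D" using dist_bounded[OF Lz Lz] by blast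
    define N where "N s t = g (z t) * (2 * (\<tau> (z s) \<bullet> (z s - z t)))
        - g (z s) * (2 * (\<tau> (z t) \<bullet> (z s - z t)))" for s t
    have n1: "\<bar>N s t\<bar> \<le> (2 * \<bar>M\<bar> + 2 * P * K * D powr (1 - \<alpha>)) * dist (z s) (z t) powr (1 + \<alpha>)" for s t
    proof -
      define r where "r = dist (z s) (z t)"
      have r: "0 \<le> r" "r \<le> D" using D by (auto simp: r_def)
      have 1: "\<bar>\<tau> (z s) \<bullet> (z s - z t)\<bar> \<le> r"
        using Cauchy_Schwarz_ineq2[of "\<tau> (z s)" "z s - z t"]
        by (simp add: norm_tangent[OF Lz] dist_norm r_def)
      have 2: "\<bar>(\<tau> (z s) - \<tau> (z t)) \<bullet> (z s - z t)\<bar> \<le> K * r * r"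
        using Cauchy_Schwarz_ineq2[of "\<tau> (z s) - \<tau> (z t)" "z s - z t"]
          mult_right_mono[OF K(2)[of s t], of "norm (z s - z t)"]
        by (simp add: dist_norm r_def)
      have "\<bar>g (z t) - g (z s)\<bar> \<le> M * dist (z t) (z s) powr \<alpha>" using g by blast
      also have "\<dots> \<le> \<bar>M\<bar> * dist (z t) (z s) powr \<alpha>" by (intro mult_right_mono) auto
      finally have 3: "\<bar>g (z t) - g (z s)\<bar> \<le> \<bar>M\<bar> * r powr \<alpha>"
        by (simp add: r_def dist_commute)
      define a where "a = (g (z t) - g (z s)) * (\<tau> (z s) \<bullet> (z s - z t))"
      define b where "b = g (z s) * ((\<tau> (z s) - \<tau> (z t)) \<bullet> (z s - z t))"
      have "N s t = 2 * a + 2 * b"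
        unfolding N_def a_def b_def inner_diff_left[of _ _ "z s - z t"] by algebra
      then have "\<bar>N s t\<bar> \<le> 2 * \<bar>a\<bar> + 2 * \<bar>b\<bar>" by simp
      also have "\<dots> = 2 * (\<bar>g (z t) - g (z s)\<bar> * \<bar>\<tau> (z s) \<bullet> (z s - z t)\<bar>)
          + 2 * (\<bar>g (z s)\<bar> * \<bar>(\<tau> (z s) - \<tau> (z t)) \<bullet> (z s - z t)\<bar>)"
        unfolding a_def b_def by (simp only: abs_mult)
      also have "\<dots> \<le> 2 * ((\<bar>M\<bar> * r powr \<alpha>) * r) + 2 * (P * (K * r * r))"
        using 1 2 3 P'[of s] P(1) K(1) r by (intro add_mono mult_mono mult_nonneg_nonneg) auto
      also have "\<dots> = (2 * \<bar>M\<bar> + 2 * P * K * D powr (1 - \<alpha>)) * r powr (1 + \<alpha>)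
          - 2 * P * K * (D powr (1 - \<alpha>) - r powr (1 - \<alpha>)) * r powr (1 + \<alpha>)"
      proof (cases "r = 0")
        case False
        have "r powr (1 - \<alpha>) * r powr (1 + \<alpha>) = r powr 2" by (simp flip: powr_add)
        then have e1: "r powr (1 - \<alpha>) * r powr (1 + \<alpha>) = r * r"
          using r False by (simp add: power2_eq_square)
        have e2: "r powr (1 + \<alpha>) = r powr \<alpha> * r" using r False by (simp add: powr_add)
        have "(2 * \<bar>M\<bar> + 2 * P * K * D powr (1 - \<alpha>)) * r powr (1 + \<alpha>)
            - 2 * P * K * (D powr (1 - \<alpha>) - r powr (1 - \<alpha>)) * r powr (1 + \<alpha>)
            = 2 * \<bar>M\<bar> * r powr (1 + \<alpha>) + 2 * P * K * (r powr (1 - \<alpha>) * r powr (1 + \<alpha>))"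
          by (simp add: algebra_simps)
        also have "\<dots> = 2 * (\<bar>M\<bar> * r powr \<alpha> * r) + 2 * (P * (K * r * r))"
          unfolding e1 unfolding e2 by simp
        finally show ?thesis by simp
      qed auto
      also have "\<dots> \<le> (2 * \<bar>M\<bar> + 2 * P * K * D powr (1 - \<alpha>)) * r powr (1 + \<alpha>)"
        using r P(1) K(1) \<alpha> powr_mono2[of "1 - \<alpha>" r D] by simp
      finally show ?thesis by (simp add: r_def)
    qed
    have n2: "continuous_on {0..L} (N s)" for s
      unfolding N_def[abs_def] by (intro continuous_intros gc z_cont[OF Lz] tangent_cont[OF Lz])
    have n3: "integral {0..L} (\<lambda>t. g (z t) * (2 * (\<tau> (z s) \<bullet> (z s - z t)) * \<phi>1 ((dist (z s) (z t))\<^sup>2 + h\<^sup>2)))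
        = integral {0..L} (\<lambda>t. N s t * \<phi>1 ((dist (z s) (z t))\<^sup>2 + h\<^sup>2))" if h: "0 < h" for s h
    proof -
      have i: "(\<lambda>t. g (z t) * (2 * (\<tau> (z s) \<bullet> (z s - z t)) * \<phi>1 ((dist (z s) (z t))\<^sup>2 + h\<^sup>2)))
          integrable_on {0..L}"
        using h add_sq_pos
        by (intro integrable_continuous_interval continuous_intros gc z_cont[OF Lz]) auto
      have "((\<lambda>t. g (z t) * (2 * (\<tau> (z s) \<bullet> (z s - z t)) * \<phi>1 ((dist (z s) (z t))\<^sup>2 + h\<^sup>2))
          - g (z s) * (2 * (\<tau> (z t) \<bullet> (z s - z t)) * \<phi>1 ((dist (z s) (z t))\<^sup>2 + h\<^sup>2)))
        has_integral (integral {0..L} (\<lambda>t. g (z t) * (2 * (\<tau> (z s) \<bullet> (z s - z t)) *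
          \<phi>1 ((dist (z s) (z t))\<^sup>2 + h\<^sup>2))) - g (z s) * 0)) {0..L}"
        by (intro has_integral_diff has_integral_mult_right integrable_integral i
            periodic_cancellation[OF Lz h])
      moreover have "(\<lambda>t. g (z t) * (2 * (\<tau> (z s) \<bullet> (z s - z t)) * \<phi>1 ((dist (z s) (z t))\<^sup>2 + h\<^sup>2))
          - g (z s) * (2 * (\<tau> (z t) \<bullet> (z s - z t)) * \<phi>1 ((dist (z s) (z t))\<^sup>2 + h\<^sup>2)))
          = (\<lambda>t. N s t * \<phi>1 ((dist (z s) (z t))\<^sup>2 + h\<^sup>2))"
        by (simp add: N_def fun_eq_iff algebra_simps)
      ultimately show ?thesis by (simp add: integral_unique)
    qed
    have n4: "0 \<le> 2 * \<bar>M\<bar> + 2 * P * K * D powr (1 - \<alpha>)" using P(1) K(1) by simp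
    show ?thesis unfolding eq
      by (intro exI[of _ N] exI[of _ "2 * \<bar>M\<bar> + 2 * P * K * D powr (1 - \<alpha>)"] conjI allI ballI impI n1 n2 n3 n4)
  qed
qed

text \<open>The potentials with \<open>r\<^sup>2\<close> replaced by \<open>r\<^sup>2 + h\<^sup>2\<close> are differentiable and converge to the single
  layer, and by \<open>subtracted_kernel\<close> and \<open>singular_kernel_regularization\<close> their derivatives converge
  uniformly along the curve. So the single layer is differentiable along the boundary, and its
  derivative is the limit of the regularised ones.\<close>

lemma single_layer_tangential_derivative:
  assumes Lz0: "(L0, z0) \<in> \<C>" and Lz: "(L, z) \<in> \<C>" and \<alpha>: "0 < \<alpha>" "\<alpha> < 1"
    and g: "\<forall>x\<in>range z. \<forall>y\<in>range z. \<bar>g x - g y\<bar> \<le> M * dist x y powr \<alpha>"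
  shows "\<exists>T. \<forall>s. ((\<lambda>s. integral {0..L} (\<lambda>t. g (z t) * \<phi> ((dist (z0 s) (z t))\<^sup>2)))
      has_real_derivative T s) (at s) \<and>
    ((\<lambda>h. integral {0..L} (\<lambda>t. g (z t) * (2 * (\<tau> (z0 s) \<bullet> (z0 s - z t)) *
      \<phi>1 ((dist (z0 s) (z t))\<^sup>2 + h\<^sup>2)))) \<longlongrightarrow> T s) (at_right 0)"
proof -
  define F where "F h s = integral {0..L} (\<lambda>t. g (z t) * \<phi> ((dist (z0 s) (z t))\<^sup>2 + h\<^sup>2))" for h s
  define T' where "T' h s = integral {0..L} (\<lambda>t. g (z t) * (2 * (\<tau> (z0 s) \<bullet> (z0 s - z t)) *
      \<phi>1 ((dist (z0 s) (z t))\<^sup>2 + h\<^sup>2)))" for h s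
  have gc: "continuous_on S (\<lambda>t. g (z t))" for S
    by (rule continuous_on_Hoelder[OF Lz \<alpha>(1) g])
  have "\<exists>N C. 0 \<le> C \<and> (\<forall>s. continuous_on {0..L} (N s)) \<and>
    (\<forall>s. \<forall>t\<in>{0..L}. \<bar>N s t\<bar> \<le> C * dist (z0 s) (z t) powr (1 + \<alpha>)) \<and>
    (\<forall>s h. 0 < h \<longrightarrow> T' h s = integral {0..L} (\<lambda>t. N s t * \<phi>1 ((dist (z0 s) (z t))\<^sup>2 + h\<^sup>2)))"
    unfolding T'_def by (rule subtracted_kernel[OF Lz0 Lz \<alpha> g])
  then obtain N C where NC: "0 \<le> C \<and> (\<forall>s. continuous_on {0..L} (N s)) \<and>
    (\<forall>s. \<forall>t\<in>{0..L}. \<bar>N s t\<bar> \<le> C * dist (z0 s) (z t) powr (1 + \<alpha>)) \<and>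
    (\<forall>s h. 0 < h \<longrightarrow> T' h s = integral {0..L} (\<lambda>t. N s t * \<phi>1 ((dist (z0 s) (z t))\<^sup>2 + h\<^sup>2)))"
    by (elim exE) (rule that)
  have N: "0 \<le> C" "\<And>s. continuous_on {0..L} (N s)"
    "\<And>s t. t \<in> {0..L} \<Longrightarrow> \<bar>N s t\<bar> \<le> C * dist (z0 s) (z t) powr (1 + \<alpha>)"
    "\<And>s h. 0 < h \<Longrightarrow> T' h s = integral {0..L} (\<lambda>t. N s t * \<phi>1 ((dist (z0 s) (z t))\<^sup>2 + h\<^sup>2))"
    using NC by auto
  define T where "T s = integral {0..L} (\<lambda>t. N s t * \<phi>1 ((dist (z0 s) (z t))\<^sup>2))" for s
  obtain D where D: "D > 0" "\<And>s t. dist (z0 s) (z t) \<le> D" using dist_bounded[OF Lz0 Lz] by blast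
  from singular_kernel_regularization[OF \<alpha> N(1), of D]
  obtain A where A: "A \<ge> 0" and reg: "\<forall>(N :: real \<Rightarrow> real) r w L.
    continuous_on {0..L} N \<longrightarrow> continuous_on {0..L} r \<longrightarrow> w integrable_on {0..L} \<longrightarrow>
    (\<forall>t\<in>{0..L}. 0 \<le> r t \<and> r t \<le> D \<and> \<bar>N t\<bar> \<le> C * r t powr (1 + \<alpha>) \<and>
      r t powr (- (1 - \<alpha> / 2)) \<le> w t) \<longrightarrow>
    (\<lambda>t. N t * \<phi>1 ((r t)\<^sup>2)) integrable_on {0..L} \<and>
    (\<forall>h. 0 < h \<longrightarrow> h \<le> 1 \<longrightarrow>
      \<bar>integral {0..L} (\<lambda>t. N t * \<phi>1 ((r t)\<^sup>2 + h\<^sup>2)) - integral {0..L} (\<lambda>t. N t * \<phi>1 ((r t)\<^sup>2))\<bar>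
        \<le> A * h powr (\<alpha> / 2) * integral {0..L} w)"
    by (elim exE conjE, intro that)
  have "0 < 1 - \<alpha> / 2" "1 - \<alpha> / 2 < 1" using \<alpha> by auto
  then obtain K where K: "\<And>s. \<exists>w. w integrable_on {0..L} \<and> integral {0..L} w \<le> K \<and>
      (\<forall>t\<in>{0..L}. dist (z0 s) (z t) powr (- (1 - \<alpha> / 2)) \<le> w t)"
    using majorant[OF Lz0 Lz, of "1 - \<alpha> / 2"] by blast
  have unif: "\<bar>T' h s - T s\<bar> \<le> A * \<bar>K\<bar> * h powr (\<alpha> / 2)" if h: "0 < h" "h \<le> 1" for h s
  proof -
    obtain w where w: "w integrable_on {0..L}" "integral {0..L} w \<le> K"
      "\<forall>t\<in>{0..L}. dist (z0 s) (z t) powr (- (1 - \<alpha> / 2)) \<le> w t"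
      using K by blast
    have "\<forall>t\<in>{0..L}. 0 \<le> dist (z0 s) (z t) \<and> dist (z0 s) (z t) \<le> D \<and>
        \<bar>N s t\<bar> \<le> C * dist (z0 s) (z t) powr (1 + \<alpha>) \<and>
        dist (z0 s) (z t) powr (- (1 - \<alpha> / 2)) \<le> w t"
      using N(3)[of _ s] w(3) D(2) by simp
    moreover have "continuous_on {0..L} (\<lambda>t. dist (z0 s) (z t))"
      by (intro continuous_intros z_cont[OF Lz])
    ultimately have "\<bar>T' h s - T s\<bar> \<le> A * h powr (\<alpha> / 2) * integral {0..L} w"
      unfolding N(4)[OF h(1)] T_def
      using reg[rule_format, OF N(2)[of s] _ w(1), of "\<lambda>t. dist (z0 s) (z t)", THEN conjunct2] h
      by blast
    also have "\<dots> \<le> A * h powr (\<alpha> / 2) * \<bar>K\<bar>"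
      using w(2) A by (intro mult_left_mono) auto
    finally show ?thesis by (simp add: mult_ac)
  qed
  have lim: "((\<lambda>h. T' h s) \<longlongrightarrow> T s) (at_right 0)" for s
  proof -
    have "((\<lambda>h. A * \<bar>K\<bar> * h powr (\<alpha> / 2)) \<longlongrightarrow> A * \<bar>K\<bar> * 0 powr (\<alpha> / 2)) (at_right 0)"
      using \<alpha> by (intro tendsto_intros tendsto_powr2)
        (auto simp: eventually_at_right_less intro: eventually_at_rightI[of 0 1] tendsto_ident_at)
    then have "((\<lambda>h. A * \<bar>K\<bar> * h powr (\<alpha> / 2)) \<longlongrightarrow> 0) (at_right 0)" using \<alpha> by simp
    then have "((\<lambda>h. T' h s - T s) \<longlongrightarrow> 0) (at_right 0)"
      by (rule Lim_null_comparison[rotated])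
        (use unif in \<open>auto intro!: eventually_at_rightI[of 0 1]\<close>)
    then show ?thesis by (rule LIM_zero_cancel)
  qed
  define h where "h n = 1 / real (Suc n)" for n
  have h: "0 < h n" "h n \<le> 1" for n by (auto simp: h_def)
  have h0: "h \<longlonglongrightarrow> 0" unfolding h_def by (rule LIMSEQ_Suc[OF lim_1_over_n])
  have half: "\<exists>w. w integrable_on {0..L} \<and> (\<forall>t\<in>{0..L}. dist (z0 s) (z t) powr (- (1/2)) \<le> w t)" for s
    using majorant[OF Lz0 Lz, of "1/2"] by auto
  have F0: "(\<lambda>n. F (h n) s) \<longlonglongrightarrow> integral {0..L} (\<lambda>t. g (z t) * \<phi> ((dist (z0 s) (z t))\<^sup>2))" for s
  proof -
    obtain w where w: "w integrable_on {0..L}"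
      "\<And>t. t \<in> {0..L} \<Longrightarrow> dist (z0 s) (z t) powr (- (1/2)) \<le> w t"
      using half[of s] by blast
    have "(\<lambda>n. integral {0..L} (\<lambda>t. \<phi> ((dist (z0 s) (z t))\<^sup>2 + (h n)\<^sup>2) *\<^sub>R g (z t)))
        \<longlonglongrightarrow> integral {0..L} (\<lambda>t. \<phi> ((dist (z0 s) (z t))\<^sup>2) *\<^sub>R g (z t))"
    proof (rule log_kernel_convergence(2)[OF gc w(1), where U = "D\<^sup>2 + 1"
          and r = "\<lambda>t. dist (z0 s) (z t)" and \<rho> = "\<lambda>n t. (dist (z0 s) (z t))\<^sup>2 + (h n)\<^sup>2"])
      show "finite {t \<in> {0..L}. dist (z0 s) (z t) = 0}"
        by (rule finite_subset[OF _ finite_hits[OF Lz, of "z0 s"]]) auto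
      show "continuous_on {0..L} (\<lambda>t. (dist (z0 s) (z t))\<^sup>2 + (h n)\<^sup>2)" for n
        by (intro continuous_intros z_cont[OF Lz])
      show "0 < (dist (z0 s) (z t))\<^sup>2 + (h n)\<^sup>2 \<and>
          (dist (z0 s) (z t))\<^sup>2 / 2 \<le> (dist (z0 s) (z t))\<^sup>2 + (h n)\<^sup>2 \<and>
          (dist (z0 s) (z t))\<^sup>2 + (h n)\<^sup>2 \<le> D\<^sup>2 + 1" for n t
      proof -
        have "(dist (z0 s) (z t))\<^sup>2 \<le> D\<^sup>2" using D(2) by (intro power_mono) auto
        moreover have "(h n)\<^sup>2 \<le> 1" "0 < (h n)\<^sup>2" using h[of n] by (auto simp: power_le_one)
        moreover have "0 \<le> (dist (z0 s) (z t))\<^sup>2" by simp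
        ultimately show ?thesis by linarith
      qed
      show "(\<lambda>n. (dist (z0 s) (z t))\<^sup>2 + (h n)\<^sup>2) \<longlonglongrightarrow> (dist (z0 s) (z t))\<^sup>2" for t
        using tendsto_add[OF tendsto_const tendsto_power[OF h0, of 2], of "(dist (z0 s) (z t))\<^sup>2"] by simp
    qed (use w(2) in auto)
    then show ?thesis by (simp add: F_def mult.commute)
  qed
  have "\<exists>G. \<forall>s\<in>UNIV. (\<lambda>n. F (h n) s) \<longlonglongrightarrow> G s \<and> (G has_derivative (\<lambda>x. T s * x)) (at s within UNIV)"
  proof (rule has_derivative_sequence)
    show "(F (h n) has_derivative (\<lambda>x. T' (h n) s * x)) (at s within UNIV)" for n s
      using regularized_potential_deriv[OF Lz0 Lz gc h(1)]
      by (simp add: F_def[abs_def] T'_def has_field_derivative_def)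
    fix e :: real assume e: "e > 0"
    have "(\<lambda>n. A * \<bar>K\<bar> * h n powr (\<alpha> / 2)) \<longlonglongrightarrow> A * \<bar>K\<bar> * 0 powr (\<alpha> / 2)"
      using \<alpha> h(1) by (intro tendsto_intros tendsto_powr2 h0) (auto simp: less_imp_le)
    then have "\<forall>\<^sub>F n in sequentially. A * \<bar>K\<bar> * h n powr (\<alpha> / 2) < e"
      using e \<alpha> by (intro order_tendstoD) auto
    then show "\<forall>\<^sub>F n in sequentially. \<forall>s\<in>UNIV. \<forall>x. norm (T' (h n) s * x - T s * x) \<le> e * norm x"
    proof (eventually_elim, safe)
      fix n s x assume "A * \<bar>K\<bar> * h n powr (\<alpha> / 2) < e"
      then have "\<bar>T' (h n) s - T s\<bar> \<le> e" using unif[OF h, of n s] by linarith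
      then show "norm (T' (h n) s * x - T s * x) \<le> e * norm x"
        by (simp add: abs_mult mult_right_mono flip: left_diff_distrib)
    qed
  qed (use F0[of 0] in auto)
  then obtain G where G: "\<And>s. (\<lambda>n. F (h n) s) \<longlonglongrightarrow> G s" "\<And>s. (G has_real_derivative T s) (at s)"
    by (auto simp: has_field_derivative_def)
  have "G = (\<lambda>s. integral {0..L} (\<lambda>t. g (z t) * \<phi> ((dist (z0 s) (z t))\<^sup>2)))"
    using LIMSEQ_unique[OF G(1) F0] by blast
  then have "((\<lambda>s. integral {0..L} (\<lambda>t. g (z t) * \<phi> ((dist (z0 s) (z t))\<^sup>2)))
      has_real_derivative T s) (at s)" for s
    using G(2)[of s] by (simp only:)
  then show ?thesis using lim[unfolded T'_def] by (intro exI[of _ T] allI conjI) simp_all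
qed

end

context boundary_kernel
begin

text \<open>On the inner normal the squared distance to a boundary point is \<open>r\<^sup>2 + h\<^sup>2\<close> up to a relative
  error of order \<open>h\<close>, since the chord leaves the tangent only quadratically.\<close>

lemma normal_distance:
  assumes Lz0: "(L0, z0) \<in> \<C>" and Lz: "(L, z) \<in> \<C>"
  shows "\<exists>C>0. \<forall>s t h. 0 < h \<longrightarrow>
    \<bar>(dist (z0 s - h *\<^sub>R \<nu> (z0 s)) (z t))\<^sup>2 - ((dist (z0 s) (z t))\<^sup>2 + h\<^sup>2)\<bar>
      \<le> C * h * (dist (z0 s) (z t))\<^sup>2"
proof -
  obtain C where C: "C > 0" "\<And>s t. \<bar>\<nu> (z0 s) \<bullet> (z0 s - z t)\<bar> \<le> C * (dist (z0 s) (z t))\<^sup>2"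
    using normal_chord[OF Lz0 Lz] by blast
  have "\<bar>(dist (z0 s - h *\<^sub>R \<nu> (z0 s)) (z t))\<^sup>2 - ((dist (z0 s) (z t))\<^sup>2 + h\<^sup>2)\<bar>
      \<le> 2 * C * h * (dist (z0 s) (z t))\<^sup>2" if h: "0 < h" for s t h
  proof -
    have "\<nu> (z0 s) \<bullet> \<nu> (z0 s) = 1"
      using norm_normal[OF Lz0, of s] by (simp add: norm_eq_sqrt_inner)
    then have "(dist (z0 s - h *\<^sub>R \<nu> (z0 s)) (z t))\<^sup>2 - ((dist (z0 s) (z t))\<^sup>2 + h\<^sup>2)
        = - (2 * h * (\<nu> (z0 s) \<bullet> (z0 s - z t)))"
      unfolding dist_norm power2_norm_eq_inner
      by (simp add: inner_diff_left inner_diff_right inner_commute power2_eq_square algebra_simps)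
    then have "\<bar>(dist (z0 s - h *\<^sub>R \<nu> (z0 s)) (z t))\<^sup>2 - ((dist (z0 s) (z t))\<^sup>2 + h\<^sup>2)\<bar>
        = 2 * h * \<bar>\<nu> (z0 s) \<bullet> (z0 s - z t)\<bar>"
      using h by (simp add: abs_mult)
    also have "\<dots> \<le> 2 * h * (C * (dist (z0 s) (z t))\<^sup>2)"
      using C(2) h by (intro mult_left_mono) auto
    finally show ?thesis by (simp add: mult_ac)
  qed
  then show ?thesis using C(1) by (intro exI[of _ "2 * C"]) auto
qed

lemma half_sum_bound:
  fixes a b x :: real
  assumes "0 \<le> a" "0 < b" "(a + b) / 2 \<le> x"
  shows "0 < x \<and> a / 2 \<le> x"
  using assms by auto

lemma perturbed_sum_bound:
  fixes R e D X c :: real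
  assumes "R \<le> D" "e \<le> 1" "0 \<le> e" "0 \<le> R" "c \<le> 1 / 2 * R" "\<bar>X - (R + e)\<bar> \<le> c"
  shows "(R + e) / 2 \<le> X \<and> X \<le> 2 * D + 1 \<and> R + e \<le> 2 * D + 1"
  using assms by (auto simp: abs_le_iff)

lemma normal_distance_window:
  assumes Lz0: "(L0, z0) \<in> \<C>" and Lz: "(L, z) \<in> \<C>"
  shows "\<exists>C b U. 0 < b \<and> 0 < C \<and> (\<forall>s t h. 0 < h \<longrightarrow> h < b \<longrightarrow>
    \<bar>(dist (z0 s - h *\<^sub>R \<nu> (z0 s)) (z t))\<^sup>2 - ((dist (z0 s) (z t))\<^sup>2 + h\<^sup>2)\<bar>
      \<le> C * h * (dist (z0 s) (z t))\<^sup>2 \<and>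
    ((dist (z0 s) (z t))\<^sup>2 + h\<^sup>2) / 2 \<le> (dist (z0 s - h *\<^sub>R \<nu> (z0 s)) (z t))\<^sup>2 \<and>
    (dist (z0 s - h *\<^sub>R \<nu> (z0 s)) (z t))\<^sup>2 \<le> U \<and> (dist (z0 s) (z t))\<^sup>2 + h\<^sup>2 \<le> U)"
proof -
  obtain C where C: "C > 0" "\<And>s t h. 0 < h \<Longrightarrow>
    \<bar>(dist (z0 s - h *\<^sub>R \<nu> (z0 s)) (z t))\<^sup>2 - ((dist (z0 s) (z t))\<^sup>2 + h\<^sup>2)\<bar>
      \<le> C * h * (dist (z0 s) (z t))\<^sup>2"
    using normal_distance[OF Lz0 Lz] by blast
  obtain D where D: "D > 0" "\<And>s t. dist (z0 s) (z t) \<le> D" using dist_bounded[OF Lz0 Lz] by blast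
  define b where "b = min 1 (1 / (2 * C))"
  have b: "b > 0" using C(1) by (simp add: b_def)
  have "((dist (z0 s) (z t))\<^sup>2 + h\<^sup>2) / 2 \<le> (dist (z0 s - h *\<^sub>R \<nu> (z0 s)) (z t))\<^sup>2 \<and>
    (dist (z0 s - h *\<^sub>R \<nu> (z0 s)) (z t))\<^sup>2 \<le> 2 * D\<^sup>2 + 1 \<and> (dist (z0 s) (z t))\<^sup>2 + h\<^sup>2 \<le> 2 * D\<^sup>2 + 1"
    if h: "0 < h" "h < b" for s t h
  proof -
    define R where "R = (dist (z0 s) (z t))\<^sup>2"
    define X where "X = (dist (z0 s - h *\<^sub>R \<nu> (z0 s)) (z t))\<^sup>2"
    have "R \<le> D\<^sup>2" unfolding R_def using D(2) by (intro power_mono) auto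
    moreover have "h\<^sup>2 \<le> 1" "0 \<le> h\<^sup>2" using h by (auto simp: b_def power_le_one)
    moreover have "0 \<le> R" "0 \<le> D\<^sup>2" by (simp_all add: R_def)
    moreover have "C * h * R \<le> 1 / 2 * R"
    proof (rule mult_right_mono)
      have "h < 1 / (2 * C)" using h by (simp add: b_def)
      then show "C * h \<le> 1 / 2" using C(1) by (simp add: field_simps)
    qed (simp add: R_def)
    moreover have "\<bar>X - (R + h\<^sup>2)\<bar> \<le> C * h * R"
      using C(2)[OF h(1)] by (simp add: R_def X_def)
    ultimately have "(R + h\<^sup>2) / 2 \<le> X \<and> X \<le> 2 * D\<^sup>2 + 1 \<and> R + h\<^sup>2 \<le> 2 * D\<^sup>2 + 1"
      by (intro perturbed_sum_bound[of R "D\<^sup>2" "h\<^sup>2" "C * h * R"])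
    then show ?thesis by (simp only: R_def X_def)
  qed
  with b C show ?thesis by (intro exI[of _ C] exI[of _ b] exI[of _ "2 * D\<^sup>2 + 1"]) auto
qed

lemma phi1_difference:
  "\<exists>B>0. \<forall>u v. 0 < u \<longrightarrow> u \<le> U \<longrightarrow> 0 < v \<longrightarrow> v \<le> U \<longrightarrow> \<bar>\<phi>1 u - \<phi>1 v\<bar> \<le> B * \<bar>u - v\<bar> / (u * v)"
proof -
  obtain B where B: "B > 0" "\<And>u v. 0 < u \<Longrightarrow> u \<le> v \<Longrightarrow> v \<le> U \<Longrightarrow> \<bar>\<phi>1 v - \<phi>1 u\<bar> \<le> B * (1 / u - 1 / v)"
    using difference_bounds[of U] by meson
  have "\<bar>\<phi>1 u - \<phi>1 v\<bar> \<le> B * \<bar>u - v\<bar> / (u * v)" if "0 < u" "u \<le> U" "0 < v" "v \<le> U" for u v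
  proof (cases "u \<le> v")
    case True
    then have "B * (1 / u - 1 / v) = B * \<bar>u - v\<bar> / (u * v)"
      using that by (simp add: field_simps)
    then show ?thesis using B(2)[of u v] True that by (simp add: abs_minus_commute)
  next
    case False
    then have "B * (1 / v - 1 / u) = B * \<bar>u - v\<bar> / (u * v)"
      using that by (simp add: field_simps)
    then show ?thesis using B(2)[of v u] False that by simp
  qed
  then show ?thesis using B(1) by blast
qed

text \<open>Shifting the base point to \<open>x - h \<nu>\<close> has the same effect in the limit as the regularisation
  \<open>r\<^sup>2 + h\<^sup>2\<close>: the two kernels differ by at most a multiple of \<open>h r\<^sup>3 / (r\<^sup>2 + h\<^sup>2)\<^sup>2\<close>, which is bounded
  and tends to zero pointwise.\<close>

lemma normal_approach:
  assumes Lz0: "(L0, z0) \<in> \<C>" and Lz: "(L, z) \<in> \<C>"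
    and g: "continuous_on {0..L} (\<lambda>t. g (z t))"
    and lim: "((\<lambda>h. integral {0..L} (\<lambda>t. g (z t) * (2 * (\<tau> (z0 s) \<bullet> (z0 s - z t)) *
      \<phi>1 ((dist (z0 s) (z t))\<^sup>2 + h\<^sup>2)))) \<longlongrightarrow> T) (at_right 0)"
  shows "((\<lambda>h. integral {0..L} (\<lambda>t. g (z t) * (2 * (\<tau> (z0 s) \<bullet> (z0 s - z t)) *
      \<phi>1 ((dist (z0 s - h *\<^sub>R \<nu> (z0 s)) (z t))\<^sup>2)))) \<longlongrightarrow> T) (at_right 0)"
proof -
  define \<rho> where "\<rho> h t = (dist (z0 s - h *\<^sub>R \<nu> (z0 s)) (z t))\<^sup>2" for h t
  define r where "r t = dist (z0 s) (z t)" for t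
  define N where "N t = g (z t) * (2 * (\<tau> (z0 s) \<bullet> (z0 s - z t)))" for t
  from normal_distance_window[OF Lz0 Lz]
  obtain C b U where "0 < b \<and> 0 < C \<and> (\<forall>s t h. 0 < h \<longrightarrow> h < b \<longrightarrow>
    \<bar>(dist (z0 s - h *\<^sub>R \<nu> (z0 s)) (z t))\<^sup>2 - ((dist (z0 s) (z t))\<^sup>2 + h\<^sup>2)\<bar>
      \<le> C * h * (dist (z0 s) (z t))\<^sup>2 \<and>
    ((dist (z0 s) (z t))\<^sup>2 + h\<^sup>2) / 2 \<le> (dist (z0 s - h *\<^sub>R \<nu> (z0 s)) (z t))\<^sup>2 \<and>
    (dist (z0 s - h *\<^sub>R \<nu> (z0 s)) (z t))\<^sup>2 \<le> U \<and> (dist (z0 s) (z t))\<^sup>2 + h\<^sup>2 \<le> U)"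
    by (elim exE) (rule that)
  then have b: "0 < b" and C: "0 < C"
    and win: "\<And>h t. 0 < h \<Longrightarrow> h < b \<Longrightarrow> \<bar>\<rho> h t - ((r t)\<^sup>2 + h\<^sup>2)\<bar> \<le> C * h * (r t)\<^sup>2 \<and>
      ((r t)\<^sup>2 + h\<^sup>2) / 2 \<le> \<rho> h t \<and> \<rho> h t \<le> U \<and> (r t)\<^sup>2 + h\<^sup>2 \<le> U"
    unfolding \<rho>_def r_def by auto
  obtain B where B: "B > 0" "\<And>u v. 0 < u \<Longrightarrow> u \<le> U \<Longrightarrow> 0 < v \<Longrightarrow> v \<le> U \<Longrightarrow>
      \<bar>\<phi>1 u - \<phi>1 v\<bar> \<le> B * \<bar>u - v\<bar> / (u * v)"
    using phi1_difference[of U] by blast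
  have "bounded ((\<lambda>t. g (z t)) ` {0..L})"
    using g compact_continuous_image compact_imp_bounded by blast
  then obtain P where P: "P > 0" "\<And>t. t \<in> {0..L} \<Longrightarrow> \<bar>g (z t)\<bar> \<le> P"
    unfolding bounded_pos by auto
  have \<rho>_pos: "0 < \<rho> h t" "0 < (r t)\<^sup>2 + h\<^sup>2" if "0 < h" "h < b" for h t
  proof -
    show "0 < (r t)\<^sup>2 + h\<^sup>2" using that(1) by (rule add_sq_pos)
    show "0 < \<rho> h t"
      using half_sum_bound[of "(r t)\<^sup>2" "h\<^sup>2"] win[OF that, of t] that(1) by simp
  qed
  have Nb: "\<bar>N t\<bar> \<le> 2 * P * r t" if "t \<in> {0..L}" for t
  proof -
    have "\<bar>\<tau> (z0 s) \<bullet> (z0 s - z t)\<bar> \<le> r t"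
      using Cauchy_Schwarz_ineq2[of "\<tau> (z0 s)" "z0 s - z t"]
      by (simp add: norm_tangent[OF Lz0] dist_norm r_def)
    then have "\<bar>N t\<bar> \<le> P * (2 * r t)"
      unfolding N_def abs_mult using P(2)[OF that] P(1) by (intro mult_mono) auto
    then show ?thesis by simp
  qed
  have Nc: "continuous_on {0..L} N"
    unfolding N_def[abs_def] by (intro continuous_intros g z_cont[OF Lz])
  have int: "(\<lambda>t. N t * \<phi>1 (\<rho> h t)) integrable_on {0..L}"
    "(\<lambda>t. N t * \<phi>1 ((r t)\<^sup>2 + h\<^sup>2)) integrable_on {0..L}" if "0 < h" "h < b" for h
  proof -
    show "(\<lambda>t. N t * \<phi>1 (\<rho> h t)) integrable_on {0..L}"
      using \<rho>_pos[OF that]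
      by (intro integrable_continuous_interval continuous_intros Nc)
        (auto simp: \<rho>_def[abs_def] intro!: continuous_intros z_cont[OF Lz])
    show "(\<lambda>t. N t * \<phi>1 ((r t)\<^sup>2 + h\<^sup>2)) integrable_on {0..L}"
      using \<rho>_pos[OF that]
      by (intro integrable_continuous_interval continuous_intros Nc)
        (auto simp: r_def[abs_def] intro!: continuous_intros z_cont[OF Lz])
  qed
  have bd: "\<bar>N t * (\<phi>1 (\<rho> h t) - \<phi>1 ((r t)\<^sup>2 + h\<^sup>2))\<bar> \<le> 4 * P * B * C"
    if h: "0 < h" "h < b" and t: "t \<in> {0..L}" for h t
  proof -
    define u where "u = (r t)\<^sup>2 + h\<^sup>2"
    have u: "u > 0" using \<rho>_pos[OF h] by (simp add: u_def)
    have r0: "0 \<le> r t" by (simp add: r_def)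
    have "\<bar>\<phi>1 (\<rho> h t) - \<phi>1 u\<bar> \<le> B * \<bar>\<rho> h t - u\<bar> / (\<rho> h t * u)"
      using win[OF h, of t] \<rho>_pos[OF h, of t] by (intro B(2)) (auto simp: u_def)
    also have "\<dots> \<le> B * (C * h * (r t)\<^sup>2) / (u / 2 * u)"
      using win[OF h, of t] B(1) u
      by (intro frac_le mult_left_mono mult_right_mono mult_nonneg_nonneg mult_pos_pos)
        (use C h in \<open>auto simp: u_def\<close>)
    finally have "\<bar>\<phi>1 (\<rho> h t) - \<phi>1 u\<bar> \<le> 2 * B * C * (h * (r t)\<^sup>2) / (u * u)"
      by (simp add: mult_ac)
    then have "\<bar>N t\<bar> * \<bar>\<phi>1 (\<rho> h t) - \<phi>1 u\<bar> \<le> (2 * P * r t) * (2 * B * C * (h * (r t)\<^sup>2) / (u * u))"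
      using Nb[OF t] P(1) r0 by (intro mult_mono) auto
    also have "\<dots> = 4 * P * B * C * ((r t * h) * (r t)\<^sup>2 / (u * u))" by simp
    also have "\<dots> \<le> 4 * P * B * C * 1"
    proof (rule mult_left_mono)
      have "0 \<le> (r t - h)\<^sup>2 + (r t)\<^sup>2 + h\<^sup>2" by simp
      then have "r t * h \<le> u" by (simp add: u_def power2_eq_square algebra_simps)
      moreover have "(r t)\<^sup>2 \<le> u" by (simp add: u_def)
      ultimately have "(r t * h) * (r t)\<^sup>2 \<le> u * u" using u by (intro mult_mono) auto
      then show "(r t * h) * (r t)\<^sup>2 / (u * u) \<le> 1" using u by simp
    qed (use P(1) B(1) C in auto)
    finally show ?thesis by (simp add: abs_mult u_def)
  qed
  have "((\<lambda>h. integral {0..L} (\<lambda>t. N t * \<phi>1 (\<rho> h t)) - integral {0..L} (\<lambda>t. N t * \<phi>1 ((r t)\<^sup>2 + h\<^sup>2)))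
      \<longlongrightarrow> 0) (at_right 0)"
  proof (rule tendsto_at_right_sequentially[OF b])
    fix S :: "nat \<Rightarrow> real" assume S: "\<And>n. 0 < S n" "\<And>n. S n < b" "S \<longlonglongrightarrow> 0"
    have "(\<lambda>n. integral {0..L} (\<lambda>t. N t * (\<phi>1 (\<rho> (S n) t) - \<phi>1 ((r t)\<^sup>2 + (S n)\<^sup>2))))
        \<longlonglongrightarrow> integral {0..L} (\<lambda>t. 0 :: real)"
    proof (rule dominated_convergence(2)[where h = "\<lambda>t. 4 * P * B * C"])
      show "(\<lambda>t. N t * (\<phi>1 (\<rho> (S n) t) - \<phi>1 ((r t)\<^sup>2 + (S n)\<^sup>2))) integrable_on {0..L}" for n
        unfolding right_diff_distrib using int S by (intro integrable_diff) auto
      show "(\<lambda>t. 4 * P * B * C) integrable_on {0..L}" by (rule integrable_const_ivl)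
      show "norm (N t * (\<phi>1 (\<rho> (S n) t) - \<phi>1 ((r t)\<^sup>2 + (S n)\<^sup>2))) \<le> 4 * P * B * C"
        if "t \<in> {0..L}" for n t
        using bd[OF S(1) S(2) that] by (simp only: real_norm_def)
      show "(\<lambda>n. N t * (\<phi>1 (\<rho> (S n) t) - \<phi>1 ((r t)\<^sup>2 + (S n)\<^sup>2))) \<longlonglongrightarrow> 0" if "t \<in> {0..L}" for t
      proof (cases "r t = 0")
        case True
        then have "N t = 0" using Nb[OF that] by simp
        then show ?thesis by simp
      next
        case False
        have "(\<lambda>n. \<rho> (S n) t) \<longlonglongrightarrow> (dist (z0 s - 0 *\<^sub>R \<nu> (z0 s)) (z t))\<^sup>2"
          unfolding \<rho>_def by (intro tendsto_intros S)
        then have "(\<lambda>n. \<rho> (S n) t) \<longlonglongrightarrow> (r t)\<^sup>2" by (simp add: r_def)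
        moreover have "(\<lambda>n. (r t)\<^sup>2 + (S n)\<^sup>2) \<longlonglongrightarrow> (r t)\<^sup>2"
          using tendsto_add[OF tendsto_const tendsto_power[OF S(3), of 2], of "(r t)\<^sup>2"] by simp
        ultimately have "(\<lambda>n. N t * (\<phi>1 (\<rho> (S n) t) - \<phi>1 ((r t)\<^sup>2 + (S n)\<^sup>2)))
            \<longlonglongrightarrow> N t * (\<phi>1 ((r t)\<^sup>2) - \<phi>1 ((r t)\<^sup>2))"
          using False by (intro tendsto_intros tendsto_phi) auto
        then show ?thesis by simp
      qed
    qed
    then show "(\<lambda>n. integral {0..L} (\<lambda>t. N t * \<phi>1 (\<rho> (S n) t))
        - integral {0..L} (\<lambda>t. N t * \<phi>1 ((r t)\<^sup>2 + (S n)\<^sup>2))) \<longlonglongrightarrow> 0"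
      using int S by (simp add: right_diff_distrib integral_diff)
  qed
  from tendsto_add[OF this lim[folded r_def, folded mult.assoc[of "g (z t)" for t], folded N_def]]
  show ?thesis by (simp add: N_def \<rho>_def mult.assoc)
qed

text \<open>Potentials whose kernel is \<open>\<phi>\<close> itself are continuous up to the boundary. The density is
  vector-valued because it will be a scalar function times the normal.\<close>

lemma potential_normal_limit:
  fixes G :: "real \<Rightarrow> real^2"
  assumes Lz0: "(L0, z0) \<in> \<C>" and Lz: "(L, z) \<in> \<C>" and G: "continuous_on {0..L} G"
  shows "(\<lambda>t. \<phi> ((dist (z0 s) (z t))\<^sup>2) *\<^sub>R G t) integrable_on {0..L}"
    and "((\<lambda>h. integral {0..L} (\<lambda>t. \<phi> ((dist (z0 s - h *\<^sub>R \<nu> (z0 s)) (z t))\<^sup>2) *\<^sub>R G t)) \<longlongrightarrow>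
      integral {0..L} (\<lambda>t. \<phi> ((dist (z0 s) (z t))\<^sup>2) *\<^sub>R G t)) (at_right 0)"
proof -
  from normal_distance_window[OF Lz0 Lz]
  obtain C b U where "0 < b \<and> 0 < C \<and> (\<forall>s t h. 0 < h \<longrightarrow> h < b \<longrightarrow>
    \<bar>(dist (z0 s - h *\<^sub>R \<nu> (z0 s)) (z t))\<^sup>2 - ((dist (z0 s) (z t))\<^sup>2 + h\<^sup>2)\<bar>
      \<le> C * h * (dist (z0 s) (z t))\<^sup>2 \<and>
    ((dist (z0 s) (z t))\<^sup>2 + h\<^sup>2) / 2 \<le> (dist (z0 s - h *\<^sub>R \<nu> (z0 s)) (z t))\<^sup>2 \<and>
    (dist (z0 s - h *\<^sub>R \<nu> (z0 s)) (z t))\<^sup>2 \<le> U \<and> (dist (z0 s) (z t))\<^sup>2 + h\<^sup>2 \<le> U)"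
    by (elim exE) (rule that)
  then have b: "0 < b"
    and win: "\<And>h t. 0 < h \<Longrightarrow> h < b \<Longrightarrow>
      ((dist (z0 s) (z t))\<^sup>2 + h\<^sup>2) / 2 \<le> (dist (z0 s - h *\<^sub>R \<nu> (z0 s)) (z t))\<^sup>2 \<and>
      (dist (z0 s - h *\<^sub>R \<nu> (z0 s)) (z t))\<^sup>2 \<le> U"
    by auto
  have "\<exists>w. w integrable_on {0..L} \<and> (\<forall>t\<in>{0..L}. dist (z0 s) (z t) powr (- (1/2)) \<le> w t)"
    using majorant[OF Lz0 Lz, of "1/2"] by auto
  then obtain w where w: "w integrable_on {0..L}"
      "\<And>t. t \<in> {0..L} \<Longrightarrow> dist (z0 s) (z t) powr (- (1/2)) \<le> w t" by blast
  have main: "(\<lambda>t. \<phi> ((dist (z0 s) (z t))\<^sup>2) *\<^sub>R G t) integrable_on {0..L} \<and>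
    (\<lambda>n. integral {0..L} (\<lambda>t. \<phi> ((dist (z0 s - S n *\<^sub>R \<nu> (z0 s)) (z t))\<^sup>2) *\<^sub>R G t)) \<longlonglongrightarrow>
      integral {0..L} (\<lambda>t. \<phi> ((dist (z0 s) (z t))\<^sup>2) *\<^sub>R G t)"
    if S: "\<And>n. 0 < S n" "\<And>n. S n < b" "S \<longlonglongrightarrow> 0" for S :: "nat \<Rightarrow> real"
  proof -
    have 1: "finite {t \<in> {0..L}. dist (z0 s) (z t) = 0}"
      by (rule finite_subset[OF _ finite_hits[OF Lz, of "z0 s"]]) auto
    have 2: "0 \<le> dist (z0 s) (z t) \<and> dist (z0 s) (z t) powr (- (1/2)) \<le> w t" if "t \<in> {0..L}" for t
      using w(2)[OF that] by simp
    have 3: "continuous_on {0..L} (\<lambda>t. (dist (z0 s - S n *\<^sub>R \<nu> (z0 s)) (z t))\<^sup>2)" for n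
      by (intro continuous_intros z_cont[OF Lz])
    have 4: "0 < (dist (z0 s - S n *\<^sub>R \<nu> (z0 s)) (z t))\<^sup>2 \<and>
        (dist (z0 s) (z t))\<^sup>2 / 2 \<le> (dist (z0 s - S n *\<^sub>R \<nu> (z0 s)) (z t))\<^sup>2 \<and>
        (dist (z0 s - S n *\<^sub>R \<nu> (z0 s)) (z t))\<^sup>2 \<le> U" for n t
    proof -
      have "0 < (S n)\<^sup>2" using S(1)[of n] by simp
      then show ?thesis
        using half_sum_bound[OF zero_le_power2, of "(S n)\<^sup>2" "dist (z0 s) (z t)"
            "(dist (z0 s - S n *\<^sub>R \<nu> (z0 s)) (z t))\<^sup>2"] win[of "S n" t, OF S(1) S(2)]
        by blast
    qed
    have 5: "(\<lambda>n. (dist (z0 s - S n *\<^sub>R \<nu> (z0 s)) (z t))\<^sup>2) \<longlonglongrightarrow> (dist (z0 s) (z t))\<^sup>2" for t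
    proof -
      have "(\<lambda>n. (dist (z0 s - S n *\<^sub>R \<nu> (z0 s)) (z t))\<^sup>2)
          \<longlonglongrightarrow> (dist (z0 s - 0 *\<^sub>R \<nu> (z0 s)) (z t))\<^sup>2"
        by (intro tendsto_intros S)
      then show ?thesis by simp
    qed
    show ?thesis
      using log_kernel_convergence[where r = "\<lambda>t. dist (z0 s) (z t)" and U = U
          and \<rho> = "\<lambda>n t. (dist (z0 s - S n *\<^sub>R \<nu> (z0 s)) (z t))\<^sup>2", OF G w(1) 1 2 3 4 5] by blast
  qed
  show "((\<lambda>h. integral {0..L} (\<lambda>t. \<phi> ((dist (z0 s - h *\<^sub>R \<nu> (z0 s)) (z t))\<^sup>2) *\<^sub>R G t)) \<longlongrightarrow>
      integral {0..L} (\<lambda>t. \<phi> ((dist (z0 s) (z t))\<^sup>2) *\<^sub>R G t)) (at_right 0)"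
    by (rule tendsto_at_right_sequentially[OF b]) (use main in blast)
  define S where "S n = b / 2 * (1 / real (Suc n))" for n
  have "b / 2 * (1 / real (Suc n)) \<le> b / 2 * 1" for n using b by (intro mult_left_mono) auto
  then have "S n < b" for n unfolding S_def using b by (smt (verit) field_sum_of_halves)
  moreover have "0 < S n" for n using b by (simp add: S_def)
  moreover have "S \<longlonglongrightarrow> b / 2 * 0"
    unfolding S_def by (intro tendsto_intros LIMSEQ_Suc[OF lim_1_over_n])
  ultimately show "(\<lambda>t. \<phi> ((dist (z0 s) (z t))\<^sup>2) *\<^sub>R G t) integrable_on {0..L}"
    using main[of S] by simp
qed

lemma dist_sq_inner: "(dist x y)\<^sup>2 = (y - x) \<bullet> (y - x)" for x y :: "real^2"
  by (metis dist_commute dist_norm power2_norm_eq_inner)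

lemma GDERIV_kernel:
  fixes x y :: "real^2"
  assumes "y \<noteq> x"
  shows "GDERIV (\<lambda>y. \<phi> ((dist x y)\<^sup>2)) y :> (2 * \<phi>1 ((dist x y)\<^sup>2)) *\<^sub>R (y - x)"
proof -
  have "((\<lambda>y. (y - x) \<bullet> (y - x)) has_derivative (\<lambda>h. 2 * (h \<bullet> (y - x)))) (at y)"
    by (auto intro!: derivative_eq_intros simp: inner_commute)
  then have "GDERIV (\<lambda>y. (dist x y)\<^sup>2) y :> 2 *\<^sub>R (y - x)"
    unfolding gderiv_def by (simp add: dist_sq_inner)
  from GDERIV_DERIV_compose[OF this deriv1] show ?thesis
    using assms by (simp add: mult.commute)
qed

text \<open>The derivative of the kernel \<open>y \<mapsto> \<phi> (|p - y|\<^sup>2)\<close> in the direction \<open>n\<close>.\<close>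

definition dipole :: "real^2 \<Rightarrow> real^2 \<Rightarrow> real^2 \<Rightarrow> real" where
  "dipole n y p = 2 * \<phi>1 ((dist p y)\<^sup>2) * (n \<bullet> (y - p))"

text \<open>The gradient of the dipole in \<open>p\<close>: minus the Hessian of the kernel applied to \<open>n\<close>.\<close>

definition dipole_grad :: "real^2 \<Rightarrow> real^2 \<Rightarrow> real^2 \<Rightarrow> real^2" where
  "dipole_grad n y p = - ((2 * \<phi>1 ((dist p y)\<^sup>2)) *\<^sub>R n
     + (4 * \<phi>2 ((dist p y)\<^sup>2) * (n \<bullet> (y - p))) *\<^sub>R (y - p))"

lemma dipole_has_derivative:
  assumes "p \<noteq> y"
  shows "(dipole n y has_derivative (\<lambda>h. h \<bullet> dipole_grad n y p)) (at p)"
proof -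
  have sq: "((\<lambda>p. (dist p y)\<^sup>2) has_derivative (\<lambda>h. 2 * (h \<bullet> (p - y)))) (at p)"
    unfolding dist_norm power2_norm_eq_inner by (auto intro!: derivative_eq_intros simp: inner_commute)
  have "(\<phi>1 has_derivative (\<lambda>x. \<phi>2 ((dist p y)\<^sup>2) * x)) (at ((dist p y)\<^sup>2))"
    using deriv2[of "(dist p y)\<^sup>2"] assms by (simp add: has_field_derivative_def)
  from has_derivative_compose[OF sq this]
  have 1: "((\<lambda>p. \<phi>1 ((dist p y)\<^sup>2)) has_derivative (\<lambda>h. \<phi>2 ((dist p y)\<^sup>2) * (2 * (h \<bullet> (p - y))))) (at p)" .
  have 2: "((\<lambda>p. n \<bullet> (y - p)) has_derivative (\<lambda>h. - (n \<bullet> h))) (at p)"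
    by (auto intro!: derivative_eq_intros)
  have "((\<lambda>p. 2 * (\<phi>1 ((dist p y)\<^sup>2) * (n \<bullet> (y - p)))) has_derivative
      (\<lambda>h. 2 * (\<phi>1 ((dist p y)\<^sup>2) * - (n \<bullet> h)
        + \<phi>2 ((dist p y)\<^sup>2) * (2 * (h \<bullet> (p - y))) * (n \<bullet> (y - p))))) (at p)"
    by (intro has_derivative_mult_right has_derivative_mult 1 2)
  moreover have "(\<lambda>h. 2 * (\<phi>1 ((dist p y)\<^sup>2) * - (n \<bullet> h)
        + \<phi>2 ((dist p y)\<^sup>2) * (2 * (h \<bullet> (p - y))) * (n \<bullet> (y - p)))) = (\<lambda>h. h \<bullet> dipole_grad n y p)"
    by (auto simp: dipole_grad_def fun_eq_iff inner_add_right inner_diff_right inner_commute algebra_simps)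
  ultimately show ?thesis unfolding dipole_def[abs_def] by (simp add: mult.assoc)
qed

lemma continuous_dipole:
  assumes f: "continuous_on S f" and Y: "continuous_on S Y" and n: "continuous_on S n"
    and ne: "\<And>x. x \<in> S \<Longrightarrow> f x \<noteq> Y x"
  shows "continuous_on S (\<lambda>x. dipole (n x) (Y x) (f x))"
    and "continuous_on S (\<lambda>x. dipole_grad (n x) (Y x) (f x))"
  unfolding dipole_def dipole_grad_def using ne by (auto intro!: continuous_intros f Y n)

lemma double_layer_gradient:
  assumes Lz: "(L, z) \<in> \<C>" and g: "continuous_on {0..L} (\<lambda>t. g (z t))" and p: "p \<notin> range z"
  shows "GDERIV (\<lambda>p. integral {0..L} (\<lambda>t. g (z t) * dipole (\<nu> (z t)) (z t) p)) p :>
      integral {0..L} (\<lambda>t. g (z t) *\<^sub>R dipole_grad (\<nu> (z t)) (z t) p)"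
    and "(\<lambda>t. g (z t) *\<^sub>R dipole_grad (\<nu> (z t)) (z t) p) integrable_on {0..L}"
proof -
  have "open (- range z)" using compact_range_z[OF Lz] compact_imp_closed by blast
  then obtain e where e: "e > 0" "ball p e \<subseteq> - range z"
    using p openE by (metis ComplI)
  have ne: "x \<noteq> z t" if "x \<in> ball p e" for x t using e(2) that by auto
  show int: "(\<lambda>t. g (z t) *\<^sub>R dipole_grad (\<nu> (z t)) (z t) p) integrable_on {0..L}"
    using p by (intro integrable_continuous_interval continuous_intros g continuous_dipole
        z_cont[OF Lz] normal_cont[OF Lz]) auto
  have "((\<lambda>p. integral (cbox 0 L) (\<lambda>t. g (z t) * dipole (\<nu> (z t)) (z t) p)) has_derivative
      blinfun_apply (integral (cbox 0 L)
        (\<lambda>t. blinfun_inner_left (g (z t) *\<^sub>R dipole_grad (\<nu> (z t)) (z t) p)))) (at p within ball p e)"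
  proof (rule leibniz_rule)
    show "((\<lambda>p. g (z t) * dipole (\<nu> (z t)) (z t) p) has_derivative
        blinfun_apply (blinfun_inner_left (g (z t) *\<^sub>R dipole_grad (\<nu> (z t)) (z t) x)))
        (at x within ball p e)" if "x \<in> ball p e" for x t
      using has_derivative_mult_right[OF has_derivative_at_withinI[OF dipole_has_derivative[OF ne[OF that]]],
          of "g (z t)" "\<nu> (z t)" t "ball p e"]
      by (simp add: fun_eq_iff)
    show "(\<lambda>t. g (z t) * dipole (\<nu> (z t)) (z t) x) integrable_on cbox 0 L" if "x \<in> ball p e" for x
      unfolding box_real using ne[OF that]
      by (intro integrable_continuous_interval continuous_intros g continuous_dipole
        z_cont[OF Lz] normal_cont[OF Lz]) auto
    show "continuous_on (ball p e \<times> cbox 0 L)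
        (\<lambda>(x, t). blinfun_inner_left (g (z t) *\<^sub>R dipole_grad (\<nu> (z t)) (z t) x))"
      unfolding split_beta
      by (intro bounded_linear.continuous_on[OF bounded_linear_blinfun_inner_left]
          continuous_intros continuous_dipole continuous_on_compose2[OF g]
          continuous_on_compose2[OF z_cont[OF Lz, of UNIV]]
          continuous_on_compose2[OF normal_cont[OF Lz, of UNIV]]) (use ne in auto)
  qed (use e in auto)
  moreover have "integral {0..L} (\<lambda>t. blinfun_inner_left (g (z t) *\<^sub>R dipole_grad (\<nu> (z t)) (z t) p))
      = blinfun_inner_left (integral {0..L} (\<lambda>t. g (z t) *\<^sub>R dipole_grad (\<nu> (z t)) (z t) p))"
    using integral_linear[OF int bounded_linear_blinfun_inner_left] by (simp add: o_def)
  ultimately show "GDERIV (\<lambda>p. integral {0..L} (\<lambda>t. g (z t) * dipole (\<nu> (z t)) (z t) p)) p :>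
      integral {0..L} (\<lambda>t. g (z t) *\<^sub>R dipole_grad (\<nu> (z t)) (z t) p)"
    using e(1) by (simp add: gderiv_def at_within_open[of p "ball p e"])
qed

text \<open>The identity is \<open>H n \<bullet> m + H (J n) \<bullet> (J m) = (tr H) (n \<bullet> m)\<close> for a symmetric matrix \<open>H\<close> and
  the rotation \<open>J\<close> by a right angle: it trades two normal derivatives of the kernel for its
  Laplacian and two tangential derivatives, one of which is integrated by parts.\<close>

lemma dipole_grad_identity:
  assumes "p \<noteq> y"
  shows "m \<bullet> dipole_grad n y p = - ((m \<bullet> n) * (4 * \<phi>1 ((dist p y)\<^sup>2) + 4 * (dist p y)\<^sup>2 * \<phi>2 ((dist p y)\<^sup>2)))
    + (2 * \<phi>1 ((dist p y)\<^sup>2) * (rot90 m \<bullet> rot90 n)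
      + 4 * \<phi>2 ((dist p y)\<^sup>2) * (rot90 m \<bullet> (y - p)) * (rot90 n \<bullet> (y - p)))"
proof -
  have d: "(dist p y)\<^sup>2 = (y - p) $ 1 * (y - p) $ 1 + (y - p) $ 2 * (y - p) $ 2"
    by (simp only: dist_sq_inner inner_real2)
  define w where "w = y - p"
  define a where "a = \<phi>1 ((dist p y)\<^sup>2)"
  define b where "b = \<phi>2 ((dist p y)\<^sup>2)"
  show ?thesis
    unfolding dipole_grad_def a_def[symmetric] b_def[symmetric] unfolding d w_def[symmetric]
    by (simp add: inner_real2) (simp add: algebra_simps)
qed

text \<open>The terms with two tangential derivatives in the preceding identity form the derivative along
  the curve of the component of the gradient of the kernel in the direction \<open>rot90 m\<close>.
  Integration by parts over the closed curve moves this derivative to the density.\<close>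

lemma double_layer_normal_component:
  assumes Lz: "(L, z) \<in> \<C>" and p: "p \<notin> range z"
    and g: "\<And>t. ((\<lambda>t. g (z t)) has_real_derivative g' (z t)) (at t)"
    and g': "continuous_on {0..L} (\<lambda>t. g' (z t))"
  shows "m \<bullet> integral {0..L} (\<lambda>t. g (z t) *\<^sub>R dipole_grad (\<nu> (z t)) (z t) p) =
    integral {0..L} (\<lambda>t. g' (z t) * (2 * (rot90 m \<bullet> (p - z t)) * \<phi>1 ((dist p (z t))\<^sup>2)))
    - m \<bullet> integral {0..L} (\<lambda>t. (4 * \<phi>1 ((dist p (z t))\<^sup>2)
        + 4 * (dist p (z t))\<^sup>2 * \<phi>2 ((dist p (z t))\<^sup>2)) *\<^sub>R (g (z t) *\<^sub>R \<nu> (z t)))"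
proof -
  have gc: "continuous_on {0..L} (\<lambda>t. g (z t))"
    using g DERIV_isCont continuous_at_imp_continuous_on by blast
  have pos: "0 < (dist p (z t))\<^sup>2" for t using p by auto
  define lap where "lap t = 4 * \<phi>1 ((dist p (z t))\<^sup>2) + 4 * (dist p (z t))\<^sup>2 * \<phi>2 ((dist p (z t))\<^sup>2)" for t
  define Y where "Y t = 2 * \<phi>1 ((dist p (z t))\<^sup>2) * (rot90 m \<bullet> (z t - p))" for t
  define Y' where "Y' t = 2 * \<phi>1 ((dist p (z t))\<^sup>2) * (rot90 m \<bullet> \<tau> (z t))
      + 4 * \<phi>2 ((dist p (z t))\<^sup>2) * (rot90 m \<bullet> (z t - p)) * (\<tau> (z t) \<bullet> (z t - p))" for t
  have Yd: "(Y has_real_derivative Y' t) (at t)" for t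
  proof -
    have "((\<lambda>t. \<phi>1 ((dist (z t) p)\<^sup>2 + 0)) has_real_derivative
        \<phi>2 ((dist (z t) p)\<^sup>2 + 0) * (2 * (\<tau> (z t) \<bullet> (z t - p)))) (at t)"
      by (rule DERIV_chain2[OF deriv2 has_derivative_dist_sq[OF Lz]])
        (use pos[of t] in \<open>simp add: dist_commute\<close>)
    then have 1: "((\<lambda>t. \<phi>1 ((dist p (z t))\<^sup>2)) has_real_derivative
        \<phi>2 ((dist p (z t))\<^sup>2) * (2 * (\<tau> (z t) \<bullet> (z t - p)))) (at t)"
      by (simp add: dist_commute)
    have "((\<lambda>t. rot90 m \<bullet> (z t - p)) has_derivative (\<lambda>h. rot90 m \<bullet> (h *\<^sub>R \<tau> (z t)))) (at t)"
      using z_deriv[OF Lz, of t] unfolding has_vector_derivative_def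
      by (auto intro!: derivative_eq_intros)
    then have 2: "((\<lambda>t. rot90 m \<bullet> (z t - p)) has_real_derivative rot90 m \<bullet> \<tau> (z t)) (at t)"
      unfolding has_field_derivative_def by (rule has_derivative_eq_rhs) (simp add: fun_eq_iff)
    from DERIV_mult[OF DERIV_cmult[OF 1, of 2] 2] show ?thesis
      unfolding Y_def[abs_def] Y'_def by (rule DERIV_cong) (simp add: algebra_simps)
  qed
  have "((\<lambda>t. g' (z t) * Y t + Y' t * g (z t)) has_integral (g (z L) * Y L - g (z 0) * Y 0)) {0..L}"
  proof (rule fundamental_theorem_of_calculus)
    show "((\<lambda>t. g (z t) * Y t) has_vector_derivative g' (z t) * Y t + Y' t * g (z t))
        (at t within {0..L})" for t
      using DERIV_mult[OF g Yd, of t]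
      by (simp add: has_real_derivative_iff_has_vector_derivative has_vector_derivative_at_within)
  qed (use L_pos[OF Lz] in simp)
  moreover have "z L = z 0" using z_period[OF Lz, of 0] by simp
  ultimately have ibp: "((\<lambda>t. g' (z t) * Y t + Y' t * g (z t)) has_integral 0) {0..L}"
    by (simp add: Y_def)
  have "continuous_on {0..L} Y"
    using pos unfolding Y_def[abs_def] by (intro continuous_intros z_cont[OF Lz]) auto
  then have iY: "(\<lambda>t. g' (z t) * Y t) integrable_on {0..L}"
    by (intro integrable_continuous_interval continuous_intros g')
  have il: "(\<lambda>t. lap t *\<^sub>R (g (z t) *\<^sub>R \<nu> (z t))) integrable_on {0..L}"
    unfolding lap_def using pos
    by (intro integrable_continuous_interval continuous_intros gc z_cont[OF Lz] normal_cont[OF Lz]) auto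
  have inner_int: "m \<bullet> integral {0..L} f = integral {0..L} (\<lambda>t. m \<bullet> f t)"
    "(\<lambda>t. m \<bullet> f t) integrable_on {0..L}"
    if "f integrable_on {0..L}" for f :: "real \<Rightarrow> real^2"
    using integral_linear[OF that bounded_linear_inner_right, of m]
      integrable_linear[OF that bounded_linear_inner_right, of m] by (simp_all add: o_def)
  have "((\<lambda>t. (g' (z t) * Y t + Y' t * g (z t)) - g' (z t) * Y t - m \<bullet> (lap t *\<^sub>R (g (z t) *\<^sub>R \<nu> (z t))))
      has_integral (0 - integral {0..L} (\<lambda>t. g' (z t) * Y t)
        - integral {0..L} (\<lambda>t. m \<bullet> (lap t *\<^sub>R (g (z t) *\<^sub>R \<nu> (z t)))))) {0..L}"
    by (intro has_integral_diff ibp integrable_integral iY inner_int(2)[OF il])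
  moreover have "(\<lambda>t. (g' (z t) * Y t + Y' t * g (z t)) - g' (z t) * Y t - m \<bullet> (lap t *\<^sub>R (g (z t) *\<^sub>R \<nu> (z t))))
      = (\<lambda>t. m \<bullet> (g (z t) *\<^sub>R dipole_grad (\<nu> (z t)) (z t) p))"
  proof
    fix t
    have "p \<noteq> z t" using p by auto
    from dipole_grad_identity[OF this, of m "\<nu> (z t)"]
    have e: "m \<bullet> dipole_grad (\<nu> (z t)) (z t) p = Y' t - lap t * (m \<bullet> \<nu> (z t))"
      by (simp add: Y'_def lap_def \<tau>_def)
    show "(g' (z t) * Y t + Y' t * g (z t)) - g' (z t) * Y t - m \<bullet> (lap t *\<^sub>R (g (z t) *\<^sub>R \<nu> (z t)))
        = m \<bullet> (g (z t) *\<^sub>R dipole_grad (\<nu> (z t)) (z t) p)"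
      unfolding inner_scaleR_right e by (simp add: algebra_simps)
  qed
  ultimately have "integral {0..L} (\<lambda>t. m \<bullet> (g (z t) *\<^sub>R dipole_grad (\<nu> (z t)) (z t) p))
      = - integral {0..L} (\<lambda>t. g' (z t) * Y t)
        - integral {0..L} (\<lambda>t. m \<bullet> (lap t *\<^sub>R (g (z t) *\<^sub>R \<nu> (z t))))"
    by (simp add: integral_unique)
  moreover have "- integral {0..L} (\<lambda>t. g' (z t) * Y t)
      = integral {0..L} (\<lambda>t. g' (z t) * (2 * (rot90 m \<bullet> (p - z t)) * \<phi>1 ((dist p (z t))\<^sup>2)))"
    unfolding integral_neg[symmetric]
    by (rule arg_cong[of _ _ "integral {0..L}"]) (simp add: Y_def fun_eq_iff inner_diff_right algebra_simps)
  ultimately show ?thesis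
    using inner_int(1)[OF double_layer_gradient(2)[OF Lz gc p]] inner_int(1)[OF il]
    by (simp add: lap_def)
qed

end

section \<open>The normal derivative of the double layer\<close>

lemma grad_eq: "GDERIV f x :> D \<Longrightarrow> grad f x = D"
proof -
  assume D: "GDERIV f x :> D"
  have "E = D" if "GDERIV f x :> E" for E
  proof -
    have "(\<lambda>h. h \<bullet> E) = (\<lambda>h. h \<bullet> D)"
      using that D unfolding gderiv_def by (rule has_derivative_unique)
    then have "\<forall>h. h \<bullet> E = h \<bullet> D" by (simp add: fun_eq_iff)
    then show ?thesis by (simp only: vector_eq_ldot)
  qed
  then show ?thesis unfolding grad_def using D by (intro the_equality)
qed

context C3_boundary
begin

text \<open>The curves are disjoint and simple, so a boundary point lies on one curve only and its
  parameter is unique up to periods; hence derivatives along the boundary do not depend on the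
  parameter that witnesses them.\<close>

lemma has_arc_derivative_param:
  assumes Lz: "(L, z) \<in> \<C>" and d: "has_arc_derivative \<C> g d (z s)"
  shows "((\<lambda>t. g (z t)) has_real_derivative d) (at s)"
proof -
  obtain L' z' s' where z': "(L', z') \<in> \<C>" "z' s' = z s"
      "((\<lambda>t. g (z' t)) has_real_derivative d) (at s')"
    using d unfolding has_arc_derivative_def by auto
  have "(L', z') = (L, z)"
  proof (rule ccontr)
    assume "(L', z') \<noteq> (L, z)"
    from separated[OF z'(1) Lz this] show False using z'(2) by (metis dist_self not_less)
  qed
  then have z'z: "z' = z" by simp
  obtain k :: int where k: "\<bar>s' - (s + of_int k * L)\<bar> \<le> L / 2"
    using nearest_mod_period[OF L_pos[OF Lz]] by blast
  have "s' = s + of_int k * L"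
    by (rule z_eq_imp[OF Lz]) (use k L_pos[OF Lz] z'(2) z'z z_shift[OF Lz] in auto)
  then have "((\<lambda>t. g (z t)) has_real_derivative d) (at (s + of_int k * L))"
    using z'(3) z'z by simp
  then have "((\<lambda>t. g (z (t + of_int k * L))) has_real_derivative d) (at s)"
    by (simp only: DERIV_shift)
  then show ?thesis by (simp only: z_shift[OF Lz])
qed

lemma arc_deriv_eq:
  assumes Lz: "(L, z) \<in> \<C>" and d: "has_arc_derivative \<C> g d (z s)"
  shows "arc_deriv \<C> g (z s) = d"
  unfolding arc_deriv_def
  using has_arc_derivative_param[OF Lz] d by (intro the_equality) (auto intro: DERIV_unique)

lemma C1_Hoelder_deriv:
  assumes Lz: "(L, z) \<in> \<C>" and g: "C1_Hoelder \<C> \<alpha> g"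
  shows "((\<lambda>t. g (z t)) has_real_derivative arc_deriv \<C> g (z s)) (at s)"
    and "\<exists>M. \<forall>x\<in>range z. \<forall>y\<in>range z. \<bar>arc_deriv \<C> g x - arc_deriv \<C> g y\<bar> \<le> M * dist x y powr \<alpha>"
proof -
  have sub: "range z \<subseteq> (\<Union>(L, z)\<in>\<C>. range z)" using Lz by auto
  note g = g[unfolded C1_Hoelder_def]
  have "z s \<in> (\<Union>(L, z)\<in>\<C>. range z)" using sub by blast
  then obtain d where d: "has_arc_derivative \<C> g d (z s)"
    using conjunct1[OF g] by (meson bspec)
  show "((\<lambda>t. g (z t)) has_real_derivative arc_deriv \<C> g (z s)) (at s)"
    unfolding arc_deriv_eq[OF Lz d] by (rule has_arc_derivative_param[OF Lz d])
  obtain M where M: "\<forall>x\<in>(\<Union>(L, z)\<in>\<C>. range z). \<forall>y\<in>(\<Union>(L, z)\<in>\<C>. range z).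
      \<bar>arc_deriv \<C> g x - arc_deriv \<C> g y\<bar> \<le> M * dist x y powr \<alpha>"
    using conjunct2[OF g] by (elim exE) (rule that)
  show "\<exists>M. \<forall>x\<in>range z. \<forall>y\<in>range z. \<bar>arc_deriv \<C> g x - arc_deriv \<C> g y\<bar> \<le> M * dist x y powr \<alpha>"
    by (intro exI[of _ M] ballI M[rule_format] subsetD[OF sub])
qed

end

locale Phi_boundary = C3_boundary \<C> \<nu> + Phi_params \<gamma> \<beta> for \<C> \<nu> \<gamma> \<beta>
begin

sublocale layer: boundary_kernel \<C> \<nu> "phi \<gamma> \<beta> k" "phi1 k" "phi2 k" for k ..

lemma D_op_eq:
  assumes "p \<notin> (\<Union>(L, z)\<in>\<C>. range z)"
  shows "D_op \<C> \<nu> \<gamma> \<beta> k g p =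
    1 / pi * (\<Sum>(L, z)\<in>\<C>. integral {0..L} (\<lambda>t. g (z t) * layer.dipole k (\<nu> (z t)) (z t) p))"
proof -
  have "\<nu> (z t) \<bullet> grad (\<lambda>y. Phi \<gamma> \<beta> k p y) (z t) = layer.dipole k (\<nu> (z t)) (z t) p"
    if "(L, z) \<in> \<C>" for L z t
  proof -
    have "z t \<noteq> p" using assms that by auto
    from grad_eq[OF layer.GDERIV_kernel[OF this]] show ?thesis
      by (simp add: Phi_eq_phi layer.dipole_def)
  qed
  then show ?thesis
    unfolding D_op_def arc_integral_def by (auto intro!: sum.cong)
qed

text \<open>The formula holds for each kernel \<open>\<Phi>\<^sub>k\<close> and each density separately: the gradient of the
  double layer exists off the boundary, and its normal component splits into a tangential
  derivative of a single layer with density \<open>dg/ds\<close> and a continuous potential coming from the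
  Laplacian of the kernel.\<close>

lemma double_layer_normal_derivative:
  assumes Lz0: "(L0, z0) \<in> \<C>" and \<alpha>: "0 < \<alpha>" "\<alpha> < 1" and g: "C1_Hoelder \<C> \<alpha> g"
    and \<Omega>: "open \<Omega>" "\<Omega> \<inter> (\<Union>(L, z)\<in>\<C>. range z) = {}"
    and inside: "\<forall>\<^sub>F h in at_right 0. z0 s - h *\<^sub>R \<nu> (z0 s) \<in> \<Omega>"
  shows "\<exists>d. has_arc_derivative \<C> (S_deriv \<C> \<gamma> \<beta> k g) d (z0 s)"
    and "\<exists>G. (\<forall>p\<in>\<Omega>. GDERIV (D_op \<C> \<nu> \<gamma> \<beta> k g) p :> G p) \<and>
      ((\<lambda>h. \<nu> (z0 s) \<bullet> G (z0 s - h *\<^sub>R \<nu> (z0 s))) \<longlongrightarrow>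
        H_op \<C> \<gamma> \<beta> k g (z0 s) - L_op \<C> \<nu> \<gamma> \<beta> k g (z0 s)) (at_right 0)"
proof -
  define g' where "g' = arc_deriv \<C> g"
  define m where "m = \<nu> (z0 s)"
  define p where "p h = z0 s - h *\<^sub>R m" for h
  have off: "q \<notin> range z" if "q \<in> \<Omega>" "(L, z) \<in> \<C>" for q L z using \<Omega>(2) that by auto
  have gd: "((\<lambda>t. g (z t)) has_real_derivative g' (z t)) (at t)" if "(L, z) \<in> \<C>" for L z t
    unfolding g'_def by (rule C1_Hoelder_deriv(1)[OF that g])
  have gc: "continuous_on S (\<lambda>t. g (z t))" if "(L, z) \<in> \<C>" for L z S
    using gd[OF that] DERIV_isCont continuous_at_imp_continuous_on by blast
  have g'c: "continuous_on S (\<lambda>t. g' (z t))" if Lz: "(L, z) \<in> \<C>" for L z S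
  proof -
    obtain M where "\<forall>x\<in>range z. \<forall>y\<in>range z. \<bar>g' x - g' y\<bar> \<le> M * dist x y powr \<alpha>"
      using C1_Hoelder_deriv(2)[OF Lz g] unfolding g'_def by blast
    then show ?thesis by (rule layer.continuous_on_Hoelder[OF Lz \<alpha>(1)])
  qed
  \<comment> \<open>The contribution of each boundary curve to the derivative of the single layer with density
     \<open>dg/ds\<close>, together with its second description as a limit of regularised kernels.\<close>
  define P where "P L z T \<longleftrightarrow>
      ((\<lambda>s. integral {0..L} (\<lambda>t. g' (z t) * phi \<gamma> \<beta> k ((dist (z0 s) (z t))\<^sup>2)))
        has_real_derivative T) (at s) \<and>
      ((\<lambda>h. integral {0..L} (\<lambda>t. g' (z t) * (2 * (\<tau> (z0 s) \<bullet> (z0 s - z t)) *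
        phi1 k ((dist (z0 s) (z t))\<^sup>2 + h\<^sup>2)))) \<longlongrightarrow> T) (at_right 0)" for L :: real and z T
  define T where "T L z = (SOME T. P L z T)" for L z
  have "P L z (T L z)" if Lz: "(L, z) \<in> \<C>" for L z
  proof -
    obtain M where M: "\<forall>x\<in>range z. \<forall>y\<in>range z. \<bar>g' x - g' y\<bar> \<le> M * dist x y powr \<alpha>"
      using C1_Hoelder_deriv(2)[OF Lz g] unfolding g'_def by blast
    have "\<exists>T. P L z T"
      using layer.single_layer_tangential_derivative[OF Lz0 Lz \<alpha> M, of k]
      unfolding P_def by (elim exE allE[of _ s]) (rule exI)
    then show ?thesis unfolding T_def by (rule someI_ex)
  qed
  note T = conjunct1[OF this[unfolded P_def]] conjunct2[OF this[unfolded P_def]]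
  define d where "d = (\<Sum>(L, z)\<in>\<C>. T L z)"
  have "((\<lambda>s. \<Sum>(L, z)\<in>\<C>. integral {0..L} (\<lambda>t. g' (z t) * phi \<gamma> \<beta> k ((dist (z0 s) (z t))\<^sup>2)))
      has_real_derivative d) (at s)"
    unfolding d_def split_beta by (rule DERIV_sum) (use T(1) in auto)
  then have "((\<lambda>s. S_deriv \<C> \<gamma> \<beta> k g (z0 s)) has_real_derivative d) (at s)"
    by (simp add: S_deriv_def arc_integral_def Phi_eq_phi g'_def)
  then have arc: "has_arc_derivative \<C> (S_deriv \<C> \<gamma> \<beta> k g) d (z0 s)"
    unfolding has_arc_derivative_def using Lz0 by auto
  then show "\<exists>d. has_arc_derivative \<C> (S_deriv \<C> \<gamma> \<beta> k g) d (z0 s)" by blast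
  have H: "H_op \<C> \<gamma> \<beta> k g (z0 s) = 1 / pi * d"
    unfolding H_op_def arc_deriv_eq[OF Lz0 arc] ..

  define G1 where "G1 L z q = integral {0..L} (\<lambda>t. g (z t) *\<^sub>R layer.dipole_grad k (\<nu> (z t)) (z t) q)"
    for L :: real and z q
  define G where "G q = (1 / pi) *\<^sub>R (\<Sum>(L, z)\<in>\<C>. G1 L z q)" for q
  have grad: "GDERIV (D_op \<C> \<nu> \<gamma> \<beta> k g) q :> G q" if q: "q \<in> \<Omega>" for q
  proof -
    have "((\<lambda>q. \<Sum>(L, z)\<in>\<C>. integral {0..L} (\<lambda>t. g (z t) * layer.dipole k (\<nu> (z t)) (z t) q))
        has_derivative (\<lambda>h. \<Sum>(L, z)\<in>\<C>. h \<bullet> G1 L z q)) (at q)"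
      unfolding split_beta
    proof (rule has_derivative_sum)
      fix c assume c: "c \<in> \<C>"
      show "((\<lambda>q. integral {0..fst c} (\<lambda>t. g (snd c t) * layer.dipole k (\<nu> (snd c t)) (snd c t) q))
          has_derivative (\<lambda>h. h \<bullet> G1 (fst c) (snd c) q)) (at q)"
      proof -
        have c': "(fst c, snd c) \<in> \<C>" using c by simp
        show ?thesis
          using layer.double_layer_gradient(1)[OF c' gc[OF c'] off[OF q c'], of k]
          unfolding gderiv_def G1_def .
      qed
    qed
    from has_derivative_mult_right[OF this, of "1 / pi"]
    have "((\<lambda>q. 1 / pi * (\<Sum>(L, z)\<in>\<C>. integral {0..L}
        (\<lambda>t. g (z t) * layer.dipole k (\<nu> (z t)) (z t) q))) has_derivative (\<lambda>h. h \<bullet> G q)) (at q)"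
      by (rule has_derivative_eq_rhs)
        (simp add: G_def fun_eq_iff inner_sum_right split_beta)
    then show ?thesis
      unfolding gderiv_def
    proof (rule has_derivative_transform_within_open[OF _ \<Omega>(1) q])
      show "1 / pi * (\<Sum>(L, z)\<in>\<C>. integral {0..L} (\<lambda>t. g (z t) * layer.dipole k (\<nu> (z t)) (z t) q))
          = D_op \<C> \<nu> \<gamma> \<beta> k g q" if "q \<in> \<Omega>" for q
      proof -
        have "q \<notin> (\<Union>(L, z)\<in>\<C>. range z)" using \<Omega>(2) that by blast
        then show ?thesis by (rule D_op_eq[symmetric])
      qed
    qed
  qed

  \<comment> \<open>The potential with density \<open>g \<nu>\<close> and kernel \<open>\<Sum> \<beta>\<^sub>k\<^sub>-\<^sub>j \<Phi>\<^sub>j = \<Delta> \<Phi>\<^sub>k\<close>, which is continuous up to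
     the boundary and there gives the operator \<open>\<L>\<^sub>k\<close>.\<close>
  define F where "F L z y = (\<Sum>j=0..k. \<beta> (k - j) *\<^sub>R
      integral {0..L} (\<lambda>t. phi \<gamma> \<beta> j ((dist y (z t))\<^sup>2) *\<^sub>R (g (z t) *\<^sub>R \<nu> (z t))))" for L :: real and z y
  have gnc: "continuous_on {0..L} (\<lambda>t. g (z t) *\<^sub>R \<nu> (z t))" if "(L, z) \<in> \<C>" for L z
    by (intro continuous_intros gc[OF that] normal_cont[OF that])
  have F_eq: "integral {0..L} (\<lambda>t. (\<Sum>j=0..k. \<beta> (k - j) * phi \<gamma> \<beta> j ((dist y (z t))\<^sup>2)) *\<^sub>R
      (g (z t) *\<^sub>R \<nu> (z t))) = F L z y"
    if "\<And>j. (\<lambda>t. phi \<gamma> \<beta> j ((dist y (z t))\<^sup>2) *\<^sub>R (g (z t) *\<^sub>R \<nu> (z t))) integrable_on {0..L}" for L z y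
  proof -
    have "integral {0..L} (\<lambda>t. \<Sum>j=0..k. \<beta> (k - j) *\<^sub>R
        (phi \<gamma> \<beta> j ((dist y (z t))\<^sup>2) *\<^sub>R (g (z t) *\<^sub>R \<nu> (z t))))
        = (\<Sum>j=0..k. integral {0..L} (\<lambda>t. \<beta> (k - j) *\<^sub>R
        (phi \<gamma> \<beta> j ((dist y (z t))\<^sup>2) *\<^sub>R (g (z t) *\<^sub>R \<nu> (z t)))))"
      by (rule integral_sum) (intro integrable_cmul that finite_atLeastAtMost)+
    also have "\<dots> = F L z y" unfolding F_def by (simp only: integral_cmul)
    finally show ?thesis by (simp only: scaleR_sum_left scaleR_scaleR sum_distrib_right mult.assoc)
  qed
  have L: "L_op \<C> \<nu> \<gamma> \<beta> k g (z0 s) = 1 / pi * (\<Sum>(L, z)\<in>\<C>. m \<bullet> F L z (z0 s))"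
  proof -
    have "(\<lambda>t. (g (z t) * (\<Sum>j=0..k. \<beta> (k - j) * Phi \<gamma> \<beta> j (z0 s) (z t))) *\<^sub>R \<nu> (z t))
        = (\<lambda>t. (\<Sum>j=0..k. \<beta> (k - j) * phi \<gamma> \<beta> j ((dist (z0 s) (z t))\<^sup>2)) *\<^sub>R (g (z t) *\<^sub>R \<nu> (z t)))" for z :: "real \<Rightarrow> real^2"
      by (simp add: Phi_eq_phi mult.commute)
    then have "integral {0..L} (\<lambda>t. (g (z t) * (\<Sum>j=0..k. \<beta> (k - j) * Phi \<gamma> \<beta> j (z0 s) (z t))) *\<^sub>R \<nu> (z t))
        = F L z (z0 s)" if "(L, z) \<in> \<C>" for L z
      using F_eq[OF layer.potential_normal_limit(1)[OF Lz0 that gnc[OF that]]] by (simp only:)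
    then have "arc_integral \<C> (\<lambda>y. (g y * (\<Sum>j=0..k. \<beta> (k - j) * Phi \<gamma> \<beta> j (z0 s) y)) *\<^sub>R \<nu> y)
        = (\<Sum>(L, z)\<in>\<C>. F L z (z0 s))"
      unfolding arc_integral_def by (auto intro!: sum.cong)
    then show ?thesis
      by (simp add: L_op_def m_def inner_sum_right split_beta)
  qed

  define A where "A L z h = integral {0..L} (\<lambda>t. g' (z t) * (2 * (\<tau> (z0 s) \<bullet> (z0 s - z t)) *
      phi1 k ((dist (p h) (z t))\<^sup>2)))" for L :: real and z h
  have A: "(A L z \<longlongrightarrow> T L z) (at_right 0)" if "(L, z) \<in> \<C>" for L z
    unfolding A_def[abs_def] p_def m_def
    by (rule layer.normal_approach[OF Lz0 that g'c[OF that] T(2)[OF that]])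
  have F: "((\<lambda>h. F L z (p h)) \<longlongrightarrow> F L z (z0 s)) (at_right 0)" if "(L, z) \<in> \<C>" for L z
    unfolding F_def p_def m_def
    by (intro tendsto_intros layer.potential_normal_limit(2)[OF Lz0 that gnc[OF that]])
  \<comment> \<open>Moving along the normal does not change tangential components, so the base point may be
     kept at the boundary in \<open>A\<close>.\<close>
  have split: "m \<bullet> G1 L z (p h) = A L z h - m \<bullet> F L z (p h)"
    if h: "p h \<in> \<Omega>" and Lz: "(L, z) \<in> \<C>" for h L z
  proof -
    have ph: "p h \<notin> range z" by (rule off[OF h Lz])
    then have pos: "0 < (dist (p h) (z t))\<^sup>2" for t by auto
    have "rot90 m \<bullet> (p h - z t) = \<tau> (z0 s) \<bullet> (z0 s - z t)" for t
      using normal_tangent[of "z0 s"]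
      by (simp add: p_def m_def \<tau>_def inner_diff_right inner_commute)
    moreover have "4 * phi1 k ((dist (p h) (z t))\<^sup>2)
        + 4 * (dist (p h) (z t))\<^sup>2 * phi2 k ((dist (p h) (z t))\<^sup>2)
        = (\<Sum>j=0..k. \<beta> (k - j) * phi \<gamma> \<beta> j ((dist (p h) (z t))\<^sup>2))" for t
      by (rule phi_laplace[OF pos])
    moreover have "integral {0..L} (\<lambda>t. (\<Sum>j=0..k. \<beta> (k - j) * phi \<gamma> \<beta> j ((dist (p h) (z t))\<^sup>2)) *\<^sub>R
        (g (z t) *\<^sub>R \<nu> (z t))) = F L z (p h)"
      by (intro F_eq integrable_continuous_interval continuous_intros
          z_cont[OF Lz] gc[OF Lz] normal_cont[OF Lz] pos)
    ultimately show ?thesis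
      using layer.double_layer_normal_component[OF Lz ph gd[OF Lz] g'c[OF Lz], of m k]
      by (simp add: G1_def A_def)
  qed
  have "((\<lambda>h. 1 / pi * (\<Sum>(L, z)\<in>\<C>. A L z h - m \<bullet> F L z (p h))) \<longlongrightarrow>
      1 / pi * (\<Sum>(L, z)\<in>\<C>. T L z - m \<bullet> F L z (z0 s))) (at_right 0)"
    unfolding split_beta using A F by (intro tendsto_intros) auto
  also have "1 / pi * (\<Sum>(L, z)\<in>\<C>. T L z - m \<bullet> F L z (z0 s))
      = H_op \<C> \<gamma> \<beta> k g (z0 s) - L_op \<C> \<nu> \<gamma> \<beta> k g (z0 s)"
    unfolding H L d_def by (simp add: split_beta sum_subtractf right_diff_distrib diff_divide_distrib)
  finally have "((\<lambda>h. m \<bullet> G (p h)) \<longlongrightarrow>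
      H_op \<C> \<gamma> \<beta> k g (z0 s) - L_op \<C> \<nu> \<gamma> \<beta> k g (z0 s)) (at_right 0)"
  proof (rule Lim_transform_eventually)
    show "\<forall>\<^sub>F h in at_right 0. 1 / pi * (\<Sum>(L, z)\<in>\<C>. A L z h - m \<bullet> F L z (p h)) = m \<bullet> G (p h)"
      using inside
    proof eventually_elim
      case (elim h)
      then have "p h \<in> \<Omega>" by (simp add: p_def m_def)
      then have "(\<Sum>(L, z)\<in>\<C>. A L z h - m \<bullet> F L z (p h)) = (\<Sum>(L, z)\<in>\<C>. m \<bullet> G1 L z (p h))"
        using split by (auto intro!: sum.cong)
      then show ?case by (simp add: G_def inner_sum_right split_beta)
    qed
  qed
  with grad show "\<exists>G. (\<forall>p\<in>\<Omega>. GDERIV (D_op \<C> \<nu> \<gamma> \<beta> k g) p :> G p) \<and>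
      ((\<lambda>h. \<nu> (z0 s) \<bullet> G (z0 s - h *\<^sub>R \<nu> (z0 s))) \<longlongrightarrow>
        H_op \<C> \<gamma> \<beta> k g (z0 s) - L_op \<C> \<nu> \<gamma> \<beta> k g (z0 s)) (at_right 0)"
    unfolding p_def m_def by (intro exI[of _ G]) auto
qed

end

theorem theorem2p5:
  fixes \<Omega> :: "(real^2) set" and \<nu> :: "real^2 \<Rightarrow> real^2"
    and \<C> :: "(real \<times> (real \<Rightarrow> real^2)) set"
    and \<kappa> c \<gamma> \<alpha> :: real and \<beta> :: "nat \<Rightarrow> real"
    and q :: "nat \<Rightarrow> real^2 \<Rightarrow> real"
  assumes "bounded_C3_domain \<Omega> \<nu> \<C>"
    and "\<kappa> > 0" and "c > 0"
    and "\<And>n. \<beta> n = \<kappa>\<^sup>2 / c\<^sup>2 * real (n + 1)"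
    and "\<gamma> = \<kappa> / c"
    and "0 < \<alpha>" and "\<alpha> < 1"
    and "\<And>m. C1_Hoelder \<C> \<alpha> (q m)"
  shows "\<forall>x\<in>frontier \<Omega>. \<forall>n.
    (\<forall>m\<le>n. \<exists>d. has_arc_derivative \<C> (S_deriv \<C> \<gamma> \<beta> (n - m) (q m)) d x)
    \<and> has_interior_normal_derivative \<nu>
        (\<lambda>p. \<Sum>m=0..n. D_op \<C> \<nu> \<gamma> \<beta> (n - m) (q m) p)
        (\<Sum>m=0..n. H_op \<C> \<gamma> \<beta> (n - m) (q m) x - L_op \<C> \<nu> \<gamma> \<beta> (n - m) (q m) x)
        x"
proof (intro ballI allI)
  fix x n assume x: "x \<in> frontier \<Omega>"
  have dom: "open \<Omega>" "outward_unit_normal \<Omega> \<nu>" "finite \<C>" "\<forall>(L, z)\<in>\<C>. C3_closed_curve L z"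
    "disjoint_family_on (\<lambda>(L, z). range z) \<C>" "frontier \<Omega> = (\<Union>(L, z)\<in>\<C>. range z)"
    "\<forall>(L, z)\<in>\<C>. \<forall>s. vector_derivative z (at s) = rot90 (\<nu> (z s))"
    using assms(1) unfolding bounded_C3_domain_def by blast+
  interpret Phi_boundary \<C> \<nu> \<gamma> \<beta>
  proof
    show "\<gamma> > 0" using assms by simp
    show "\<beta> 0 = \<gamma>\<^sup>2" using assms(4)[of 0] assms(5) by (simp add: power_divide)
  qed (use dom in auto)
  obtain L0 z0 s where Lz0: "(L0, z0) \<in> \<C>" and xs: "x = z0 s" using x dom(6) by auto
  have disj: "\<Omega> \<inter> (\<Union>(L, z)\<in>\<C>. range z) = {}"
    using dom(1) unfolding dom(6)[symmetric] frontier_def by (auto simp: interior_open)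
  have inside: "\<forall>\<^sub>F h in at_right 0. x - h *\<^sub>R \<nu> x \<in> \<Omega>"
    using dom(2) x unfolding outward_unit_normal_def by (auto elim: eventually_mono)
  note D = double_layer_normal_derivative[OF Lz0 assms(6,7,8) dom(1) disj inside[unfolded xs]]
  have "\<exists>G. \<forall>m. (\<forall>p\<in>\<Omega>. GDERIV (D_op \<C> \<nu> \<gamma> \<beta> (n - m) (q m)) p :> G m p) \<and>
      ((\<lambda>h. \<nu> x \<bullet> G m (x - h *\<^sub>R \<nu> x)) \<longlongrightarrow>
        H_op \<C> \<gamma> \<beta> (n - m) (q m) x - L_op \<C> \<nu> \<gamma> \<beta> (n - m) (q m) x) (at_right 0)"
    unfolding xs by (intro choice allI D(2))
  then obtain G where G: "\<And>m p. p \<in> \<Omega> \<Longrightarrow> GDERIV (D_op \<C> \<nu> \<gamma> \<beta> (n - m) (q m)) p :> G m p"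
    "\<And>m. ((\<lambda>h. \<nu> x \<bullet> G m (x - h *\<^sub>R \<nu> x)) \<longlongrightarrow>
        H_op \<C> \<gamma> \<beta> (n - m) (q m) x - L_op \<C> \<nu> \<gamma> \<beta> (n - m) (q m) x) (at_right 0)"
    by blast
  have u: "GDERIV (\<lambda>p. \<Sum>m=0..n. D_op \<C> \<nu> \<gamma> \<beta> (n - m) (q m) p) p :> (\<Sum>m=0..n. G m p)"
    if "p \<in> \<Omega>" for p
    using G(1)[OF that] unfolding gderiv_def inner_sum_right by (intro has_derivative_sum)
  have "has_interior_normal_derivative \<nu> (\<lambda>p. \<Sum>m=0..n. D_op \<C> \<nu> \<gamma> \<beta> (n - m) (q m) p)
      (\<Sum>m=0..n. H_op \<C> \<gamma> \<beta> (n - m) (q m) x - L_op \<C> \<nu> \<gamma> \<beta> (n - m) (q m) x) x"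
    unfolding has_interior_normal_derivative_def
  proof
    show "\<forall>\<^sub>F h in at_right 0. (\<lambda>p. \<Sum>m=0..n. D_op \<C> \<nu> \<gamma> \<beta> (n - m) (q m) p)
        differentiable at (x - h *\<^sub>R \<nu> x)"
      using inside by eventually_elim (use u in \<open>auto simp: gderiv_def differentiable_def\<close>)
    have "((\<lambda>h. \<Sum>m=0..n. \<nu> x \<bullet> G m (x - h *\<^sub>R \<nu> x)) \<longlongrightarrow>
        (\<Sum>m=0..n. H_op \<C> \<gamma> \<beta> (n - m) (q m) x - L_op \<C> \<nu> \<gamma> \<beta> (n - m) (q m) x)) (at_right 0)"
      by (intro tendsto_sum G(2))
    then show "((\<lambda>h. \<nu> x \<bullet> grad (\<lambda>p. \<Sum>m=0..n. D_op \<C> \<nu> \<gamma> \<beta> (n - m) (q m) p) (x - h *\<^sub>R \<nu> x)) \<longlongrightarrow>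
        (\<Sum>m=0..n. H_op \<C> \<gamma> \<beta> (n - m) (q m) x - L_op \<C> \<nu> \<gamma> \<beta> (n - m) (q m) x)) (at_right 0)"
    proof (rule Lim_transform_eventually)
      show "\<forall>\<^sub>F h in at_right 0. (\<Sum>m=0..n. \<nu> x \<bullet> G m (x - h *\<^sub>R \<nu> x)) =
          \<nu> x \<bullet> grad (\<lambda>p. \<Sum>m=0..n. D_op \<C> \<nu> \<gamma> \<beta> (n - m) (q m) p) (x - h *\<^sub>R \<nu> x)"
        using inside by eventually_elim (simp add: grad_eq[OF u] inner_sum_right)
    qed
  qed
  then show "(\<forall>m\<le>n. \<exists>d. has_arc_derivative \<C> (S_deriv \<C> \<gamma> \<beta> (n - m) (q m)) d x)
    \<and> has_interior_normal_derivative \<nu>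
        (\<lambda>p. \<Sum>m=0..n. D_op \<C> \<nu> \<gamma> \<beta> (n - m) (q m) p)
        (\<Sum>m=0..n. H_op \<C> \<gamma> \<beta> (n - m) (q m) x - L_op \<C> \<nu> \<gamma> \<beta> (n - m) (q m) x)
        x"
    using D(1) xs by auto
qed

end
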